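(* For component 3994 of $G(9)$, the nontrivial cycles in the cycle basis produce the following commutativity property, which transposes the indeterminates $\{d,f\}$: $$( a \bullet b ) \circ ( c \bullet ( ( d \bullet e ) \circ ( f \bullet g ) \circ ( h \bullet i ) ) ) \equiv ( a \bullet b ) \circ ( c \bullet ( ( f \bullet e ) \circ ( d \bullet g ) \circ ( h \bullet i ) ) ),$$ that is, in terms of geometric realizations, $$\begin{bmatrix} \begin{bmatrix} a \\ b \end{bmatrix} & \begin{bmatrix} & c & \\ \begin{bmatrix} d \\ e \end{bmatrix} & \begin{bmatrix} f \\ g \end{bmatrix} & \begin{bmatrix} h \\ i \end{bmatrix} \end{bmatrix} \end{bmatrix} \equiv \begin{bmatrix} \begin{bmatrix} a \\ b \end{bmatrix} & \begin{bmatrix} & c & \\ \begin{bmatrix} f \\ e \end{bmatrix} & \begin{bmatrix} d \\ g \end{bmatrix} & \begin{bmatrix} h \\ i \end{bmatrix} \end{bmatrix} \end{bmatrix}.$$ The action of the dihedral group $D_8$ induces bijections between the components of type 3 (components 3994 to 4001), and so all eight components have corresponding identities.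
   Context: A double semigroup is a set $S$ with two associative binary operations $\circ,\bullet$ satisfying the interchange relation $(a\bullet b)\circ(c\bullet d)\equiv(a\circ c)\bullet(b\circ d)$ for all $a,b,c,d\in S$; no units are assumed. The symbol $\equiv$ means that the equation holds for all values of the variables. Geometric realization: $\circ$ is horizontal composition (left to right) and $\bullet$ is vertical composition (top to bottom) of boxes; row vectors denote horizontal composition and column vectors denote vertical composition (in the diagrams of the claim, $c$ is placed above the row of the three columns next to it). The dihedral group $D_8$, of order 8, is the symmetry group of the square; it acts on geometric realizations by rotations and reflections. Association types of degree $n$ are the possible placements of balanced parentheses and operation symbols in a monomial of degree $n$ with two associative operations $\circ,\bullet$ (the interchange relation is not imposed). A multilinear monomial of degree $n$ is an association type of degree $n$ whose positions, from left to right, are filled with a permutation of $n$ fixed indeterminates. Total order on association types: products of more than two factors by the same operation are parenthesized to the right, so each type of degree at least 2 is uniquely $t'\circ t''$ or $t'\bullet t''$. Lower degree comes first; in equal degree, $\circ$ at the root precedes $\bullet$ at the root; with the same root operation, compare $t'$ first and then $t''$, recursively. The index number of an association type is its position in this order among types of its degree. $F(n)$ is the directed graph whose vertices are the multilinear monomials of degree $n$, with an edge $m\to m'$ whenever $m$ can be converted into $m'$ by one application of the interchange relation (modulo associativity, to a submonomial $(w\bullet x)\circ(y\bullet z)$ or $(w\circ y)\bullet(x\circ z)$ with $w,x,y,z$ arbitrary monomials); every edge has a reverse edge. The symmetric group $S_n$ acts freely on $F(n)$ by permuting positions of indeterminates. $G(n)$ is the quotient graph; its vertices are the association types, and its edges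 are labelled by the corresponding permutations of positions, reverse edges having inverse labels. A directed cycle in $G(n)$ is nontrivial if the product of the permutations along its edges is not the identity. A commutativity property in degree $n$ corresponds to a nontrivial cycle: if the cycle passes through association type $t$, regarding $t$ as its first and last vertex gives a property $m\equiv m'$ in which both monomials have association type $t$ but different permutations of the indeterminates. $G(9)$ has 4001 connected components that are not isolated vertices. They are sorted first by number of vertices and then by minimal vertex in the total order; "component $N$" is the $N$-th in this list. Cycle basis: a set of cycles generating all cycles of the component by repeated symmetric differences; its size is the circuit rank $r$. The cycle basis used for each component is chosen as follows: take the basis computed by the command CycleBasis of the Maple package GraphTheory; convert it to an $r\times e$ matrix over $\mathbb{F}_2$, where $e$ is the number of edges of the component (a pair of mutually reverse edges counted once) and the $(i,j)$ entry is 1 if and only if cycle $i$ contains edge $j$; compute the row canonical form; and use the cycles represented by its rows. Component 3994 has 120 vertices, 149 edges and circuit rank 30, and 3 of the cycles in this basis are nontrivial. None of these 3 nontrivial basis cycles contains the association type of the left side of the displayed identity (index number 9559), but there is a directed path $\epsilon_1\epsilon_2$ from it, through the vertex with index number 9569, to the vertex with index number 9771, which belongs to all three. The nontrivial cycles are therefore made to start and end at vertex 9559 by following $\epsilon_1\epsilon_2$, then the basis cycle, then returning by $\epsilon_2^{-1}\epsilon_1^{-1}$. The eight components of type 3 contain the following representative association types (positions indicated by alphabetical order of the indeterminates): 3994: $( a \bullet b ) \circ ( c \bullet ( ( d \bullet e ) \circ ( f \bullet g ) \circ ( h \bullet i ) ) )$; 3995: $( a \circ b ) \bullet ( c \circ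 ( ( d \circ e ) \bullet ( f \circ g ) \bullet ( h \circ i ) ) )$; 3996: $( a \circ ( ( b \circ c ) \bullet ( d \circ e ) \bullet ( f \circ g ) ) ) \bullet ( h \circ i )$; 3997: $( a \bullet b ) \circ ( ( ( c \bullet d ) \circ ( e \bullet f ) \circ ( g \bullet h ) ) \bullet i )$; 3998: $( a \bullet ( ( b \bullet c ) \circ ( d \bullet e ) \circ ( f \bullet g ) ) ) \circ ( h \bullet i )$; 3999: $( ( ( a \bullet b ) \circ ( c \bullet d ) \circ ( e \bullet f ) ) \bullet g ) \circ ( h \bullet i )$; 4000: $( a \circ b ) \bullet ( ( ( c \circ d ) \bullet ( e \circ f ) \bullet ( g \circ h ) ) \circ i )$; 4001: $( ( ( a \circ b ) \bullet ( ( c \circ d ) \bullet ( e \circ f ) ) ) \circ g ) \bullet ( h \circ i )$. *)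

theory Defs
  imports
    "Graph_Theory.Digraph_Component"
    "Jordan_Normal_Form.Gauss_Jordan_Elimination"
    "HOL-Combinatorics.Permutations"
    "HOL-Library.Z2"
begin

definition double_semigroup :: "'a set \<Rightarrow> ('a \<Rightarrow> 'a \<Rightarrow> 'a) \<Rightarrow> ('a \<Rightarrow> 'a \<Rightarrow> 'a) \<Rightarrow> bool" where
  "double_semigroup S hc vc \<longleftrightarrow>
     (\<forall>x\<in>S. \<forall>y\<in>S. hc x y \<in> S \<and> vc x y \<in> S) \<and>
     (\<forall>x\<in>S. \<forall>y\<in>S. \<forall>z\<in>S. hc (hc x y) z = hc x (hc y z)) \<and>
     (\<forall>x\<in>S. \<forall>y\<in>S. \<forall>z\<in>S. vc (vc x y) z = vc x (vc y z)) \<and>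
     (\<forall>a\<in>S. \<forall>b\<in>S. \<forall>c\<in>S. \<forall>d\<in>S. hc (vc a b) (vc c d) = vc (hc a c) (hc b d))"

text \<open>
  The operation written with a bold circle is horizontal composition (left to right), the one
  written with a bold bullet is vertical composition (top to bottom).
\<close>

datatype 'x monomial =
    Var 'x
  | HComp "'x monomial" "'x monomial"  (infixr \<open>\<^bold>\<circ>\<close> 75)
  | VComp "'x monomial" "'x monomial"  (infixr \<open>\<^bold>\<bullet>\<close> 75)

primrec eval :: "('a \<Rightarrow> 'a \<Rightarrow> 'a) \<Rightarrow> ('a \<Rightarrow> 'a \<Rightarrow> 'a) \<Rightarrow> ('x \<Rightarrow> 'a) \<Rightarrow> 'x monomial \<Rightarrow> 'a" where
  "eval hc vc val (Var x) = val x"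
| "eval hc vc val (p \<^bold>\<circ> q) = hc (eval hc vc val p) (eval hc vc val q)"
| "eval hc vc val (p \<^bold>\<bullet> q) = vc (eval hc vc val p) (eval hc vc val q)"

definition satisfies ::
  "'a set \<Rightarrow> ('a \<Rightarrow> 'a \<Rightarrow> 'a) \<Rightarrow> ('a \<Rightarrow> 'a \<Rightarrow> 'a) \<Rightarrow> 'x monomial \<Rightarrow> 'x monomial \<Rightarrow> bool" where
  "satisfies S hc vc m m' \<longleftrightarrow>
     (\<forall>val. (\<forall>x \<in> set_monomial m \<union> set_monomial m'. val x \<in> S) \<longrightarrow>
        eval hc vc val m = eval hc vc val m')"

primrec word :: "'x monomial \<Rightarrow> 'x list" where
  "word (Var x) = [x]"
| "word (p \<^bold>\<circ> q) = word p @ word q"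
| "word (p \<^bold>\<bullet> q) = word p @ word q"

definition mdegree :: "'x monomial \<Rightarrow> nat" where
  "mdegree m = length (word m)"

inductive assoc_eq :: "'x monomial \<Rightarrow> 'x monomial \<Rightarrow> bool"  (infix \<open>\<approx>\<close> 50) where
  refl: "p \<approx> p"
| sym: "p \<approx> q \<Longrightarrow> q \<approx> p"
| trans: "p \<approx> q \<Longrightarrow> q \<approx> r \<Longrightarrow> p \<approx> r"
| hassoc: "(p \<^bold>\<circ> q) \<^bold>\<circ> r \<approx> p \<^bold>\<circ> (q \<^bold>\<circ> r)"
| vassoc: "(p \<^bold>\<bullet> q) \<^bold>\<bullet> r \<approx> p \<^bold>\<bullet> (q \<^bold>\<bullet> r)"
| hcong: "p \<approx> p' \<Longrightarrow> q \<approx> q' \<Longrightarrow> p \<^bold>\<circ> q \<approx> p' \<^bold>\<circ> q'"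
| vcong: "p \<approx> p' \<Longrightarrow> q \<approx> q' \<Longrightarrow> p \<^bold>\<bullet> q \<approx> p' \<^bold>\<bullet> q'"

text \<open>
  Products of more than two factors by the same operation are parenthesized to the right;
  every associativity class contains exactly one such monomial.
\<close>

primrec right_normal :: "'x monomial \<Rightarrow> bool" where
  "right_normal (Var x) \<longleftrightarrow> True"
| "right_normal (p \<^bold>\<circ> q) \<longleftrightarrow> right_normal p \<and> right_normal q \<and> (\<nexists>u v. p = u \<^bold>\<circ> v)"
| "right_normal (p \<^bold>\<bullet> q) \<longleftrightarrow> right_normal p \<and> right_normal q \<and> (\<nexists>u v. p = u \<^bold>\<bullet> v)"

definition normal_form :: "'x monomial \<Rightarrow> 'x monomial" where
  "normal_form m = (THE m'. right_normal m' \<and> m \<approx> m')"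

type_synonym assoc_type = "unit monomial"

definition assoc_types :: "nat \<Rightarrow> assoc_type set" where
  "assoc_types n = {t. right_normal t \<and> mdegree t = n}"

definition type_of :: "'x monomial \<Rightarrow> assoc_type" where
  "type_of m = map_monomial (\<lambda>_. ()) m"

definition multilinear :: "nat \<Rightarrow> nat monomial set" where
  "multilinear n = {m. right_normal m \<and> distinct (word m) \<and> set (word m) = {..<n}}"

primrec type_less :: "assoc_type \<Rightarrow> assoc_type \<Rightarrow> bool" where
  "type_less (Var x) t \<longleftrightarrow> 1 < mdegree t"
| "type_less (p \<^bold>\<circ> q) t \<longleftrightarrow> mdegree (p \<^bold>\<circ> q) < mdegree t \<or> mdegree (p \<^bold>\<circ> q) = mdegree t \<and>
     (case t of Var y \<Rightarrow> False
      | p' \<^bold>\<circ> q' \<Rightarrow> type_less p p' \<or> p = p' \<and> type_less q q'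
      | p' \<^bold>\<bullet> q' \<Rightarrow> True)"
| "type_less (p \<^bold>\<bullet> q) t \<longleftrightarrow> mdegree (p \<^bold>\<bullet> q) < mdegree t \<or> mdegree (p \<^bold>\<bullet> q) = mdegree t \<and>
     (case t of Var y \<Rightarrow> False
      | p' \<^bold>\<circ> q' \<Rightarrow> False
      | p' \<^bold>\<bullet> q' \<Rightarrow> type_less p p' \<or> p = p' \<and> type_less q q')"

definition index_number :: "assoc_type \<Rightarrow> nat" where
  "index_number t = card {s \<in> assoc_types (mdegree t). type_less s t} + 1"

inductive interchange :: "'x monomial \<Rightarrow> 'x monomial \<Rightarrow> bool" where
  h_to_v: "interchange ((w \<^bold>\<bullet> x) \<^bold>\<circ> (y \<^bold>\<bullet> z)) ((w \<^bold>\<circ> y) \<^bold>\<bullet> (x \<^bold>\<circ> z))"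
| v_to_h: "interchange ((w \<^bold>\<circ> y) \<^bold>\<bullet> (x \<^bold>\<circ> z)) ((w \<^bold>\<bullet> x) \<^bold>\<circ> (y \<^bold>\<bullet> z))"
| h_left: "interchange p p' \<Longrightarrow> interchange (p \<^bold>\<circ> q) (p' \<^bold>\<circ> q)"
| h_right: "interchange q q' \<Longrightarrow> interchange (p \<^bold>\<circ> q) (p \<^bold>\<circ> q')"
| v_left: "interchange p p' \<Longrightarrow> interchange (p \<^bold>\<bullet> q) (p' \<^bold>\<bullet> q)"
| v_right: "interchange q q' \<Longrightarrow> interchange (p \<^bold>\<bullet> q) (p \<^bold>\<bullet> q')"

definition F_graph :: "nat \<Rightarrow> (nat monomial, nat monomial \<times> nat monomial) pre_digraph" where
  "F_graph n =
     \<lparr> verts = multilinear n,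
       arcs = {(m, m'). m \<in> multilinear n \<and> m' \<in> multilinear n \<and>
                 (\<exists>u v. m \<approx> u \<and> interchange u v \<and> v \<approx> m')},
       tail = fst, head = snd \<rparr>"

text \<open>
  In an arc (t, s, t') of G(n) the label s is the permutation of positions {0, ..., n - 1}
  such that position i of the target is filled by the indeterminate in position s(i) of the source.
  All edges of F(n) that differ only by a renaming of the indeterminates give the same arc.
\<close>

type_synonym G_arc = "assoc_type \<times> (nat \<Rightarrow> nat) \<times> assoc_type"

definition G_graph :: "nat \<Rightarrow> (assoc_type, G_arc) pre_digraph" where
  "G_graph n =
     \<lparr> verts = assoc_types n,
       arcs = {(type_of m, \<sigma>, type_of m') | m m' \<sigma>.
                 (m, m') \<in> arcs (F_graph n) \<and> \<sigma> permutes {..<n} \<and>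
                 word m' = permute_list \<sigma> (word m)},
       tail = (\<lambda>(t, \<sigma>, t'). t), head = (\<lambda>(t, \<sigma>, t'). t') \<rparr>"

definition label :: "G_arc \<Rightarrow> nat \<Rightarrow> nat" where
  "label = (\<lambda>(t, \<sigma>, t'). \<sigma>)"

definition reverse_arc :: "G_arc \<Rightarrow> G_arc" where
  "reverse_arc = (\<lambda>(t, \<sigma>, t'). (t', inv_into UNIV \<sigma>, t))"

definition reverse_walk :: "G_arc list \<Rightarrow> G_arc list" where
  "reverse_walk p = rev (map reverse_arc p)"

text \<open>
  As permute_list f (permute_list g xs) is permute_list (g o f) xs, this product describes
  the effect of following the walk from its first to its last arc.
\<close>

definition label_product :: "G_arc list \<Rightarrow> nat \<Rightarrow> nat" where
  "label_product p = foldr (\<lambda>e \<sigma>. label e \<circ> \<sigma>) p id"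

text \<open>
  Every arc of G(n) has a reverse arc, so the strongly connected components are the connected
  components. There are no loops, so the isolated vertices are the components of size 1.
\<close>

definition nonisolated_components :: "nat \<Rightarrow> assoc_type set set" where
  "nonisolated_components n = {C \<in> pre_digraph.sccs_verts (G_graph n). 2 \<le> card C}"

definition component_before :: "assoc_type set \<Rightarrow> assoc_type set \<Rightarrow> bool" where
  "component_before C D \<longleftrightarrow> card C < card D \<or>
     card C = card D \<and> Min (index_number ` C) < Min (index_number ` D)"

definition component :: "nat \<Rightarrow> nat \<Rightarrow> assoc_type set" where
  "component n N = (THE C. C \<in> nonisolated_components n \<and>
     card {D \<in> nonisolated_components n. component_before D C} + 1 = N)"

abbreviation component_graph :: "nat \<Rightarrow> nat \<Rightarrow> (assoc_type, G_arc) pre_digraph" where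
  "component_graph n N \<equiv> G_graph n \<restriction> component n N"

text \<open>A pair of mutually reverse arcs counts as one edge.\<close>

definition edge :: "G_arc \<Rightarrow> G_arc set" where
  "edge e = {e, reverse_arc e}"

definition edges :: "(assoc_type, G_arc) pre_digraph \<Rightarrow> G_arc set set" where
  "edges H = edge ` arcs H"

definition traverses ::
  "(assoc_type, G_arc) pre_digraph \<Rightarrow> G_arc list \<Rightarrow> G_arc set set \<Rightarrow> bool" where
  "traverses H \<gamma> C \<longleftrightarrow>
     pre_digraph.cycle H \<gamma> \<and> distinct (map edge \<gamma>) \<and> C = edge ` set \<gamma>"

definition cycles :: "(assoc_type, G_arc) pre_digraph \<Rightarrow> G_arc set set set" where
  "cycles H = {C. \<exists>\<gamma>. traverses H \<gamma> C}"

definition nontrivial :: "(assoc_type, G_arc) pre_digraph \<Rightarrow> G_arc set set \<Rightarrow> bool" where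
  "nontrivial H C \<longleftrightarrow> (\<exists>\<gamma>. traverses H \<gamma> C \<and> label_product \<gamma> \<noteq> id)"

definition circuit_rank :: "(assoc_type, G_arc) pre_digraph \<Rightarrow> nat" where
  "circuit_rank H = card (edges H) + 1 - card (verts H)"  \<comment> \<open>for connected H\<close>

definition symmetric_difference :: "'b set list \<Rightarrow> 'b set" where
  "symmetric_difference Cs = foldr (\<lambda>A B. (A - B) \<union> (B - A)) Cs {}"

definition is_cycle_basis :: "(assoc_type, G_arc) pre_digraph \<Rightarrow> G_arc set set list \<Rightarrow> bool" where
  "is_cycle_basis H cs \<longleftrightarrow>
     distinct cs \<and> set cs \<subseteq> cycles H \<and> length cs = circuit_rank H \<and>
     (\<forall>C \<in> cycles H. \<exists>Cs. set Cs \<subseteq> set cs \<and> C = symmetric_difference Cs)"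

definition incidence_matrix :: "'b list \<Rightarrow> 'b set list \<Rightarrow> bit mat" where
  "incidence_matrix es cs =
     mat (length cs) (length es) (\<lambda>(i, j). if es ! j \<in> cs ! i then 1 else 0)"

text \<open>
  The edge sets represented by the rows of the row canonical form of the matrix of the cycle basis
  cs, where es enumerates the edges in the order of the columns.  They depend on es, but not on
  the choice of the basis cs.
\<close>

definition canonical_cycles :: "'b list \<Rightarrow> 'b set list \<Rightarrow> 'b set set" where
  "canonical_cycles es cs =
     {{es ! j | j. j < length es \<and> gauss_jordan_single (incidence_matrix es cs) $$ (i, j) = 1}
      | i. i < length cs}"

text \<open>
  Follow \<open>\<epsilon>\<close> from the type of m to a vertex of the closed walk \<open>\<gamma>\<close>, then \<open>\<gamma>\<close>, then return
  by \<open>\<epsilon>\<close> reversed: this turns m into m', which has the same type.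
\<close>

definition produces_property ::
  "nat \<Rightarrow> G_arc list \<Rightarrow> G_arc list \<Rightarrow> nat monomial \<Rightarrow> nat monomial \<Rightarrow> bool" where
  "produces_property n \<epsilon> \<gamma> m m' \<longleftrightarrow>
     m \<in> multilinear n \<and> m' \<in> multilinear n \<and> type_of m' = type_of m \<and>
     (\<exists>v. pre_digraph.awalk (G_graph n) (type_of m) \<epsilon> v \<and>
          pre_digraph.awalk (G_graph n) v \<gamma> v) \<and>
     label_product \<gamma> \<noteq> id \<and>
     word m' = permute_list (label_product (\<epsilon> @ \<gamma> @ reverse_walk \<epsilon>)) (word m)"

fun row_vector :: "'x monomial list \<Rightarrow> 'x monomial" where
  "row_vector [p] = p"
| "row_vector (p # q # ps) = p \<^bold>\<circ> row_vector (q # ps)"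

fun column_vector :: "'x monomial list \<Rightarrow> 'x monomial" where
  "column_vector [p] = p"
| "column_vector (p # q # ps) = p \<^bold>\<bullet> column_vector (q # ps)"

text \<open>
  A clockwise quarter turn moves the left box of a horizontal composition to the top and the
  top box of a vertical composition to the right; the reflection exchanges left and right.
\<close>

primrec rotate_boxes :: "'x monomial \<Rightarrow> 'x monomial" where
  "rotate_boxes (Var x) = Var x"
| "rotate_boxes (p \<^bold>\<circ> q) = rotate_boxes p \<^bold>\<bullet> rotate_boxes q"
| "rotate_boxes (p \<^bold>\<bullet> q) = rotate_boxes q \<^bold>\<circ> rotate_boxes p"

primrec reflect_boxes :: "'x monomial \<Rightarrow> 'x monomial" where
  "reflect_boxes (Var x) = Var x"
| "reflect_boxes (p \<^bold>\<circ> q) = reflect_boxes q \<^bold>\<circ> reflect_boxes p"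
| "reflect_boxes (p \<^bold>\<bullet> q) = reflect_boxes p \<^bold>\<bullet> reflect_boxes q"

text \<open>The pair (k, l) stands for the reflection applied l times, followed by k quarter turns.\<close>

definition D8 :: "(nat \<times> nat) set" where
  "D8 = {..<4} \<times> {..<2}"

definition D8_act :: "nat \<times> nat \<Rightarrow> 'x monomial \<Rightarrow> 'x monomial" where
  "D8_act = (\<lambda>(k, l) m. normal_form ((rotate_boxes ^^ k) ((reflect_boxes ^^ l) m)))"

text \<open>
  The second conjunct says that the part of F(n) lying over C is carried isomorphically to the
  part lying over D, and so determines the labelled edges of the component D of G(n).
\<close>

definition induces_bijection ::
  "nat \<Rightarrow> nat \<times> nat \<Rightarrow> assoc_type set \<Rightarrow> assoc_type set \<Rightarrow> bool" where
  "induces_bijection n g C D \<longleftrightarrow>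
     bij_betw (D8_act g) C D \<and>
     (\<forall>m \<in> multilinear n. \<forall>m' \<in> multilinear n. type_of m \<in> C \<and> type_of m' \<in> C \<longrightarrow>
        ((m, m') \<in> arcs (F_graph n) \<longleftrightarrow> (D8_act g m, D8_act g m') \<in> arcs (F_graph n)))"

definition monomial_3994 ::
  "'x \<Rightarrow> 'x \<Rightarrow> 'x \<Rightarrow> 'x \<Rightarrow> 'x \<Rightarrow> 'x \<Rightarrow> 'x \<Rightarrow> 'x \<Rightarrow> 'x \<Rightarrow> 'x monomial" where
  "monomial_3994 a b c d e f g h i =
     (Var a \<^bold>\<bullet> Var b) \<^bold>\<circ>
     (Var c \<^bold>\<bullet> ((Var d \<^bold>\<bullet> Var e) \<^bold>\<circ> (Var f \<^bold>\<bullet> Var g) \<^bold>\<circ> (Var h \<^bold>\<bullet> Var i)))"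

text \<open>The indeterminates a, ..., i are 0, ..., 8; in particular d is 3 and f is 5.\<close>

definition left_side :: "nat monomial" where
  "left_side = monomial_3994 0 1 2 3 4 5 6 7 8"

definition right_side :: "nat monomial" where
  "right_side = monomial_3994 0 1 2 5 4 3 6 7 8"

end

theory Submission
  imports Defs
begin

text \<open>
  Two association types are connected in G(n) iff they are related by associativity and
  interchange. The dihedral group acts on G(9) by automorphisms, and the nonisolated components
  fall into 594 orbits. Searching from one representative of each orbit yields 4001 pairwise
  disjoint components with 27528 vertices altogether; as a recursion on root operations shows,
  this is the number of association types that admit an interchange, so there are no other
  components. The eight largest ones form one orbit, whose smallest vertex lies in the component
  of the left side.

  Over each association type in that component lie exactly two of the monomials that can be
  reached from the left side; over its own type these are the two sides of the identity. So the
  label product of a closed walk is determined by a parity, which is additive on symmetric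
  differences of cycles. The nonempty rows of the row canonical form are minimal elements of the
  cycle space, hence simple cycles, and some row is odd because some cycle is.
\<close>

text \<open>The basis in the claim is the output of a computer algebra system, so the theorem
  quantifies over all cycle bases and all orders of the columns. Two facts make this possible. Row
  reduction preserves the kernel of a matrix, and over F_2 membership in a span can be tested
  dually: by the sets of edges that meet every generator in an even number of edges. The linear
  algebra below is therefore phrased with such parities (\<open>odd_on\<close>), not with vector
  spaces of edge sets.

  The two monomials over each type form a double cover of the component. A closed walk fixes or
  exchanges the two sheets, so every nontrivial one, moved to the type of the left side along any
  path, yields the right side.

  The other obstacle is size, since everything is evaluated by the simplifier. Searching is confined
  to one component per orbit, and completeness rests on a count that never enumerates the
  association types. That no orbit is listed twice follows from the strictly increasing minima of
  the listed orbits, without comparing orbits with each other.\<close>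

section \<open>Normal forms and single interchanges\<close>

text \<open>This is list append for the horizontal factors of a right-nested product:
  \<open>r\<close> goes to the end of the right spine of \<open>p\<close>. Unlike plain composition,
  it keeps right-normal monomials right-normal.\<close>

primrec hjoin :: "'x monomial \<Rightarrow> 'x monomial \<Rightarrow> 'x monomial" where
  "hjoin (Var x) r = Var x \<^bold>\<circ> r"
| "hjoin (p \<^bold>\<circ> q) r = p \<^bold>\<circ> hjoin q r"
| "hjoin (p \<^bold>\<bullet> q) r = (p \<^bold>\<bullet> q) \<^bold>\<circ> r"

primrec vjoin :: "'x monomial \<Rightarrow> 'x monomial \<Rightarrow> 'x monomial" where
  "vjoin (Var x) r = Var x \<^bold>\<bullet> r"
| "vjoin (p \<^bold>\<circ> q) r = (p \<^bold>\<circ> q) \<^bold>\<bullet> r"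
| "vjoin (p \<^bold>\<bullet> q) r = p \<^bold>\<bullet> vjoin q r"

primrec normalize :: "'x monomial \<Rightarrow> 'x monomial" where
  "normalize (Var x) = Var x"
| "normalize (p \<^bold>\<circ> q) = hjoin (normalize p) (normalize q)"
| "normalize (p \<^bold>\<bullet> q) = vjoin (normalize p) (normalize q)"

lemma hjoin_assoc: "hjoin (hjoin p q) r = hjoin p (hjoin q r)"
  by (induct p) auto

lemma vjoin_assoc: "vjoin (vjoin p q) r = vjoin p (vjoin q r)"
  by (induct p) auto

lemma hjoin_is_HComp: "\<exists>u v. hjoin p q = u \<^bold>\<circ> v"
  by (cases p) auto

lemma vjoin_is_VComp: "\<exists>u v. vjoin p q = u \<^bold>\<bullet> v"
  by (cases p) auto

lemma hjoin_vjoin: "hjoin (vjoin p q) r = vjoin p q \<^bold>\<circ> r"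
  by (cases p) auto

lemma vjoin_hjoin: "vjoin (hjoin p q) r = hjoin p q \<^bold>\<bullet> r"
  by (cases p) auto

lemma hjoin_eq_HComp: "(\<nexists>u v. p = u \<^bold>\<circ> v) \<Longrightarrow> hjoin p q = p \<^bold>\<circ> q"
  by (cases p) auto

lemma vjoin_eq_VComp: "(\<nexists>u v. p = u \<^bold>\<bullet> v) \<Longrightarrow> vjoin p q = p \<^bold>\<bullet> q"
  by (cases p) auto

lemma right_normal_hjoin: "right_normal p \<Longrightarrow> right_normal q \<Longrightarrow> right_normal (hjoin p q)"
  by (induct p) auto

lemma right_normal_vjoin: "right_normal p \<Longrightarrow> right_normal q \<Longrightarrow> right_normal (vjoin p q)"
  by (induct p) auto

lemma right_normal_normalize: "right_normal (normalize m)"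
  by (induct m) (auto simp: right_normal_hjoin right_normal_vjoin)

lemma normalize_right_normal: "right_normal m \<Longrightarrow> normalize m = m"
  by (induct m) (auto simp: hjoin_eq_HComp vjoin_eq_VComp)

lemma hjoin_approx: "p \<^bold>\<circ> q \<approx> hjoin p q"
proof (induct p)
  case (HComp a b)
  then show ?case
    using assoc_eq.trans[OF assoc_eq.hassoc assoc_eq.hcong[OF assoc_eq.refl HComp(2)]] by simp
qed (simp_all add: assoc_eq.refl)

lemma vjoin_approx: "p \<^bold>\<bullet> q \<approx> vjoin p q"
proof (induct p)
  case (VComp a b)
  then show ?case
    using assoc_eq.trans[OF assoc_eq.vassoc assoc_eq.vcong[OF assoc_eq.refl VComp(2)]] by simp
qed (simp_all add: assoc_eq.refl)

lemma normalize_approx: "m \<approx> normalize m"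
proof (induct m)
  case (HComp p q)
  then show ?case
    using assoc_eq.trans[OF assoc_eq.hcong hjoin_approx] by simp
next
  case (VComp p q)
  then show ?case
    using assoc_eq.trans[OF assoc_eq.vcong vjoin_approx] by simp
qed (simp add: assoc_eq.refl)

text \<open>\<open>hjoin\<close> and \<open>vjoin\<close> are associative, so
  \<open>normalize\<close> is constant on associativity classes. As it fixes right-normal monomials,
  each class contains only one of them, and the \<open>THE\<close> in \<open>normal_form\<close> is
  well defined.\<close>

lemma approx_imp_normalize_eq: "p \<approx> q \<Longrightarrow> normalize p = normalize q"
  by (induct rule: assoc_eq.induct) (auto simp: hjoin_assoc vjoin_assoc)

lemma normal_form_eq_normalize: "normal_form m = normalize m"
  unfolding normal_form_def
proof (rule the_equality)
  show "right_normal (normalize m) \<and> m \<approx> normalize m"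
    by (simp add: right_normal_normalize normalize_approx)
qed (metis approx_imp_normalize_eq normalize_right_normal)

lemma word_hjoin [simp]: "word (hjoin p q) = word p @ word q"
  by (induct p) auto

lemma word_vjoin [simp]: "word (vjoin p q) = word p @ word q"
  by (induct p) auto

lemma word_normalize [simp]: "word (normalize m) = word m"
  by (induct m) auto

lemma approx_word: "p \<approx> q \<Longrightarrow> word p = word q"
  using approx_imp_normalize_eq word_normalize by metis

lemma map_monomial_hjoin:
  "map_monomial f (hjoin p q) = hjoin (map_monomial f p) (map_monomial f q)"
  by (induct p) auto

lemma map_monomial_vjoin:
  "map_monomial f (vjoin p q) = vjoin (map_monomial f p) (map_monomial f q)"
  by (induct p) auto

lemma word_map_monomial: "word (map_monomial f m) = map f (word m)"
  by (induct m) auto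

lemma set_monomial_word: "set_monomial m = set (word m)"
  by (induct m) auto

lemma right_normal_map_monomial [simp]: "right_normal (map_monomial f m) = right_normal m"
proof (induct m)
  case (HComp p q)
  then show ?case by (cases p) auto
next
  case (VComp p q)
  then show ?case by (cases p) auto
qed simp

text \<open>
  All functions evaluated on the association types of degree 9 avoid conditionals, case
  distinctions and abstractions: the simplifier then never visits an evaluated argument twice.
\<close>

fun hcons :: "'x monomial \<Rightarrow> ('x monomial \<times> 'x monomial) list \<Rightarrow> ('x monomial \<times> 'x monomial) list"
  where
  "hcons p [] = []"
| "hcons p ((a, b) # r) = (p \<^bold>\<circ> a, b) # hcons p r"

fun vcons :: "'x monomial \<Rightarrow> ('x monomial \<times> 'x monomial) list \<Rightarrow> ('x monomial \<times> 'x monomial) list"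
  where
  "vcons p [] = []"
| "vcons p ((a, b) # r) = (p \<^bold>\<bullet> a, b) # vcons p r"

text \<open>Modulo associativity, a factorization of a horizontal product is a cut between two
  consecutive factors. Both halves of a right-normal monomial are again right-normal.\<close>

primrec hsplits :: "'x monomial \<Rightarrow> ('x monomial \<times> 'x monomial) list" where
  "hsplits (Var x) = []"
| "hsplits (p \<^bold>\<circ> q) = (p, q) # hcons p (hsplits q)"
| "hsplits (p \<^bold>\<bullet> q) = []"

primrec vsplits :: "'x monomial \<Rightarrow> ('x monomial \<times> 'x monomial) list" where
  "vsplits (Var x) = []"
| "vsplits (p \<^bold>\<circ> q) = []"
| "vsplits (p \<^bold>\<bullet> q) = (p, q) # vcons p (vsplits q)"

text \<open>One cut of the upper operand against all cuts of the lower one. The tail of the result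
  is passed along in \<open>acc\<close>, which avoids appending evaluated lists.\<close>

fun hcross1 :: "'x monomial \<Rightarrow> 'x monomial \<Rightarrow> ('x monomial \<times> 'x monomial) list \<Rightarrow> 'x monomial list \<Rightarrow>
    'x monomial list" where
  "hcross1 w x [] acc = acc"
| "hcross1 w x ((y, z) # ts) acc = hjoin (vjoin w y) (vjoin x z) # hcross1 w x ts acc"

fun vcross1 :: "'x monomial \<Rightarrow> 'x monomial \<Rightarrow> ('x monomial \<times> 'x monomial) list \<Rightarrow> 'x monomial list \<Rightarrow>
    'x monomial list" where
  "vcross1 w x [] acc = acc"
| "vcross1 w x ((y, z) # ts) acc = vjoin (hjoin w y) (hjoin x z) # vcross1 w x ts acc"

fun hcross :: "('x monomial \<times> 'x monomial) list \<Rightarrow> ('x monomial \<times> 'x monomial) list \<Rightarrow>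
    'x monomial list" where
  "hcross [] ts = []"
| "hcross ((w, x) # ss) ts = hcross1 w x ts (hcross ss ts)"

fun vcross :: "('x monomial \<times> 'x monomial) list \<Rightarrow> ('x monomial \<times> 'x monomial) list \<Rightarrow>
    'x monomial list" where
  "vcross [] ts = []"
| "vcross ((w, x) # ss) ts = vcross1 w x ts (vcross ss ts)"

primrec hcomp_right :: "'x monomial \<Rightarrow> 'x monomial list \<Rightarrow> 'x monomial list" where
  "hcomp_right q [] = []"
| "hcomp_right q (u # us) = (u \<^bold>\<circ> q) # hcomp_right q us"

primrec vcomp_right :: "'x monomial \<Rightarrow> 'x monomial list \<Rightarrow> 'x monomial list" where
  "vcomp_right q [] = []"
| "vcomp_right q (u # us) = (u \<^bold>\<bullet> q) # vcomp_right q us"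

primrec hjoin_right :: "'x monomial \<Rightarrow> 'x monomial list \<Rightarrow> 'x monomial list \<Rightarrow> 'x monomial list" where
  "hjoin_right q [] acc = acc"
| "hjoin_right q (u # us) acc = hjoin u q # hjoin_right q us acc"

primrec vjoin_right :: "'x monomial \<Rightarrow> 'x monomial list \<Rightarrow> 'x monomial list \<Rightarrow> 'x monomial list" where
  "vjoin_right q [] acc = acc"
| "vjoin_right q (u # us) acc = vjoin u q # vjoin_right q us acc"

primrec hcomp_left :: "'x monomial \<Rightarrow> 'x monomial list \<Rightarrow> 'x monomial list \<Rightarrow> 'x monomial list" where
  "hcomp_left p [] acc = acc"
| "hcomp_left p (u # us) acc = (p \<^bold>\<circ> u) # hcomp_left p us acc"

primrec vcomp_left :: "'x monomial \<Rightarrow> 'x monomial list \<Rightarrow> 'x monomial list \<Rightarrow> 'x monomial list" where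
  "vcomp_left p [] acc = acc"
| "vcomp_left p (u # us) acc = (p \<^bold>\<bullet> u) # vcomp_left p us acc"

text \<open>Interchanges at a horizontal root. Both operands of the rule have a vertical root, so
  each is a single factor of the horizontal product. Hence \<open>p\<close> interacts only with the
  first factor of \<open>q\<close>, and the remaining factors \<open>b\<close> are left alone. The
  results of \<open>vcross\<close> have a vertical root, so composing them with \<open>b\<close>
  needs no flattening.\<close>

primrec hpair :: "'x monomial \<Rightarrow> 'x monomial \<Rightarrow> 'x monomial list" where
  "hpair p (Var x) = []"
| "hpair p (a \<^bold>\<circ> b) = hcomp_right b (vcross (vsplits p) (vsplits a))"
| "hpair p (a \<^bold>\<bullet> b) = vcross (vsplits p) (vsplits (a \<^bold>\<bullet> b))"

primrec vpair :: "'x monomial \<Rightarrow> 'x monomial \<Rightarrow> 'x monomial list" where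
  "vpair p (Var x) = []"
| "vpair p (a \<^bold>\<circ> b) = hcross (hsplits p) (hsplits (a \<^bold>\<circ> b))"
| "vpair p (a \<^bold>\<bullet> b) = vcomp_right b (hcross (hsplits p) (hsplits a))"

text \<open>A rewritten left factor may have acquired the root operation of the whole product and
  must be joined. A rewritten right factor stands behind the unchanged \<open>p\<close>, where plain
  composition is already right-normal.\<close>

primrec neighbours :: "'x monomial \<Rightarrow> 'x monomial list" where
  "neighbours (Var x) = []"
| "neighbours (p \<^bold>\<circ> q) = hjoin_right q (neighbours p) (hcomp_left p (neighbours q) (hpair p q))"
| "neighbours (p \<^bold>\<bullet> q) = vjoin_right q (neighbours p) (vcomp_left p (neighbours q) (vpair p q))"

lemma set_hcons [simp]: "set (hcons p l) = (\<lambda>(a, b). (p \<^bold>\<circ> a, b)) ` set l"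
  by (induct p l rule: hcons.induct) auto

lemma set_vcons [simp]: "set (vcons p l) = (\<lambda>(a, b). (p \<^bold>\<bullet> a, b)) ` set l"
  by (induct p l rule: vcons.induct) auto

lemma set_hcross1 [simp]:
  "set (hcross1 w x ts acc) = (\<lambda>(y, z). hjoin (vjoin w y) (vjoin x z)) ` set ts \<union> set acc"
  by (induct w x ts acc rule: hcross1.induct) auto

lemma set_vcross1 [simp]:
  "set (vcross1 w x ts acc) = (\<lambda>(y, z). vjoin (hjoin w y) (hjoin x z)) ` set ts \<union> set acc"
  by (induct w x ts acc rule: vcross1.induct) auto

lemma set_hcross:
  "set (hcross ss ts) = {hjoin (vjoin w y) (vjoin x z) | w x y z. (w, x) \<in> set ss \<and> (y, z) \<in> set ts}"
  by (induct ss ts rule: hcross.induct) force+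

lemma set_vcross:
  "set (vcross ss ts) = {vjoin (hjoin w y) (hjoin x z) | w x y z. (w, x) \<in> set ss \<and> (y, z) \<in> set ts}"
  by (induct ss ts rule: vcross.induct) force+

lemma hcross_is_HComp: "u \<in> set (hcross ss ts) \<Longrightarrow> \<exists>c d. u = c \<^bold>\<circ> d"
  unfolding set_hcross using hjoin_is_HComp by blast

lemma vcross_is_VComp: "u \<in> set (vcross ss ts) \<Longrightarrow> \<exists>c d. u = c \<^bold>\<bullet> d"
  unfolding set_vcross using vjoin_is_VComp by blast

lemma set_map_variants [simp]:
  "set (hcomp_right q us) = (\<lambda>u. u \<^bold>\<circ> q) ` set us"
  "set (vcomp_right q us) = (\<lambda>u. u \<^bold>\<bullet> q) ` set us"
  "set (hjoin_right q us acc) = (\<lambda>u. hjoin u q) ` set us \<union> set acc"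
  "set (vjoin_right q us acc) = (\<lambda>u. vjoin u q) ` set us \<union> set acc"
  "set (hcomp_left p us acc) = (\<lambda>u. p \<^bold>\<circ> u) ` set us \<union> set acc"
  "set (vcomp_left p us acc) = (\<lambda>u. p \<^bold>\<bullet> u) ` set us \<union> set acc"
  by (induct us) auto

lemma hsplits_approx: "(w, x) \<in> set (hsplits p) \<Longrightarrow> w \<^bold>\<circ> x \<approx> p"
proof (induct p arbitrary: w x)
  case (HComp a b)
  then consider "w = a" "x = b" | w' where "w = a \<^bold>\<circ> w'" "(w', x) \<in> set (hsplits b)" by auto
  then show ?case
    using HComp(2)
    by cases (auto intro: assoc_eq.refl assoc_eq.trans[OF assoc_eq.hassoc assoc_eq.hcong])
qed auto

lemma vsplits_approx: "(w, x) \<in> set (vsplits p) \<Longrightarrow> w \<^bold>\<bullet> x \<approx> p"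
proof (induct p arbitrary: w x)
  case (VComp a b)
  then consider "w = a" "x = b" | w' where "w = a \<^bold>\<bullet> w'" "(w', x) \<in> set (vsplits b)" by auto
  then show ?case
    using VComp(2)
    by cases (auto intro: assoc_eq.refl assoc_eq.trans[OF assoc_eq.vassoc assoc_eq.vcong])
qed auto

lemma hsplits_hjoin: "(w, x) \<in> set (hsplits (hjoin w x))"
  by (induct w) (auto intro: rev_image_eqI)

lemma vsplits_vjoin: "(w, x) \<in> set (vsplits (vjoin w x))"
  by (induct w) (auto intro: rev_image_eqI)

lemma right_normal_hsplits:
  "(w, x) \<in> set (hsplits p) \<Longrightarrow> right_normal p \<Longrightarrow> right_normal w \<and> right_normal x"
  by (induct p arbitrary: w x) auto

lemma right_normal_vsplits:
  "(w, x) \<in> set (vsplits p) \<Longrightarrow> right_normal p \<Longrightarrow> right_normal w \<and> right_normal x"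
  by (induct p arbitrary: w x) auto

section \<open>The edge relation of F(n) modulo associativity\<close>

definition linked :: "'x monomial \<Rightarrow> 'x monomial \<Rightarrow> bool" where
  "linked m m' \<longleftrightarrow> (\<exists>u v. m \<approx> u \<and> interchange u v \<and> v \<approx> m')"

lemma linked_approx: "m \<approx> p \<Longrightarrow> linked p q \<Longrightarrow> q \<approx> m' \<Longrightarrow> linked m m'"
  unfolding linked_def by (meson assoc_eq.trans)

lemma interchange_imp_linked: "interchange p q \<Longrightarrow> linked p q"
  unfolding linked_def using assoc_eq.refl by blast

lemma linked_cong:
  assumes "linked p p'"
  shows "linked (p \<^bold>\<circ> q) (p' \<^bold>\<circ> q)" "linked (q \<^bold>\<circ> p) (q \<^bold>\<circ> p')"
    "linked (p \<^bold>\<bullet> q) (p' \<^bold>\<bullet> q)" "linked (q \<^bold>\<bullet> p) (q \<^bold>\<bullet> p')"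
  using assms unfolding linked_def
  by (meson assoc_eq.refl assoc_eq.hcong assoc_eq.vcong interchange.intros)+

lemma interchange_sym: "interchange p q \<Longrightarrow> interchange q p"
  by (induct rule: interchange.induct) (auto intro: interchange.intros)

lemma linked_sym: "linked p q \<Longrightarrow> linked q p"
  unfolding linked_def by (meson assoc_eq.sym interchange_sym)

lemma linked_mset_word: "linked p q \<Longrightarrow> mset (word p) = mset (word q)"
proof -
  have "interchange u v \<Longrightarrow> mset (word u) = mset (word v)" for u v :: "'a monomial"
    by (induct rule: interchange.induct) auto
  then show "linked p q \<Longrightarrow> mset (word p) = mset (word q)"
    unfolding linked_def by (metis approx_word)
qed

lemma hcross_linked:
  assumes "u \<in> set (hcross (hsplits p) (hsplits q))" shows "linked (p \<^bold>\<bullet> q) u"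
proof -
  obtain w x y z where u: "u = hjoin (vjoin w y) (vjoin x z)"
    and p: "(w, x) \<in> set (hsplits p)" and q: "(y, z) \<in> set (hsplits q)"
    using assms by (auto simp: set_hcross set_vcross)
  have "p \<^bold>\<bullet> q \<approx> (w \<^bold>\<circ> x) \<^bold>\<bullet> (y \<^bold>\<circ> z)"
    by (intro assoc_eq.vcong assoc_eq.sym[OF hsplits_approx] p q)
  moreover have "linked ((w \<^bold>\<circ> x) \<^bold>\<bullet> (y \<^bold>\<circ> z)) ((w \<^bold>\<bullet> y) \<^bold>\<circ> (x \<^bold>\<bullet> z))"
    by (intro interchange_imp_linked interchange.v_to_h)
  moreover have "(w \<^bold>\<bullet> y) \<^bold>\<circ> (x \<^bold>\<bullet> z) \<approx> u"
    unfolding u by (rule assoc_eq.trans[OF assoc_eq.hcong[OF vjoin_approx vjoin_approx] hjoin_approx])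
  ultimately show ?thesis by (rule linked_approx)
qed

lemma vcross_linked:
  assumes "u \<in> set (vcross (vsplits p) (vsplits q))" shows "linked (p \<^bold>\<circ> q) u"
proof -
  obtain w x y z where u: "u = vjoin (hjoin w y) (hjoin x z)"
    and p: "(w, x) \<in> set (vsplits p)" and q: "(y, z) \<in> set (vsplits q)"
    using assms by (auto simp: set_hcross set_vcross)
  have "p \<^bold>\<circ> q \<approx> (w \<^bold>\<bullet> x) \<^bold>\<circ> (y \<^bold>\<bullet> z)"
    by (intro assoc_eq.hcong assoc_eq.sym[OF vsplits_approx] p q)
  moreover have "linked ((w \<^bold>\<bullet> x) \<^bold>\<circ> (y \<^bold>\<bullet> z)) ((w \<^bold>\<circ> y) \<^bold>\<bullet> (x \<^bold>\<circ> z))"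
    by (intro interchange_imp_linked interchange.h_to_v)
  moreover have "(w \<^bold>\<circ> y) \<^bold>\<bullet> (x \<^bold>\<circ> z) \<approx> u"
    unfolding u by (rule assoc_eq.trans[OF assoc_eq.vcong[OF hjoin_approx hjoin_approx] vjoin_approx])
  ultimately show ?thesis by (rule linked_approx)
qed

lemma hpair_linked: "u \<in> set (hpair p q) \<Longrightarrow> linked (p \<^bold>\<circ> q) u"
proof (cases q)
  case (HComp a b)
  assume "u \<in> set (hpair p q)"
  then obtain v where "u = v \<^bold>\<circ> b" "v \<in> set (vcross (vsplits p) (vsplits a))"
    unfolding HComp hpair.simps by auto
  then show ?thesis
    unfolding HComp using linked_cong(1)[OF vcross_linked, of v p a b]
    by (auto intro: linked_approx[OF assoc_eq.sym[OF assoc_eq.hassoc] _ assoc_eq.refl])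
next
  case (VComp a b)
  then show "u \<in> set (hpair p q) \<Longrightarrow> linked (p \<^bold>\<circ> q) u"
    using vcross_linked[of u p q] by (simp del: vsplits.simps)
qed simp

lemma vpair_linked: "u \<in> set (vpair p q) \<Longrightarrow> linked (p \<^bold>\<bullet> q) u"
proof (cases q)
  case (VComp a b)
  assume "u \<in> set (vpair p q)"
  then obtain v where "u = v \<^bold>\<bullet> b" "v \<in> set (hcross (hsplits p) (hsplits a))"
    unfolding VComp vpair.simps by auto
  then show ?thesis
    unfolding VComp using linked_cong(3)[OF hcross_linked, of v p a b]
    by (auto intro: linked_approx[OF assoc_eq.sym[OF assoc_eq.vassoc] _ assoc_eq.refl])
next
  case (HComp a b)
  then show "u \<in> set (vpair p q) \<Longrightarrow> linked (p \<^bold>\<bullet> q) u"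
    using hcross_linked[of u p q] by (simp del: hsplits.simps)
qed simp

lemma neighbours_linked: "u \<in> set (neighbours m) \<Longrightarrow> linked m u"
proof (induct m arbitrary: u)
  case (HComp p q)
  from HComp.prems consider v where "v \<in> set (neighbours p)" "u = hjoin v q"
    | v where "v \<in> set (neighbours q)" "u = p \<^bold>\<circ> v" | "u \<in> set (hpair p q)" by auto
  then show ?case
  proof cases
    case (1 v)
    then show ?thesis
      using linked_approx[OF assoc_eq.refl linked_cong(1) hjoin_approx] HComp.hyps(1) by blast
  next
    case (2 v)
    then show ?thesis using linked_cong(2) HComp.hyps(2) by blast
  qed (rule hpair_linked)
next
  case (VComp p q)
  from VComp.prems consider v where "v \<in> set (neighbours p)" "u = vjoin v q"
    | v where "v \<in> set (neighbours q)" "u = p \<^bold>\<bullet> v" | "u \<in> set (vpair p q)" by auto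
  then show ?case
  proof cases
    case (1 v)
    then show ?thesis
      using linked_approx[OF assoc_eq.refl linked_cong(3) vjoin_approx] VComp.hyps(1) by blast
  next
    case (2 v)
    then show ?thesis using linked_cong(4) VComp.hyps(2) by blast
  qed (rule vpair_linked)
qed simp

text \<open>A factor of an unnormalized product need not survive as a subterm of the normal form,
  because joining spreads it along the right spine. Its interchanges are then found further down
  that spine.\<close>

lemma neighbours_hjoin_left:
  "u \<in> set (neighbours p) \<Longrightarrow> hjoin u q \<in> set (neighbours (hjoin p q))"
proof (induct p arbitrary: u)
  case (HComp a b)
  from HComp.prems consider v where "v \<in> set (neighbours a)" "u = hjoin v b"
    | v where "v \<in> set (neighbours b)" "u = a \<^bold>\<circ> v" | "u \<in> set (hpair a b)" by auto
  then show ?case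
  proof cases
    case 3
    \<comment> \<open>The interchange involves \<open>a\<close> and the first factor of
      \<open>b\<close>, which is still the first factor after \<open>q\<close> has been joined. Its
      result has a vertical root and is not flattened.\<close>
    then have "hjoin u q \<in> set (hpair a (hjoin b q))"
      using vcross_is_VComp[of u] by (cases b) (fastforce simp del: vsplits.simps)+
    then show ?thesis by simp
  qed (use HComp.hyps in \<open>auto simp: hjoin_assoc\<close>)
qed auto

lemma neighbours_vjoin_left:
  "u \<in> set (neighbours p) \<Longrightarrow> vjoin u q \<in> set (neighbours (vjoin p q))"
proof (induct p arbitrary: u)
  case (VComp a b)
  from VComp.prems consider v where "v \<in> set (neighbours a)" "u = vjoin v b"
    | v where "v \<in> set (neighbours b)" "u = a \<^bold>\<bullet> v" | "u \<in> set (vpair a b)" by auto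
  then show ?case
  proof cases
    case 3
    then have "vjoin u q \<in> set (vpair a (vjoin b q))"
      using hcross_is_HComp[of u] by (cases b) (fastforce simp del: hsplits.simps)+
    then show ?thesis by simp
  qed (use VComp.hyps in \<open>auto simp: vjoin_assoc\<close>)
qed auto

lemma neighbours_hjoin_right:
  "u \<in> set (neighbours q) \<Longrightarrow> hjoin p u \<in> set (neighbours (hjoin p q))"
  by (induct p) auto

lemma neighbours_vjoin_right:
  "u \<in> set (neighbours q) \<Longrightarrow> vjoin p u \<in> set (neighbours (vjoin p q))"
  by (induct p) auto

text \<open>Completeness of the enumeration. Normalizing an operand of the rule turns it into a
  join, and one of the cuts of this join restores the two normalized parts. Below the root, the join
  lemmas carry the step upwards.\<close>

lemma interchange_imp_neighbours:
  "interchange u v \<Longrightarrow> normalize v \<in> set (neighbours (normalize u))"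
proof (induct rule: interchange.induct)
  case (h_to_v w x y z)
  let ?p = "vjoin (normalize w) (normalize x)" and ?q = "vjoin (normalize y) (normalize z)"
  obtain a b where q: "?q = a \<^bold>\<bullet> b" using vjoin_is_VComp by blast
  have "normalize ((w \<^bold>\<circ> y) \<^bold>\<bullet> (x \<^bold>\<circ> z)) \<in> set (vcross (vsplits ?p) (vsplits ?q))"
    unfolding set_vcross using vsplits_vjoin[of "normalize w"] vsplits_vjoin[of "normalize y"] by fastforce
  then have "normalize ((w \<^bold>\<circ> y) \<^bold>\<bullet> (x \<^bold>\<circ> z)) \<in> set (hpair ?p ?q)"
    unfolding q hpair.simps .
  then show ?case by (simp add: hjoin_vjoin)
next
  case (v_to_h w y x z)
  let ?p = "hjoin (normalize w) (normalize y)" and ?q = "hjoin (normalize x) (normalize z)"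
  obtain a b where q: "?q = a \<^bold>\<circ> b" using hjoin_is_HComp by blast
  have "normalize ((w \<^bold>\<bullet> x) \<^bold>\<circ> (y \<^bold>\<bullet> z)) \<in> set (hcross (hsplits ?p) (hsplits ?q))"
    unfolding set_hcross using hsplits_hjoin[of "normalize w"] hsplits_hjoin[of "normalize x"] by fastforce
  then have "normalize ((w \<^bold>\<bullet> x) \<^bold>\<circ> (y \<^bold>\<bullet> z)) \<in> set (vpair ?p ?q)"
    unfolding q vpair.simps .
  then show ?case by (simp add: vjoin_hjoin)
qed (simp_all add: neighbours_hjoin_left neighbours_hjoin_right neighbours_vjoin_left
    neighbours_vjoin_right)

lemma linked_iff_neighbours:
  "right_normal m \<Longrightarrow> right_normal m' \<Longrightarrow> linked m m' \<longleftrightarrow> m' \<in> set (neighbours m)"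
proof
  assume m: "right_normal m" "right_normal m'" and "linked m m'"
  then obtain u v where "m \<approx> u" "interchange u v" "v \<approx> m'" unfolding linked_def by blast
  then have "normalize u = m" "normalize v = m'"
    using m approx_imp_normalize_eq normalize_right_normal by metis+
  then show "m' \<in> set (neighbours m)"
    using interchange_imp_neighbours[OF \<open>interchange u v\<close>] by simp
qed (rule neighbours_linked)

lemma right_normal_hcross:
  assumes "u \<in> set (hcross (hsplits p) (hsplits q))" "right_normal p" "right_normal q"
  shows "right_normal u \<and> (\<nexists>c d. u = c \<^bold>\<bullet> d)"
proof -
  obtain w x y z where u: "u = hjoin (vjoin w y) (vjoin x z)"
    and "(w, x) \<in> set (hsplits p)" "(y, z) \<in> set (hsplits q)"
    using assms(1) by (auto simp: set_hcross set_vcross)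
  then have "right_normal w" "right_normal x" "right_normal y" "right_normal z"
    using assms(2,3) right_normal_hsplits by blast+
  moreover obtain a b where "u = HComp a b" using u hjoin_is_HComp by blast
  ultimately show ?thesis
    using u right_normal_hjoin right_normal_vjoin by (metis monomial.distinct(5))
qed

lemma right_normal_vcross:
  assumes "u \<in> set (vcross (vsplits p) (vsplits q))" "right_normal p" "right_normal q"
  shows "right_normal u \<and> (\<nexists>c d. u = c \<^bold>\<circ> d)"
proof -
  obtain w x y z where u: "u = vjoin (hjoin w y) (hjoin x z)"
    and "(w, x) \<in> set (vsplits p)" "(y, z) \<in> set (vsplits q)"
    using assms(1) by (auto simp: set_hcross set_vcross)
  then have "right_normal w" "right_normal x" "right_normal y" "right_normal z"
    using assms(2,3) right_normal_vsplits by blast+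
  moreover obtain a b where "u = VComp a b" using u vjoin_is_VComp by blast
  ultimately show ?thesis
    using u right_normal_hjoin right_normal_vjoin by (metis monomial.distinct(5))
qed

lemma right_normal_neighbours:
  "right_normal m \<Longrightarrow> u \<in> set (neighbours m) \<Longrightarrow> right_normal u"
proof (induct m arbitrary: u)
  case (HComp p q)
  have pair: "right_normal u" if u: "u \<in> set (hpair p q)"
  proof (cases q)
    case (HComp a b)
    then obtain w where w: "u = w \<^bold>\<circ> b" "w \<in> set (vcross (vsplits p) (vsplits a))"
      using u by auto
    then show ?thesis
      using HComp.prems(1) right_normal_vcross[OF w(2)] \<open>q = a \<^bold>\<circ> b\<close> by simp
  next
    case (VComp a b)
    then have "u \<in> set (vcross (vsplits p) (vsplits q))" using u by (simp del: vsplits.simps)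
    then show ?thesis using HComp.prems(1) right_normal_vcross[of u p q] by simp
  qed (use u in simp)
  from HComp.prems(2) consider w where "w \<in> set (neighbours p)" "u = hjoin w q"
    | w where "w \<in> set (neighbours q)" "u = p \<^bold>\<circ> w" | "u \<in> set (hpair p q)" by auto
  then show ?case
  proof cases
    case (1 w)
    then show ?thesis
      using HComp.hyps(1)[of w] HComp.prems(1) right_normal_hjoin[of w q] by simp
  next
    case (2 w)
    then show ?thesis using HComp.hyps(2)[of w] HComp.prems(1) by simp
  qed (rule pair)
next
  case (VComp p q)
  have pair: "right_normal u" if u: "u \<in> set (vpair p q)"
  proof (cases q)
    case (VComp a b)
    then obtain w where w: "u = w \<^bold>\<bullet> b" "w \<in> set (hcross (hsplits p) (hsplits a))"
      using u by auto
    then show ?thesis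
      using VComp.prems(1) right_normal_hcross[OF w(2)] \<open>q = a \<^bold>\<bullet> b\<close> by simp
  next
    case (HComp a b)
    then have "u \<in> set (hcross (hsplits p) (hsplits q))" using u by (simp del: hsplits.simps)
    then show ?thesis using VComp.prems(1) right_normal_hcross[of u p q] by simp
  qed (use u in simp)
  from VComp.prems(2) consider w where "w \<in> set (neighbours p)" "u = vjoin w q"
    | w where "w \<in> set (neighbours q)" "u = p \<^bold>\<bullet> w" | "u \<in> set (vpair p q)" by auto
  then show ?case
  proof cases
    case (1 w)
    then show ?thesis
      using VComp.hyps(1)[of w] VComp.prems(1) right_normal_vjoin[of w q] by simp
  next
    case (2 w)
    then show ?thesis using VComp.hyps(2)[of w] VComp.prems(1) by simp
  qed (rule pair)
qed simp

lemma neighbours_sym: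
  "right_normal m \<Longrightarrow> u \<in> set (neighbours m) \<Longrightarrow> m \<in> set (neighbours u)"
  by (metis linked_iff_neighbours linked_sym neighbours_linked right_normal_neighbours)

section \<open>Renaming of indeterminates\<close>

lemma map_monomial_hsplits:
  "hsplits (map_monomial f p) = map (map_prod (map_monomial f) (map_monomial f)) (hsplits p)"
proof (induct p)
  case (HComp a b)
  have "hcons (map_monomial f a) (map (map_prod (map_monomial f) (map_monomial f)) l) =
    map (map_prod (map_monomial f) (map_monomial f)) (hcons a l)" for l
    by (induct a l rule: hcons.induct) auto
  then show ?case using HComp by simp
qed auto

lemma map_monomial_vsplits:
  "vsplits (map_monomial f p) = map (map_prod (map_monomial f) (map_monomial f)) (vsplits p)"
proof (induct p)
  case (VComp a b)
  have "vcons (map_monomial f a) (map (map_prod (map_monomial f) (map_monomial f)) l) =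
    map (map_prod (map_monomial f) (map_monomial f)) (vcons a l)" for l
    by (induct a l rule: vcons.induct) auto
  then show ?case using VComp by simp
qed auto

lemma map_monomial_hcross:
  "set (hcross (hsplits (map_monomial f p)) (hsplits (map_monomial f q))) =
    map_monomial f ` set (hcross (hsplits p) (hsplits q))"
proof -
  let ?f = "map_prod (map_monomial f) (map_monomial f)"
  have cross1: "hcross1 (map_monomial f w) (map_monomial f x) (map ?f ts) (map (map_monomial f) acc) =
      map (map_monomial f) (hcross1 w x ts acc)" for w x ts acc
    by (induct w x ts acc rule: hcross1.induct) (simp_all add: map_monomial_hjoin map_monomial_vjoin)
  have "hcross (map ?f ss) (map ?f ts) = map (map_monomial f) (hcross ss ts)" for ss ts
    by (induct ss ts rule: hcross.induct) (simp_all add: cross1)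
  then show ?thesis unfolding map_monomial_hsplits by simp
qed

lemma map_monomial_vcross:
  "set (vcross (vsplits (map_monomial f p)) (vsplits (map_monomial f q))) =
    map_monomial f ` set (vcross (vsplits p) (vsplits q))"
proof -
  let ?f = "map_prod (map_monomial f) (map_monomial f)"
  have cross1: "vcross1 (map_monomial f w) (map_monomial f x) (map ?f ts) (map (map_monomial f) acc) =
      map (map_monomial f) (vcross1 w x ts acc)" for w x ts acc
    by (induct w x ts acc rule: vcross1.induct) (simp_all add: map_monomial_hjoin map_monomial_vjoin)
  have "vcross (map ?f ss) (map ?f ts) = map (map_monomial f) (vcross ss ts)" for ss ts
    by (induct ss ts rule: vcross.induct) (simp_all add: cross1)
  then show ?thesis unfolding map_monomial_vsplits by simp
qed

lemma map_monomial_hpair: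
  "set (hpair (map_monomial f p) (map_monomial f q)) = map_monomial f ` set (hpair p q)"
proof (cases q)
  case (VComp a b)
  then show ?thesis
    using map_monomial_vcross[of f p "a \<^bold>\<bullet> b"] by (simp only: monomial.map hpair.simps)
qed (simp_all only: monomial.map hpair.simps set_map_variants image_image map_monomial_vcross
    list.set image_empty)

lemma map_monomial_vpair:
  "set (vpair (map_monomial f p) (map_monomial f q)) = map_monomial f ` set (vpair p q)"
proof (cases q)
  case (HComp a b)
  then show ?thesis
    using map_monomial_hcross[of f p "a \<^bold>\<circ> b"] by (simp only: monomial.map vpair.simps)
qed (simp_all only: monomial.map vpair.simps set_map_variants image_image map_monomial_hcross
    list.set image_empty)

text \<open>The enumeration never inspects the indeterminates. For the constant renaming to
  \<open>()\<close> this describes the projection from F(n) to G(n).\<close>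

lemma map_monomial_neighbours:
  "set (neighbours (map_monomial f m)) = map_monomial f ` set (neighbours m)"
  by (induct m) (simp_all add: image_Un image_image map_monomial_hpair map_monomial_vpair
      map_monomial_hjoin map_monomial_vjoin)

section \<open>The graphs in terms of neighbours\<close>

abbreviation monomial_rel :: "('x monomial \<times> 'x monomial) set" where
  "monomial_rel \<equiv> {(m, m'). m' \<in> set (neighbours m)}"

primrec relabel :: "'x monomial \<Rightarrow> 'y list \<Rightarrow> 'y monomial" where
  "relabel (Var x) ys = Var (hd ys)"
| "relabel (p \<^bold>\<circ> q) ys = relabel p (take (mdegree p) ys) \<^bold>\<circ> relabel q (drop (mdegree p) ys)"
| "relabel (p \<^bold>\<bullet> q) ys = relabel p (take (mdegree p) ys) \<^bold>\<bullet> relabel q (drop (mdegree p) ys)"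

lemma mdegree_simps [simp]:
  "mdegree (Var x) = 1"
  "mdegree (p \<^bold>\<circ> q) = mdegree p + mdegree q"
  "mdegree (p \<^bold>\<bullet> q) = mdegree p + mdegree q"
  by (simp_all add: mdegree_def)

lemma mdegree_pos: "0 < mdegree m"
  by (induct m) auto

lemma word_relabel: "length ys = mdegree m \<Longrightarrow> word (relabel m ys) = ys"
proof (induct m arbitrary: ys)
  case (Var x)
  then show ?case by (cases ys) auto
qed auto

lemma type_of_relabel: "type_of (relabel m ys) = type_of m"
  unfolding type_of_def by (induct m arbitrary: ys) auto

lemma type_of_unit: "type_of t = t" for t :: assoc_type
  unfolding type_of_def by (induct t) auto

lemma mdegree_type_of [simp]: "mdegree (type_of m) = mdegree m"
  by (simp add: mdegree_def type_of_def word_map_monomial)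

lemma right_normal_type_of [simp]: "right_normal (type_of m) = right_normal m"
  by (simp add: type_of_def)

lemma type_of_map_monomial [simp]: "type_of (map_monomial f m) = type_of m"
  by (simp add: type_of_def monomial.map_comp comp_def)

lemma monomial_eqI: "type_of m = type_of m' \<Longrightarrow> word m = word m' \<Longrightarrow> m = m'"
proof (induct m arbitrary: m')
  case (Var x)
  then show ?case by (cases m') (auto simp: type_of_def)
next
  case (HComp p q)
  then obtain p' q' where m': "m' = p' \<^bold>\<circ> q'" "type_of p = type_of p'" "type_of q = type_of q'"
    by (cases m') (auto simp: type_of_def)
  then have "length (word p) = length (word p')"
    by (metis mdegree_def mdegree_type_of)
  then show ?case using HComp m' by auto
next
  case (VComp p q)
  then obtain p' q' where m': "m' = p' \<^bold>\<bullet> q'" "type_of p = type_of p'" "type_of q = type_of q'"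
    by (cases m') (auto simp: type_of_def)
  then have "length (word p) = length (word p')"
    by (metis mdegree_def mdegree_type_of)
  then show ?case using VComp m' by auto
qed

lemma type_of_neighbours: "set (neighbours (type_of m)) = type_of ` set (neighbours m)"
  unfolding type_of_def by (rule map_monomial_neighbours)

lemma neighbours_mset_word: "u \<in> set (neighbours m) \<Longrightarrow> mset (word u) = mset (word m)"
  using linked_mset_word neighbours_linked by metis

lemma neighbours_mdegree: "u \<in> set (neighbours m) \<Longrightarrow> mdegree u = mdegree m"
  unfolding mdegree_def by (metis neighbours_mset_word size_mset)

lemma multilinear_mdegree: "m \<in> multilinear n \<Longrightarrow> mdegree m = n"
  unfolding multilinear_def mdegree_def using distinct_card[of "word m"] by simp

lemma multilinear_neighbours:
  assumes "m \<in> multilinear n" "u \<in> set (neighbours m)" shows "u \<in> multilinear n"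
proof -
  have "set (word u) = set (word m)" "distinct (word u) = distinct (word m)"
    using neighbours_mset_word[OF assms(2)] mset_eq_setD mset_eq_imp_distinct_iff by blast+
  then show ?thesis
    using assms(1) right_normal_neighbours[OF _ assms(2)] by (simp add: multilinear_def)
qed

lemma type_of_multilinear: "m \<in> multilinear n \<Longrightarrow> type_of m \<in> assoc_types n"
  using multilinear_mdegree by (auto simp: assoc_types_def multilinear_def)

lemma ex_multilinear:
  assumes "t \<in> assoc_types n" shows "\<exists>m \<in> multilinear n. type_of m = t"
proof (rule bexI)
  have w: "word (relabel t [0..<n]) = [0..<n]"
    using assms by (auto intro: word_relabel simp: assoc_types_def)
  show t: "type_of (relabel t [0..<n]) = t" by (simp add: type_of_relabel type_of_unit)
  have "right_normal (relabel t [0..<n])"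
    using assms right_normal_type_of[of "relabel t [0..<n]"] unfolding t by (simp add: assoc_types_def)
  then show "relabel t [0..<n] \<in> multilinear n" using w by (auto simp: multilinear_def)
qed

lemma assoc_types_neighbours:
  "t \<in> assoc_types n \<Longrightarrow> u \<in> set (neighbours t) \<Longrightarrow> u \<in> assoc_types n"
  using right_normal_neighbours[of t u] by (simp add: assoc_types_def neighbours_mdegree)

lemma assoc_types_rtrancl:
  "(t, u) \<in> monomial_rel\<^sup>* \<Longrightarrow> t \<in> assoc_types n \<Longrightarrow> u \<in> assoc_types n"
  by (induct rule: rtrancl_induct) (auto intro: assoc_types_neighbours)

lemma multilinear_rtrancl:
  "(m, u) \<in> monomial_rel\<^sup>* \<Longrightarrow> m \<in> multilinear n \<Longrightarrow> u \<in> multilinear n"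
  by (induct rule: rtrancl_induct) (auto intro: multilinear_neighbours)

lemma right_normal_rtrancl:
  "(m, u) \<in> monomial_rel\<^sup>* \<Longrightarrow> right_normal m \<Longrightarrow> right_normal u"
  by (induct rule: rtrancl_induct) (auto intro: right_normal_neighbours)

lemma monomial_rel_rtrancl_sym:
  "(m, u) \<in> monomial_rel\<^sup>* \<Longrightarrow> right_normal m \<Longrightarrow> (u, m) \<in> monomial_rel\<^sup>*"
proof (induct rule: rtrancl_induct)
  case (step u v)
  then have "(v, u) \<in> monomial_rel"
    using neighbours_sym[of u v] right_normal_rtrancl[of m u] by auto
  then show ?case using step by (meson converse_rtrancl_into_rtrancl)
qed simp

text \<open>Path lifting for the projection from F(n) to G(n): the neighbours of a type are the
  types of the neighbours of any monomial over it.\<close>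

lemma lift_rtrancl:
  "(type_of m, t) \<in> monomial_rel\<^sup>* \<Longrightarrow> \<exists>u. (m, u) \<in> monomial_rel\<^sup>* \<and> type_of u = t"
proof (induct rule: rtrancl_induct)
  case (step s t)
  then obtain u where u: "(m, u) \<in> monomial_rel\<^sup>*" "type_of u = s" by blast
  then obtain v where "v \<in> set (neighbours u)" "type_of v = t"
    using step(2) type_of_neighbours[of u] by auto
  then show ?case using u by (auto intro: rtrancl.rtrancl_into_rtrancl)
qed auto

lemma arcs_F_graph:
  "arcs (F_graph n) = {(m, m'). m \<in> multilinear n \<and> m' \<in> set (neighbours m)}"
proof -
  have "(m, m') \<in> arcs (F_graph n) \<longleftrightarrow> m \<in> multilinear n \<and> m' \<in> set (neighbours m)" for m m'
    using multilinear_neighbours[of m n m'] linked_iff_neighbours[of m m']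
    by (auto simp: F_graph_def linked_def multilinear_def)
  then show ?thesis by auto
qed

lemma G_graph_simps [simp]:
  "verts (G_graph n) = assoc_types n"
  "tail (G_graph n) e = fst e"
  "head (G_graph n) e = snd (snd e)"
  by (simp_all add: G_graph_def case_prod_beta)

lemma arc_G_graph_iff:
  "(t, \<sigma>, t') \<in> arcs (G_graph n) \<longleftrightarrow> \<sigma> permutes {..<n} \<and>
    (\<exists>m m'. m \<in> multilinear n \<and> m' \<in> set (neighbours m) \<and> type_of m = t \<and> type_of m' = t' \<and>
      word m' = permute_list \<sigma> (word m))"
  unfolding G_graph_def arcs_F_graph by auto

lemma wf_digraph_G_graph: "wf_digraph (G_graph n)"
proof
  fix e assume "e \<in> arcs (G_graph n)"
  then obtain m m' \<sigma> where "e = (type_of m, \<sigma>, type_of m')" "m \<in> multilinear n"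
    "m' \<in> set (neighbours m)"
    by (metis arc_G_graph_iff prod.collapse)
  then show "tail (G_graph n) e \<in> verts (G_graph n)" "head (G_graph n) e \<in> verts (G_graph n)"
    by (auto intro: type_of_multilinear multilinear_neighbours)
qed

lemma ex_arc_G_graph:
  assumes "m \<in> multilinear n" "m' \<in> set (neighbours m)"
  shows "\<exists>\<sigma>. (type_of m, \<sigma>, type_of m') \<in> arcs (G_graph n) \<and> word m' = permute_list \<sigma> (word m)"
proof -
  obtain \<sigma> where "\<sigma> permutes {..<length (word m)}" "permute_list \<sigma> (word m) = word m'"
    using neighbours_mset_word[OF assms(2)] mset_eq_permutation by metis
  moreover have "length (word m) = n" using assms(1) multilinear_mdegree by (auto simp: mdegree_def)
  ultimately show ?thesis using assms arc_G_graph_iff by (metis (no_types, lifting))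
qed

lemma arcs_ends_G_graph:
  "arcs_ends (G_graph n) = {(t, t'). t \<in> assoc_types n \<and> t' \<in> set (neighbours t)}"
proof -
  have "(t, t') \<in> arcs_ends (G_graph n) \<longleftrightarrow> (\<exists>\<sigma>. (t, \<sigma>, t') \<in> arcs (G_graph n))" for t t'
    by (force simp: arcs_ends_conv image_iff)
  moreover have "(\<exists>\<sigma>. (t, \<sigma>, t') \<in> arcs (G_graph n)) \<longleftrightarrow>
      t \<in> assoc_types n \<and> t' \<in> set (neighbours t)" for t t'
  proof
    assume "\<exists>\<sigma>. (t, \<sigma>, t') \<in> arcs (G_graph n)"
    then show "t \<in> assoc_types n \<and> t' \<in> set (neighbours t)"
      unfolding arc_G_graph_iff using type_of_multilinear type_of_neighbours by fastforce
  next
    assume "t \<in> assoc_types n \<and> t' \<in> set (neighbours t)"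
    moreover then obtain m where m: "m \<in> multilinear n" "type_of m = t" using ex_multilinear by blast
    ultimately obtain m' where "m' \<in> set (neighbours m)" "type_of m' = t'"
      using type_of_neighbours[of m] by auto
    then show "\<exists>\<sigma>. (t, \<sigma>, t') \<in> arcs (G_graph n)"
      using ex_arc_G_graph[OF m(1), of m'] m(2) by blast
  qed
  ultimately show ?thesis by auto
qed

definition connected_class :: "assoc_type \<Rightarrow> assoc_type set" where
  "connected_class t = {u. (t, u) \<in> monomial_rel\<^sup>*}"

lemma reachable_G_graph_iff:
  "t \<rightarrow>\<^sup>*\<^bsub>G_graph n\<^esub> u \<longleftrightarrow> t \<in> assoc_types n \<and> (t, u) \<in> monomial_rel\<^sup>*"
proof
  assume "t \<rightarrow>\<^sup>*\<^bsub>G_graph n\<^esub> u"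
  then show "t \<in> assoc_types n \<and> (t, u) \<in> monomial_rel\<^sup>*"
    unfolding reachable_def
  proof (induct rule: rtrancl_on_induct)
    case (step y z)
    then show ?case
      unfolding arcs_ends_G_graph by (auto intro: rtrancl.rtrancl_into_rtrancl)
  qed simp
next
  interpret wf_digraph "G_graph n" by (rule wf_digraph_G_graph)
  assume "t \<in> assoc_types n \<and> (t, u) \<in> monomial_rel\<^sup>*"
  then have t: "t \<in> assoc_types n" and "(t, u) \<in> monomial_rel\<^sup>*" by auto
  from this(2) show "t \<rightarrow>\<^sup>*\<^bsub>G_graph n\<^esub> u"
  proof (induct rule: rtrancl_induct)
    case (step y z)
    then have "y \<in> assoc_types n" using t assoc_types_rtrancl by blast
    then have "(y, z) \<in> arcs_ends (G_graph n)" using step by (simp add: arcs_ends_G_graph)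
    then show ?case using step by (meson reachable_adj_trans)
  qed (simp add: t)
qed

lemma in_connected_class: "u \<in> connected_class t \<longleftrightarrow> (t, u) \<in> monomial_rel\<^sup>*"
  by (simp add: connected_class_def)

lemma connected_class_refl: "t \<in> connected_class t"
  by (simp add: in_connected_class)

lemma connected_class_eq: "t \<in> assoc_types n \<Longrightarrow> u \<in> connected_class t \<Longrightarrow> connected_class u = connected_class t"
  unfolding connected_class_def assoc_types_def
  using monomial_rel_rtrancl_sym[of t u] by (auto intro: rtrancl_trans)

lemma connected_class_subset: "t \<in> assoc_types n \<Longrightarrow> connected_class t \<subseteq> assoc_types n"
  using assoc_types_rtrancl by (auto simp: connected_class_def)

text \<open>The neighbour relation is symmetric on right-normal monomials, so mutual reachability is
  the same as reachability.\<close>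

lemma sccs_verts_G_graph: "pre_digraph.sccs_verts (G_graph n) = connected_class ` assoc_types n"
proof -
  interpret wf_digraph "G_graph n" by (rule wf_digraph_G_graph)
  have "scc_of t = connected_class t" if "t \<in> assoc_types n" for t
    using that monomial_rel_rtrancl_sym[of t] assoc_types_rtrancl[of t]
    by (auto simp: scc_of_def connected_class_def reachable_G_graph_iff assoc_types_def)
  then show ?thesis by (auto simp: sccs_verts_conv_scc_of)
qed

text \<open>The indeterminates of a multilinear monomial are distinct, so matching the two words
  position by position is a function. Consequently an edge of F(n) that witnesses an arc of G(n) can
  be moved over any monomial of the source type.\<close>

lemma multilinear_rename:
  assumes "m \<in> multilinear n" "m' \<in> multilinear n" "type_of m = type_of m'"
  shows "\<exists>\<rho>. m' = map_monomial \<rho> m"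
proof -
  have d: "distinct (word m)" using assms(1) by (simp add: multilinear_def)
  have l: "length (word m) = length (word m')"
    using assms(1,2) multilinear_mdegree unfolding mdegree_def by metis
  define \<rho> where "\<rho> = the \<circ> map_of (zip (word m) (word m'))"
  have "map \<rho> (word m) = word m'"
    by (rule nth_equalityI) (use map_of_zip_nth[OF l d] l in \<open>simp_all add: \<rho>_def\<close>)
  then have "m' = map_monomial \<rho> m"
    using monomial_eqI[of "map_monomial \<rho> m" m'] assms(3) by (simp add: word_map_monomial)
  then show ?thesis by blast
qed

section \<open>The action of the dihedral group\<close>

text \<open>On raw monomials the relations of the dihedral group are plain equations. For
  \<open>D8_act\<close>, which normalizes, inverses cancel only on right-normal arguments.\<close>

definition boxes :: "nat \<times> nat \<Rightarrow> 'x monomial \<Rightarrow> 'x monomial" where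
  "boxes = (\<lambda>(k, l) m. (rotate_boxes ^^ k) ((reflect_boxes ^^ l) m))"

lemma D8_act_eq: "D8_act g m = normalize (boxes g m)"
  by (simp add: D8_act_def boxes_def normal_form_eq_normalize case_prod_beta)

lemma rotate_boxes_4: "(rotate_boxes ^^ 4) m = m"
  by (induct m) (simp_all add: numeral_eq_Suc)

lemma reflect_boxes_2: "(reflect_boxes ^^ 2) m = m"
  by (induct m) (simp_all add: numeral_eq_Suc)

lemma reflect_rotate: "reflect_boxes (rotate_boxes m) = (rotate_boxes ^^ 3) (reflect_boxes m)"
  by (induct m) (simp_all add: numeral_eq_Suc)

lemma reflect_rotate_funpow:
  "reflect_boxes ((rotate_boxes ^^ k) m) = (rotate_boxes ^^ (3 * k)) (reflect_boxes m)"
proof (induct k)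
  case (Suc k)
  have "(rotate_boxes ^^ (3 * Suc k)) x = (rotate_boxes ^^ 3) ((rotate_boxes ^^ (3 * k)) x)"
    for x :: "'a monomial"
    by (simp add: funpow_add)
  then show ?case by (simp add: reflect_rotate Suc)
qed simp

lemma boxes_mod: "boxes (k mod 4, l mod 2) m = boxes (k, l) m"
  by (simp add: boxes_def funpow_mod_eq rotate_boxes_4 reflect_boxes_2)

text \<open>The group law in the coordinates \<open>(k, l)\<close>. Moving a reflection past a
  quarter turn inverts the turn, and the inverse is three quarter turns; hence
  \<open>3 * c\<close>.\<close>

lemma boxes_comp:
  "boxes (a, 0) (boxes (c, d) m) = boxes (a + c, d) m"
  "boxes (a, 1) (boxes (c, d) m) = boxes (a + 3 * c, d + 1) m"
  by (simp_all add: boxes_def funpow_add reflect_rotate_funpow)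

lemma D8_comp:
  assumes "g \<in> D8" "h \<in> D8" shows "\<exists>k \<in> D8. \<forall>m :: 'x monomial. boxes g (boxes h m) = boxes k m"
proof -
  obtain a b c d where g: "g = (a, b)" "b < 2" and h: "h = (c, d)"
    using assms by (auto simp: D8_def)
  then consider "b = 0" | "b = 1" by linarith
  then show ?thesis
  proof cases
    case 1
    then have "\<forall>m :: 'x monomial. boxes g (boxes h m) = boxes ((a + c) mod 4, d mod 2) m"
      by (simp only: g h boxes_comp boxes_mod simp_thms)
    then show ?thesis by (rule_tac x = "((a + c) mod 4, d mod 2)" in bexI) (auto simp: D8_def)
  next
    case 2
    then have "\<forall>m :: 'x monomial. boxes g (boxes h m) = boxes ((a + 3 * c) mod 4, (d + 1) mod 2) m"
      by (simp only: g h boxes_comp boxes_mod simp_thms)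
    then show ?thesis by (rule_tac x = "((a + 3 * c) mod 4, (d + 1) mod 2)" in bexI) (auto simp: D8_def)
  qed
qed

lemma boxes_id: "boxes (0, 0) m = m"
  by (simp add: boxes_def)

lemma D8_inverse:
  assumes "g \<in> D8" shows "\<exists>h \<in> D8. \<forall>m :: 'x monomial. boxes h (boxes g m) = m"
proof -
  obtain a b where g: "g = (a, b)" "a < 4" "b < 2" using assms by (auto simp: D8_def)
  then consider "b = 0" | "b = 1" by linarith
  then show ?thesis
  proof cases
    case 1
    have "\<forall>m :: 'x monomial. boxes ((3 * a) mod 4, 0) (boxes g m) = m"
    proof
      fix m :: "'x monomial"
      have "boxes ((3 * a) mod 4, 0) (boxes g m) = boxes (((3 * a) mod 4 + a) mod 4, 0 mod 2) m"
        unfolding g 1 boxes_comp boxes_mod ..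
      moreover have "((3 * a) mod 4 + a) mod 4 = 0" by presburger
      ultimately show "boxes ((3 * a) mod 4, 0) (boxes g m) = m" by (simp add: boxes_id)
    qed
    then show ?thesis by (rule_tac x = "((3 * a) mod 4, 0)" in bexI) (auto simp: D8_def)
  next
    case 2
    \<comment> \<open>Every reflection of the square is its own inverse; in coordinates, a + 3 * a
      is a multiple of 4.\<close>
    have "\<forall>m :: 'x monomial. boxes (a, 1) (boxes g m) = m"
    proof
      fix m :: "'x monomial"
      have "boxes (a, 1) (boxes g m) = boxes ((a + 3 * a) mod 4, (1 + 1) mod 2) m"
        unfolding g 2 boxes_comp boxes_mod ..
      moreover have "(a + 3 * a) mod 4 = 0" by presburger
      ultimately show "boxes (a, 1) (boxes g m) = m" by (simp add: boxes_id)
    qed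
    then show ?thesis using g by (rule_tac x = "(a, 1)" in bexI) (auto simp: D8_def)
  qed
qed

lemma boxes_induct:
  assumes "\<And>m. P m (rotate_boxes m)" "\<And>m. P m (reflect_boxes m)" "\<And>m. P m m"
    "\<And>p q r. P p q \<Longrightarrow> P q r \<Longrightarrow> P p r"
  shows "P m (boxes g m)"
proof -
  have "P m ((reflect_boxes ^^ l) m)" for l by (induct l) (auto intro: assms)
  moreover have "P u ((rotate_boxes ^^ k) u)" for k u by (induct k) (auto intro: assms)
  ultimately show ?thesis unfolding boxes_def by (auto intro: assms(4) split: prod.split)
qed

lemma boxes_preserves:
  assumes "\<And>p q. R p q \<Longrightarrow> R (rotate_boxes p) (rotate_boxes q)"
    "\<And>p q. R p q \<Longrightarrow> R (reflect_boxes p) (reflect_boxes q)" "R p q"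
  shows "R (boxes g p) (boxes g q)"
proof -
  have "R ((reflect_boxes ^^ l) p) ((reflect_boxes ^^ l) q)" for l
    using assms by (induct l) auto
  moreover have "R u v \<Longrightarrow> R ((rotate_boxes ^^ k) u) ((rotate_boxes ^^ k) v)" for k u v
    using assms by (induct k) auto
  ultimately show ?thesis unfolding boxes_def by (simp split: prod.split)
qed

lemma boxes_approx: "p \<approx> q \<Longrightarrow> boxes g p \<approx> boxes g q"
proof (erule boxes_preserves[rotated 2])
  \<comment> \<open>A quarter turn reverses the order of vertical factors, so their associativity
    becomes horizontal associativity read in the opposite direction.\<close>
  show "p \<approx> q \<Longrightarrow> rotate_boxes p \<approx> rotate_boxes q" for p q :: "'a monomial"
    by (induct rule: assoc_eq.induct)
      (auto intro: assoc_eq.refl assoc_eq.sym assoc_eq.trans assoc_eq.hcong assoc_eq.vcong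
        assoc_eq.hassoc assoc_eq.vassoc assoc_eq.hassoc[THEN assoc_eq.sym])
  show "p \<approx> q \<Longrightarrow> reflect_boxes p \<approx> reflect_boxes q" for p q :: "'a monomial"
    by (induct rule: assoc_eq.induct)
      (auto intro: assoc_eq.refl assoc_eq.sym assoc_eq.trans assoc_eq.hcong assoc_eq.vcong
        assoc_eq.hassoc assoc_eq.vassoc assoc_eq.hassoc[THEN assoc_eq.sym])
qed

lemma boxes_interchange: "interchange p q \<Longrightarrow> interchange (boxes g p) (boxes g q)"
proof (erule boxes_preserves[rotated 2])
  show "interchange p q \<Longrightarrow> interchange (rotate_boxes p) (rotate_boxes q)" for p q :: "'a monomial"
    by (induct rule: interchange.induct) (auto intro: interchange.intros)
  show "interchange p q \<Longrightarrow> interchange (reflect_boxes p) (reflect_boxes q)" for p q :: "'a monomial"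
    by (induct rule: interchange.induct) (auto intro: interchange.intros)
qed

lemma boxes_linked: "linked p q \<Longrightarrow> linked (boxes g p) (boxes g q)"
  unfolding linked_def using boxes_approx boxes_interchange by blast

lemma mset_word_boxes: "mset (word (boxes g m)) = mset (word m)"
proof -
  have "mset (word (rotate_boxes m)) = mset (word m)" "mset (word (reflect_boxes m)) = mset (word m)"
    for m :: "'a monomial"
    by (induct m) auto
  then show ?thesis
    by (intro boxes_induct[where P = "\<lambda>p q. mset (word q) = mset (word p)"]) auto
qed

lemma map_monomial_boxes: "map_monomial f (boxes g m) = boxes g (map_monomial f m)"
proof -
  have 1: "map_monomial f (rotate_boxes m) = rotate_boxes (map_monomial f m)" for m
    by (induct m) auto
  have 2: "map_monomial f (reflect_boxes m) = reflect_boxes (map_monomial f m)" for m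
    by (induct m) auto
  have "map_monomial f ((rotate_boxes ^^ k) m) = (rotate_boxes ^^ k) (map_monomial f m)" for k m
    by (induct k) (auto simp: 1)
  moreover have "map_monomial f ((reflect_boxes ^^ k) m) = (reflect_boxes ^^ k) (map_monomial f m)"
    for k m
    by (induct k) (auto simp: 2)
  ultimately show ?thesis by (simp add: boxes_def case_prod_beta)
qed

lemma map_monomial_normalize: "map_monomial f (normalize m) = normalize (map_monomial f m)"
  by (induct m) (auto simp: map_monomial_hjoin map_monomial_vjoin)

lemma map_monomial_D8_act: "map_monomial f (D8_act g m) = D8_act g (map_monomial f m)"
  by (simp add: D8_act_eq map_monomial_normalize map_monomial_boxes)

lemma type_of_D8_act: "type_of (D8_act g m) = D8_act g (type_of m)"
  unfolding type_of_def by (rule map_monomial_D8_act)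

lemma right_normal_D8_act: "right_normal (D8_act g m)"
  by (simp add: D8_act_eq right_normal_normalize)

lemma mset_word_D8_act: "mset (word (D8_act g m)) = mset (word m)"
  by (simp add: D8_act_eq mset_word_boxes)

lemma mdegree_D8_act: "mdegree (D8_act g m) = mdegree m"
  unfolding mdegree_def by (metis mset_word_D8_act size_mset)

lemma D8_act_assoc_types: "t \<in> assoc_types n \<Longrightarrow> D8_act g t \<in> assoc_types n"
  by (simp add: assoc_types_def right_normal_D8_act mdegree_D8_act)

lemma D8_act_multilinear:
  assumes "m \<in> multilinear n" shows "D8_act g m \<in> multilinear n"
proof -
  have "set (word (D8_act g m)) = set (word m)" "distinct (word (D8_act g m)) = distinct (word m)"
    by (rule mset_eq_setD[OF mset_word_D8_act], rule mset_eq_imp_distinct_iff[OF mset_word_D8_act])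
  then show ?thesis using assms by (simp add: multilinear_def right_normal_D8_act)
qed

text \<open>Rotations and reflections respect associativity, so an inner normalization is absorbed
  by the outer one. This transfers the group law from \<open>boxes\<close> to
  \<open>D8_act\<close>.\<close>

lemma D8_act_normalize: "D8_act g (normalize m) = D8_act g m"
  unfolding D8_act_eq
  by (rule approx_imp_normalize_eq[OF boxes_approx[OF assoc_eq.sym[OF normalize_approx]]])

lemma D8_act_D8_act: "D8_act g (D8_act h m) = normalize (boxes g (boxes h m))"
  unfolding D8_act_eq[of h] D8_act_normalize by (rule D8_act_eq)

lemma D8_act_comp:
  assumes "g \<in> D8" "h \<in> D8"
  shows "\<exists>k \<in> D8. \<forall>m :: 'x monomial. D8_act g (D8_act h m) = D8_act k m"
proof -
  obtain k where "k \<in> D8" "\<And>m :: 'x monomial. boxes g (boxes h m) = boxes k m"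
    using D8_comp[OF assms] by blast
  then have "D8_act g (D8_act h m) = D8_act k m" for m :: "'x monomial"
    by (simp only: D8_act_D8_act D8_act_eq[of k])
  then show ?thesis using \<open>k \<in> D8\<close> by blast
qed

lemma D8_act_inverse:
  assumes "g \<in> D8"
  obtains h where "h \<in> D8" "\<And>m :: 'x monomial. right_normal m \<Longrightarrow> D8_act h (D8_act g m) = m"
  using D8_inverse[OF assms, where 'x = 'x] normalize_right_normal unfolding D8_act_D8_act by metis

lemma D8_act_neighbours:
  "right_normal m \<Longrightarrow> u \<in> set (neighbours m) \<Longrightarrow> D8_act g u \<in> set (neighbours (D8_act g m))"
proof -
  assume m: "right_normal m" "u \<in> set (neighbours m)"
  have "linked (D8_act g m) (D8_act g u)"
    unfolding D8_act_eq
    using linked_approx[OF assoc_eq.sym[OF normalize_approx] boxes_linked[OF neighbours_linked[OF m(2)]]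
        normalize_approx] .
  then show ?thesis by (simp add: linked_iff_neighbours right_normal_D8_act)
qed

lemma D8_act_rtrancl:
  "(m, u) \<in> monomial_rel\<^sup>* \<Longrightarrow> right_normal m \<Longrightarrow> (D8_act g m, D8_act g u) \<in> monomial_rel\<^sup>*"
proof (induct rule: rtrancl_induct)
  case (step u v)
  then have "(D8_act g u, D8_act g v) \<in> monomial_rel"
    using D8_act_neighbours[of u v g] right_normal_rtrancl[of m u] by simp
  then show ?case using step by (meson rtrancl.rtrancl_into_rtrancl)
qed simp

lemma D8_act_neighbours_iff:
  assumes "g \<in> D8" "right_normal m" "right_normal u"
  shows "D8_act g u \<in> set (neighbours (D8_act g m)) \<longleftrightarrow> u \<in> set (neighbours m)"
proof
  obtain h where h: "\<And>m :: 'a monomial. right_normal m \<Longrightarrow> D8_act h (D8_act g m) = m"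
    using D8_act_inverse[OF assms(1)] by blast
  show "u \<in> set (neighbours m)" if "D8_act g u \<in> set (neighbours (D8_act g m))"
    using D8_act_neighbours[OF right_normal_D8_act that, of h] h assms by simp
qed (rule D8_act_neighbours[OF assms(2)])

lemma D8_act_rtrancl_iff:
  assumes "g \<in> D8" "right_normal m" "right_normal u"
  shows "(D8_act g m, D8_act g u) \<in> monomial_rel\<^sup>* \<longleftrightarrow> (m, u) \<in> monomial_rel\<^sup>*"
proof
  obtain h where h: "\<And>m :: 'a monomial. right_normal m \<Longrightarrow> D8_act h (D8_act g m) = m"
    using D8_act_inverse[OF assms(1)] by blast
  show "(m, u) \<in> monomial_rel\<^sup>*" if "(D8_act g m, D8_act g u) \<in> monomial_rel\<^sup>*"
    using D8_act_rtrancl[OF that right_normal_D8_act, of h] h assms by simp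
qed (rule D8_act_rtrancl[OF _ assms(2)])

lemma D8_act_inj:
  assumes "g \<in> D8" shows "inj_on (D8_act g) {m :: 'x monomial. right_normal m}"
proof -
  obtain h where "\<And>m :: 'x monomial. right_normal m \<Longrightarrow> D8_act h (D8_act g m) = m"
    using D8_act_inverse[OF assms] by blast
  then show ?thesis by (intro inj_on_inverseI) simp
qed

text \<open>The inverse \<open>h\<close> is a left inverse of \<open>g\<close> on right-normal
  monomials; being injective there itself, it is also a right inverse.\<close>

lemma D8_act_surj: "g \<in> D8 \<Longrightarrow> right_normal m \<Longrightarrow> \<exists>u. right_normal u \<and> D8_act g u = m"
proof -
  assume "g \<in> D8" "right_normal m"
  then obtain h where h: "h \<in> D8" "\<And>m :: 'a monomial. right_normal m \<Longrightarrow> D8_act h (D8_act g m) = m"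
    using D8_act_inverse by blast
  then have "D8_act h (D8_act g (D8_act h m)) = D8_act h m" by (simp add: right_normal_D8_act)
  then have "D8_act g (D8_act h m) = m"
    using D8_act_inj[OF h(1)] \<open>right_normal m\<close> right_normal_D8_act
    by (metis (mono_tags, lifting) inj_onD mem_Collect_eq)
  then show ?thesis using right_normal_D8_act by blast
qed

lemma D8_act_connected_class:
  assumes "g \<in> D8" "t \<in> assoc_types n"
  shows "D8_act g ` connected_class t = connected_class (D8_act g t)"
proof
  have t: "right_normal t" using assms by (simp add: assoc_types_def)
  show "D8_act g ` connected_class t \<subseteq> connected_class (D8_act g t)"
    using D8_act_rtrancl[OF _ t, of _ g] by (auto simp: in_connected_class)
  show "connected_class (D8_act g t) \<subseteq> D8_act g ` connected_class t"
  proof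
    fix u assume "u \<in> connected_class (D8_act g t)"
    then have u: "(D8_act g t, u) \<in> monomial_rel\<^sup>*" by (simp add: in_connected_class)
    then have "right_normal u" using right_normal_D8_act right_normal_rtrancl by blast
    then obtain v where v: "right_normal v" "u = D8_act g v" using D8_act_surj[OF assms(1)] by metis
    then show "u \<in> D8_act g ` connected_class t"
      using u D8_act_rtrancl_iff[OF assms(1) t] by (simp add: in_connected_class)
  qed
qed

text \<open>Each group element acts on F(n) by an automorphism
  (\<open>D8_act_neighbours_iff\<close>), so the condition on edges is automatic and the image of
  \<open>C\<close> decides.\<close>

lemma induces_bijection_iff:
  assumes "g \<in> D8" "C \<subseteq> assoc_types n"
  shows "induces_bijection n g C D \<longleftrightarrow> D = D8_act g ` C"
proof
  assume "induces_bijection n g C D"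
  then show "D = D8_act g ` C" by (auto simp: induces_bijection_def bij_betw_def)
next
  assume D: "D = D8_act g ` C"
  have "inj_on (D8_act g) C"
    using D8_act_inj[OF assms(1)] assms(2) by (auto simp: assoc_types_def inj_on_def)
  moreover have "(m, m') \<in> arcs (F_graph n) \<longleftrightarrow> (D8_act g m, D8_act g m') \<in> arcs (F_graph n)"
    if "m \<in> multilinear n" "m' \<in> multilinear n" for m m'
    using that D8_act_neighbours_iff[OF assms(1), of m m']
    by (simp add: arcs_F_graph D8_act_multilinear) (simp add: multilinear_def)
  ultimately show "induces_bijection n g C D"
    unfolding induces_bijection_def D by (auto simp: bij_betw_def)
qed

section \<open>Evaluation in double semigroups\<close>

lemma eval_closed:
  "double_semigroup S hc vc \<Longrightarrow> \<forall>x \<in> set_monomial m. val x \<in> S \<Longrightarrow> eval hc vc val m \<in> S"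
  by (induct m) (auto simp: double_semigroup_def)

lemma approx_set_monomial: "p \<approx> q \<Longrightarrow> set_monomial p = set_monomial q"
  by (simp add: set_monomial_word approx_word)

lemma approx_eval:
  assumes "double_semigroup S hc vc" "p \<approx> q" "\<forall>x \<in> set_monomial p. val x \<in> S"
  shows "eval hc vc val p = eval hc vc val q"
  using assms(2,3)
proof (induct rule: assoc_eq.induct)
  case (hassoc p q r)
  then have "eval hc vc val p \<in> S" "eval hc vc val q \<in> S" "eval hc vc val r \<in> S"
    by (auto intro!: eval_closed[OF assms(1)])
  then show ?case
    using assms(1) unfolding double_semigroup_def by simp
next
  case (vassoc p q r)
  then have "eval hc vc val p \<in> S" "eval hc vc val q \<in> S" "eval hc vc val r \<in> S"
    by (auto intro!: eval_closed[OF assms(1)])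
  then show ?case
    using assms(1) unfolding double_semigroup_def by simp
qed (auto dest: approx_set_monomial)

lemma interchange_eval:
  assumes "double_semigroup S hc vc" "interchange p q" "\<forall>x \<in> set_monomial p. val x \<in> S"
  shows "eval hc vc val p = eval hc vc val q"
  using assms(2,3)
proof (induct rule: interchange.induct)
  case (h_to_v w x y z)
  then have "eval hc vc val w \<in> S" "eval hc vc val x \<in> S" "eval hc vc val y \<in> S" "eval hc vc val z \<in> S"
    by (auto intro!: eval_closed[OF assms(1)])
  then show ?case
    using assms(1) unfolding double_semigroup_def by simp
next
  case (v_to_h w y x z)
  then have "eval hc vc val w \<in> S" "eval hc vc val x \<in> S" "eval hc vc val y \<in> S" "eval hc vc val z \<in> S"
    by (auto intro!: eval_closed[OF assms(1)])
  then show ?case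
    using assms(1) unfolding double_semigroup_def by simp
qed auto

text \<open>The second conjunct is the induction invariant: a step keeps the set of indeterminates,
  so all intermediate monomials are evaluated inside \<open>S\<close>, where the laws hold.\<close>

lemma rtrancl_eval:
  assumes "double_semigroup S hc vc" "(m, m') \<in> monomial_rel\<^sup>*" "\<forall>x \<in> set_monomial m. val x \<in> S"
  shows "eval hc vc val m = eval hc vc val m' \<and> (\<forall>x \<in> set_monomial m'. val x \<in> S)"
  using assms(2)
proof (induct rule: rtrancl_induct)
  case (step p q)
  then obtain u v where uv: "p \<approx> u" "interchange u v" "v \<approx> q"
    using neighbours_linked[of q p] by (auto simp: linked_def)
  have "set_monomial q = set_monomial p"
    using step(2) neighbours_mset_word[of q p] mset_eq_setD by (auto simp: set_monomial_word)
  moreover have "set_monomial u = set_monomial p" "set_monomial v = set_monomial q"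
    using uv approx_set_monomial by blast+
  ultimately show ?case
    using step(3) approx_eval[OF assms(1) uv(1), of val] interchange_eval[OF assms(1) uv(2), of val]
      approx_eval[OF assms(1) uv(3), of val] by simp
qed (use assms(3) in simp)

lemma rtrancl_satisfies:
  "double_semigroup S hc vc \<Longrightarrow> (m, m') \<in> monomial_rel\<^sup>* \<Longrightarrow> satisfies S hc vc m m'"
  unfolding satisfies_def using rtrancl_eval[of S hc vc m m'] by blast

section \<open>The order of association types\<close>

lemma mdegree_eq_1: "mdegree u = 1 \<longleftrightarrow> (\<exists>x. u = Var x)"
proof (cases u)
  case (HComp p q)
  then show ?thesis using mdegree_pos[of p] mdegree_pos[of q] by simp
next
  case (VComp p q)
  then show ?thesis using mdegree_pos[of p] mdegree_pos[of q] by simp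
qed simp

lemma type_less_irrefl: "\<not> type_less t t"
  by (induct t) auto

lemma type_less_total: "type_less t u \<or> t = u \<or> type_less u t"
proof (induct t arbitrary: u)
  case (Var x)
  then show ?case using mdegree_eq_1[of u] mdegree_pos[of u] by (cases u) auto
next
  case (HComp p q)
  then show ?case using mdegree_pos[of p] mdegree_pos[of q] by (cases u) fastforce+
next
  case (VComp p q)
  then show ?case using mdegree_pos[of p] mdegree_pos[of q] by (cases u) fastforce+
qed

lemma type_less_mdegree: "type_less t u \<Longrightarrow> mdegree t \<le> mdegree u"
  by (cases t) auto

lemma type_less_trans: "type_less t u \<Longrightarrow> type_less u v \<Longrightarrow> type_less t v"
proof (induct t arbitrary: u v)
  case (Var x)
  then show ?case using type_less_mdegree[of u v] by simp
next
  case (HComp p q)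
  show ?case
  proof (cases "mdegree (p \<^bold>\<circ> q) < mdegree v")
    case False
    then have d: "mdegree u = mdegree v" "mdegree (p \<^bold>\<circ> q) = mdegree v"
      using HComp.prems type_less_mdegree by fastforce+
    then have "mdegree v \<noteq> 1" using mdegree_pos[of p] mdegree_pos[of q] by simp
    then show ?thesis
      using HComp.prems d HComp.hyps
      by (cases u; cases v) (auto split: monomial.splits)
  qed simp
next
  case (VComp p q)
  show ?case
  proof (cases "mdegree (p \<^bold>\<bullet> q) < mdegree v")
    case False
    then have d: "mdegree u = mdegree v" "mdegree (p \<^bold>\<bullet> q) = mdegree v"
      using VComp.prems type_less_mdegree by fastforce+
    then have "mdegree v \<noteq> 1" using mdegree_pos[of p] mdegree_pos[of q] by simp
    then show ?thesis
      using VComp.prems d VComp.hyps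
      by (cases u; cases v) (auto split: monomial.splits)
  qed simp
qed

text \<open>Degrees are compared by stripping both words in parallel, which needs no arithmetic
  during evaluation. \<open>Some True\<close>, \<open>None\<close> and \<open>Some False\<close>
  stand for less, equal and greater.\<close>

primrec compare_length :: "'x list \<Rightarrow> 'y list \<Rightarrow> bool option" where
  "compare_length [] ys = (case ys of [] \<Rightarrow> None | y # ys' \<Rightarrow> Some True)"
| "compare_length (x # xs) ys = (case ys of [] \<Rightarrow> Some False | y # ys' \<Rightarrow> compare_length xs ys')"

lemma compare_length_iff:
  "compare_length xs ys = (if length xs < length ys then Some True
     else if length xs = length ys then None else Some False)"
  by (induct xs arbitrary: ys) (auto split: list.split)

lemma compare_length_word:
  "compare_length (word p) (word q) = (if mdegree p < mdegree q then Some True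
     else if mdegree p = mdegree q then None else Some False)"
  by (simp add: compare_length_iff mdegree_def)

text \<open>A three-valued comparison settles order and equality in one pass. With
  \<open>type_less\<close> alone, each lexicographic step would traverse the left factors
  twice.\<close>

definition compare_types :: "assoc_type \<Rightarrow> assoc_type \<Rightarrow> bool option" where
  "compare_types t u = (if type_less t u then Some True else if t = u then None else Some False)"

definition compare_lex :: "bool option \<Rightarrow> assoc_type \<Rightarrow> assoc_type \<Rightarrow> bool option" where
  "compare_lex c t u = (case c of None \<Rightarrow> compare_types t u | Some b \<Rightarrow> Some b)"

text \<open>Correct for arguments of equal degree only.\<close>

definition compare_roots :: "assoc_type \<Rightarrow> assoc_type \<Rightarrow> bool option" where
  "compare_roots t u = (case t of
     Var x \<Rightarrow> None
   | p \<^bold>\<circ> q \<Rightarrow> (case u of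
       Var y \<Rightarrow> None | p' \<^bold>\<circ> q' \<Rightarrow> compare_lex (compare_types p p') q q' | p' \<^bold>\<bullet> q' \<Rightarrow> Some True)
   | p \<^bold>\<bullet> q \<Rightarrow> (case u of
       Var y \<Rightarrow> None | p' \<^bold>\<circ> q' \<Rightarrow> Some False | p' \<^bold>\<bullet> q' \<Rightarrow> compare_lex (compare_types p p') q q'))"

definition compare_equal_length :: "bool option \<Rightarrow> assoc_type \<Rightarrow> assoc_type \<Rightarrow> bool option" where
  "compare_equal_length c t u = (case c of None \<Rightarrow> compare_roots t u | Some b \<Rightarrow> Some b)"

lemma compare_types_roots:
  assumes "mdegree t = mdegree u" shows "compare_types t u = compare_roots t u"
  using assms mdegree_eq_1[of t] mdegree_eq_1[of u] type_less_irrefl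
  by (cases t; cases u)
    (auto simp: compare_types_def compare_roots_def compare_lex_def split: monomial.splits)

lemma compare_types_length:
  "compare_types t u = compare_equal_length (compare_length (word t) (word u)) t u"
proof -
  have "mdegree t < mdegree u \<Longrightarrow> type_less t u"
    using mdegree_pos[of t] by (cases t) auto
  moreover have "mdegree u < mdegree t \<Longrightarrow> \<not> type_less t u"
    using type_less_mdegree[of t u] by auto
  ultimately show ?thesis
    using compare_types_roots[of t u]
    by (auto simp: compare_equal_length_def compare_types_def compare_length_word)
qed

lemma compare_eval:
  "compare_length [] [] = None"
  "compare_length [] (y # ys) = Some True"
  "compare_length (x # xs) [] = Some False"
  "compare_length (x # xs) (y # ys) = compare_length xs ys"
  "compare_equal_length (Some b) t u = Some b"
  "compare_equal_length None (Var a) (Var b') = None"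
  "compare_equal_length None (p \<^bold>\<circ> q) (p' \<^bold>\<circ> q') = compare_lex (compare_types p p') q q'"
  "compare_equal_length None (p \<^bold>\<bullet> q) (p' \<^bold>\<bullet> q') = compare_lex (compare_types p p') q q'"
  "compare_equal_length None (p \<^bold>\<circ> q) (p' \<^bold>\<bullet> q') = Some True"
  "compare_equal_length None (p \<^bold>\<bullet> q) (p' \<^bold>\<circ> q') = Some False"
  "compare_lex (Some b) t u = Some b"
  "compare_lex None t u = compare_types t u"
  by (simp_all add: compare_equal_length_def compare_roots_def compare_lex_def)

section \<open>Computing components\<close>

text \<open>Equality and membership get names of their own, so that the equations in
  \<open>search_eval\<close> control their evaluation: the continuations \<open>same_and\<close> and
  \<open>mem_or\<close> are entered only when the Boolean in front is known.\<close>

definition same :: "'x monomial \<Rightarrow> 'x monomial \<Rightarrow> bool" where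
  "same t u \<longleftrightarrow> t = u"

definition same_and :: "bool \<Rightarrow> 'x monomial \<Rightarrow> 'x monomial \<Rightarrow> bool" where
  "same_and c t u \<longleftrightarrow> c \<and> t = u"

definition mem :: "'x monomial \<Rightarrow> 'x monomial list \<Rightarrow> bool" where
  "mem t us \<longleftrightarrow> t \<in> set us"

definition mem_or :: "bool \<Rightarrow> 'x monomial \<Rightarrow> 'x monomial list \<Rightarrow> bool" where
  "mem_or c t us \<longleftrightarrow> c \<or> t \<in> set us"

text \<open>Depth-first search with fuel \<open>n\<close>, of which every entry of the work list
  costs one unit, repeated entries included. Exhausted fuel gives the empty list, which a completed
  search from a start vertex never returns. So nonemptiness certifies completion.\<close>

primrec search :: "nat \<Rightarrow> 'x monomial list \<Rightarrow> 'x monomial list \<Rightarrow> 'x monomial list" where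
  "search 0 vis todo = []"
| "search (Suc n) vis todo = (case todo of
     [] \<Rightarrow> vis
   | t # ts \<Rightarrow> if t \<in> set vis then search n vis ts else search n (t # vis) (neighbours t @ ts))"

definition visit :: "bool \<Rightarrow> nat \<Rightarrow> 'x monomial list \<Rightarrow> 'x monomial \<Rightarrow> 'x monomial list \<Rightarrow>
    'x monomial list" where
  "visit c n vis t ts = (if c then search n vis ts else search n (t # vis) (neighbours t @ ts))"

lemma search_eval:
  "same (Var x) (Var y) = (x = y)"
  "same (Var x) (p' \<^bold>\<circ> q') = False"
  "same (Var x) (p' \<^bold>\<bullet> q') = False"
  "same (p \<^bold>\<circ> q) (Var y) = False"
  "same (p \<^bold>\<circ> q) (p' \<^bold>\<circ> q') = same_and (same p p') q q'"
  "same (p \<^bold>\<circ> q) (p' \<^bold>\<bullet> q') = False"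
  "same (p \<^bold>\<bullet> q) (Var y) = False"
  "same (p \<^bold>\<bullet> q) (p' \<^bold>\<circ> q') = False"
  "same (p \<^bold>\<bullet> q) (p' \<^bold>\<bullet> q') = same_and (same p p') q q'"
  "same_and True t u = same t u"
  "same_and False t u = False"
  "mem t [] = False"
  "mem t (u # us) = mem_or (same t u) t us"
  "mem_or True t us = True"
  "mem_or False t us = mem t us"
  "search (numeral k) vis [] = vis"
  "search (numeral k) vis (t # ts) = visit (mem t vis) (pred_numeral k) vis t ts"
  "visit True n vis t ts = search n vis ts"
  "visit False n vis t ts = search n (t # vis) (neighbours t @ ts)"
  by (auto simp: same_def same_and_def mem_def mem_or_def visit_def numeral_eq_Suc)

lemmas neighbours_eval = hjoin.simps vjoin.simps hcons.simps vcons.simps hsplits.simps vsplits.simps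
  hcross1.simps vcross1.simps hcross.simps vcross.simps hcomp_right.simps vcomp_right.simps
  hjoin_right.simps vjoin_right.simps hcomp_left.simps vcomp_left.simps hpair.simps vpair.simps
  neighbours.simps append.simps pred_numeral_simps Num.BitM.simps

text \<open>Invariant: every neighbour of a visited monomial is visited or waiting. At the end
  nothing is waiting, so the visited set is closed under neighbours.\<close>

lemma search_correct:
  assumes "search n vis todo \<noteq> []" "distinct vis"
    "\<forall>t \<in> set vis. set (neighbours t) \<subseteq> set vis \<union> set todo"
  shows "distinct (search n vis todo) \<and> set vis \<union> set todo \<subseteq> set (search n vis todo) \<and>
    (\<forall>t \<in> set (search n vis todo). set (neighbours t) \<subseteq> set (search n vis todo)) \<and>
    (\<forall>t \<in> set (search n vis todo). \<exists>s \<in> set vis \<union> set todo. (s, t) \<in> monomial_rel\<^sup>*)"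
  using assms
proof (induct n arbitrary: vis todo)
  case (Suc n)
  show ?case
  proof (cases todo)
    case Nil
    then show ?thesis using Suc.prems by auto
  next
    case (Cons t ts)
    show ?thesis
    proof (cases "t \<in> set vis")
      case True
      then have "search (Suc n) vis todo = search n vis ts" by (simp add: Cons)
      moreover have "set vis \<union> set todo = set vis \<union> set ts" using True Cons by auto
      ultimately show ?thesis using Suc.hyps[of vis ts] Suc.prems by metis
    next
      case False
      let ?todo = "neighbours t @ ts"
      have eq: "search (Suc n) vis todo = search n (t # vis) ?todo" using False by (simp add: Cons)
      have ih: "distinct (search n (t # vis) ?todo) \<and>
          set (t # vis) \<union> set ?todo \<subseteq> set (search n (t # vis) ?todo) \<and>
          (\<forall>u \<in> set (search n (t # vis) ?todo). set (neighbours u) \<subseteq> set (search n (t # vis) ?todo)) \<and>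
          (\<forall>u \<in> set (search n (t # vis) ?todo). \<exists>s \<in> set (t # vis) \<union> set ?todo. (s, u) \<in> monomial_rel\<^sup>*)"
        by (rule Suc.hyps) (use Suc.prems eq False Cons in auto)
      have reach: "\<exists>s \<in> set vis \<union> set todo. (s, u) \<in> monomial_rel\<^sup>*"
        if "s \<in> set (t # vis) \<union> set ?todo" "(s, u) \<in> monomial_rel\<^sup>*" for s u
      proof (cases "s \<in> set (neighbours t)")
        case True
        then have "(t, u) \<in> monomial_rel\<^sup>*"
          using that(2) by (auto intro: converse_rtrancl_into_rtrancl)
        then show ?thesis using Cons by auto
      qed (use that Cons in auto)
      have "\<forall>u \<in> set (search n (t # vis) ?todo). \<exists>s \<in> set vis \<union> set todo. (s, u) \<in> monomial_rel\<^sup>*"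
        using ih reach by meson
      then show ?thesis using ih unfolding eq by (simp add: Cons)
    qed
  qed
qed simp

lemma search_eq_rtrancl:
  assumes "search n [] [t] \<noteq> []"
  shows "set (search n [] [t]) = {u. (t, u) \<in> monomial_rel\<^sup>*}" "distinct (search n [] [t])"
proof -
  note c = search_correct[OF assms]
  have "u \<in> set (search n [] [t])" if "(t, u) \<in> monomial_rel\<^sup>*" for u
    using that by (induct rule: rtrancl_induct) (use c in auto)
  then show "set (search n [] [t]) = {u. (t, u) \<in> monomial_rel\<^sup>*}" "distinct (search n [] [t])"
    using c by auto
qed

section \<open>Dihedral images of a searched component\<close>

primrec turn :: "'x monomial \<Rightarrow> 'x monomial" where
  "turn (Var x) = Var x"
| "turn (p \<^bold>\<circ> q) = vjoin (turn p) (turn q)"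
| "turn (p \<^bold>\<bullet> q) = hjoin (turn q) (turn p)"

primrec flip :: "'x monomial \<Rightarrow> 'x monomial" where
  "flip (Var x) = Var x"
| "flip (p \<^bold>\<circ> q) = hjoin (flip q) (flip p)"
| "flip (p \<^bold>\<bullet> q) = vjoin (flip p) (flip q)"

lemma turn_eq: "turn m = D8_act (1, 0) m"
  by (induct m) (simp_all add: D8_act_eq boxes_def)

lemma flip_eq: "flip m = D8_act (0, 1) m"
  by (induct m) (simp_all add: D8_act_eq boxes_def)

definition turns :: "'x monomial list \<Rightarrow> 'x monomial list" where
  "turns = map turn"

definition flips :: "'x monomial list \<Rightarrow> 'x monomial list" where
  "flips = map flip"

primrec rotations :: "nat \<Rightarrow> 'x monomial list \<Rightarrow> 'x monomial list list" where
  "rotations 0 ts = []"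
| "rotations (Suc n) ts = ts # rotations n (turns ts)"

text \<open>The count four is spelled with \<open>Suc\<close>, so that the equations of
  \<open>rotations\<close> apply directly.\<close>

definition images :: "'x monomial list \<Rightarrow> 'x monomial list list" where
  "images ts = rotations (Suc (Suc (Suc (Suc 0)))) ts @
     rotations (Suc (Suc (Suc (Suc 0)))) (flips ts)"

definition minimal :: "assoc_type \<Rightarrow> assoc_type list \<Rightarrow> bool" where
  "minimal r ts \<longleftrightarrow> (\<forall>t \<in> set ts. \<not> type_less t r)"

definition minimal_and :: "bool option \<Rightarrow> assoc_type \<Rightarrow> assoc_type list \<Rightarrow> bool" where
  "minimal_and c r ts \<longleftrightarrow> c \<noteq> Some True \<and> minimal r ts"

definition minimal_in_all :: "assoc_type \<Rightarrow> assoc_type list list \<Rightarrow> bool" where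
  "minimal_in_all r tss \<longleftrightarrow> (\<forall>ts \<in> set tss. minimal r ts)"

text \<open>A single vertex decides, because components are equal or disjoint. Hence
  \<open>discard_seen\<close> keeps one list for each component of the orbit, and the length of the
  result is the number of these components.\<close>

definition seen :: "'x monomial list \<Rightarrow> 'x monomial list list \<Rightarrow> bool" where
  "seen ts uss \<longleftrightarrow> (\<exists>us \<in> set uss. hd ts \<in> set us)"

definition seen_or :: "bool \<Rightarrow> 'x monomial list \<Rightarrow> 'x monomial list list \<Rightarrow> bool" where
  "seen_or c ts uss \<longleftrightarrow> c \<or> seen ts uss"

primrec discard_seen :: "'x monomial list list \<Rightarrow> 'x monomial list list \<Rightarrow> 'x monomial list list"
  where
  "discard_seen uss [] = uss"
| "discard_seen uss (ts # tss) =
     (if seen ts uss then discard_seen uss tss else discard_seen (ts # uss) tss)"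

definition discard_if :: "bool \<Rightarrow> 'x monomial list list \<Rightarrow> 'x monomial list \<Rightarrow> 'x monomial list list \<Rightarrow>
    'x monomial list list" where
  "discard_if c uss ts tss = (if c then discard_seen uss tss else discard_seen (ts # uss) tss)"

definition has_length :: "'b list \<Rightarrow> nat \<Rightarrow> bool" where
  "has_length xs n \<longleftrightarrow> length xs = n"

definition check_images :: "nat \<Rightarrow> assoc_type \<Rightarrow> assoc_type list list \<Rightarrow> bool" where
  "check_images m r tss \<longleftrightarrow> minimal_in_all r tss \<and> has_length (discard_seen [] tss) m"

definition check_class :: "nat \<Rightarrow> nat \<Rightarrow> assoc_type \<Rightarrow> assoc_type list \<Rightarrow> bool" where
  "check_class m s r ts \<longleftrightarrow> has_length ts s \<and> check_images m r (images ts)"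

text \<open>
  An entry \<open>(m, s, r)\<close> stands for an orbit of m components of s vertices each, with r the
  smallest vertex of all of them.
\<close>

definition check_orbit :: "nat \<times> nat \<times> assoc_type \<Rightarrow> bool" where
  "check_orbit = (\<lambda>(m, s, r). s \<noteq> 0 \<and> right_normal r \<and> has_length (word r) 9 \<and>
     check_class m s r (search 500 [] [r]))"

definition check_orbits :: "(nat \<times> nat \<times> assoc_type) list \<Rightarrow> bool" where
  "check_orbits d \<longleftrightarrow> list_all check_orbit d"

text \<open>Strictly increasing minima are what keeps the listed orbits apart, see
  \<open>orbits_disjoint\<close>.\<close>

definition ascending :: "assoc_type \<Rightarrow> (nat \<times> nat \<times> assoc_type) list \<Rightarrow> bool" where
  "ascending r d \<longleftrightarrow> sorted_wrt type_less (r # map (snd \<circ> snd) d)"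

definition ascending_and :: "bool option \<Rightarrow> assoc_type \<Rightarrow> (nat \<times> nat \<times> assoc_type) list \<Rightarrow> bool" where
  "ascending_and c r d \<longleftrightarrow> c = Some True \<and> ascending r d"

lemma ascending_Cons: "ascending r ((m, s, t) # d) \<longleftrightarrow> type_less r t \<and> ascending t d"
  using type_less_trans by (auto simp: ascending_def)

lemma check_eval:
  "turns [] = []"
  "turns (t # ts) = turn t # turns ts"
  "flips [] = []"
  "flips (t # ts) = flip t # flips ts"
  "minimal r [] = True"
  "minimal r (t # ts) = minimal_and (compare_types t r) r ts"
  "minimal_and (Some True) r ts = False"
  "minimal_and (Some False) r ts = minimal r ts"
  "minimal_and None r ts = minimal r ts"
  "minimal_in_all r [] = True"
  "minimal_in_all r (ts # tss) = (minimal r ts \<and> minimal_in_all r tss)"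
  "seen ts' [] = False"
  "seen (t # ts) (us # uss) = seen_or (mem t us) (t # ts) uss"
  "seen_or True ts uss = True"
  "seen_or False ts uss = seen ts uss"
  "discard_seen uss' [] = uss'"
  "discard_seen uss' (ts' # tss) = discard_if (seen ts' uss') uss' ts' tss"
  "discard_if True uss' ts' tss = discard_seen uss' tss"
  "discard_if False uss' ts' tss = discard_seen (ts' # uss') tss"
  "has_length [] 0 = True"
  "has_length [] (numeral k) = False"
  "has_length (x # xs) 0 = False"
  "has_length (x # xs) (numeral k) = has_length xs (pred_numeral k)"
  "has_length (x # xs) 1 = has_length xs 0"
  "right_normal (Var () \<^bold>\<circ> q) = right_normal q"
  "right_normal ((a \<^bold>\<bullet> b) \<^bold>\<circ> q) = (right_normal (a \<^bold>\<bullet> b) \<and> right_normal q)"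
  "right_normal (Var () \<^bold>\<bullet> q) = right_normal q"
  "right_normal ((a \<^bold>\<circ> b) \<^bold>\<bullet> q) = (right_normal (a \<^bold>\<circ> b) \<and> right_normal q)"
  "check_orbits [] = True"
  "check_orbits (e # d) = (check_orbit e \<and> check_orbits d)"
  "check_orbit (m, numeral k, r) = (right_normal r \<and> has_length (word r) 9 \<and>
     check_class m (numeral k) r (search 500 [] [r]))"
  "ascending r [] = True"
  "ascending r ((m, s, t) # d) = ascending_and (compare_types r t) t d"
  "ascending_and (Some True) r d = ascending r d"
  "ascending_and (Some False) r d = False"
  "ascending_and None r d = False"
  by (auto simp: turns_def flips_def minimal_def minimal_and_def minimal_in_all_def compare_types_def
      seen_def seen_or_def mem_def discard_if_def has_length_def numeral_eq_Suc check_orbits_def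
      check_orbit_def ascending_and_def ascending_Cons) (simp add: ascending_def)

lemmas orbit_eval = compare_types_length compare_eval search_eval neighbours_eval check_eval
  turn.simps flip.simps rotations.simps images_def check_images_def check_class_def word.simps
  right_normal.simps(1) simp_thms

definition orbit :: "assoc_type \<Rightarrow> assoc_type set set" where
  "orbit r = (\<lambda>g. connected_class (D8_act g r)) ` D8"

lemma turns_D8_act:
  fixes ts :: "'x monomial list"
  shows "turns (map (D8_act (k, l)) ts) = map (D8_act (Suc k, l)) ts"
proof -
  have "D8_act (1, 0) (D8_act (k, l) t) = D8_act (Suc k, l) t" for t :: "'x monomial"
    unfolding D8_act_D8_act boxes_comp by (simp add: D8_act_eq)
  then show ?thesis by (simp add: turns_def turn_eq)
qed

lemma images_eq:
  assumes "\<forall>t \<in> set ts. right_normal t"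
  shows "images ts = map (\<lambda>g. map (D8_act g) ts)
    [(0, 0), (1, 0), (2, 0), (3, 0), (0, 1), (1, 1), (2, 1), (3, 1)]"
proof -
  have "ts = map (D8_act (0, 0)) ts"
    using assms by (simp add: D8_act_eq boxes_id normalize_right_normal map_idI)
  then have "turns ts = map (D8_act (1, 0)) ts" using turns_D8_act[of 0 0 ts] by simp
  moreover have "flips ts = map (D8_act (0, 1)) ts" by (simp add: flips_def flip_eq)
  ultimately show ?thesis
    using \<open>ts = map (D8_act (0, 0)) ts\<close> by (simp add: images_def turns_D8_act numeral_eq_Suc)
qed

lemma D8_list: "D8 = set [(0, 0), (1, 0), (2, 0), (3, 0), (0, 1), (1, 1), (2, 1), (3, 1)]"
proof -
  have "{..<4::nat} = {0, 1, 2, 3}" "{..<2::nat} = {0, 1}" by auto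
  then show ?thesis by (auto simp: D8_def)
qed

lemma discard_seen_correct:
  assumes "\<forall>ts \<in> set uss \<union> set tss. ts \<noteq> []"
    "\<forall>ts \<in> set uss \<union> set tss. \<forall>us \<in> set uss \<union> set tss. set ts = set us \<or> set ts \<inter> set us = {}"
    "distinct (map set uss)"
  shows "distinct (map set (discard_seen uss tss)) \<and>
    set ` set (discard_seen uss tss) = set ` (set uss \<union> set tss)"
  using assms
proof (induct tss arbitrary: uss)
  case (Cons ts tss)
  have hd: "hd ts \<in> set ts" using Cons.prems(1) by simp
  show ?case
  proof (cases "seen ts uss")
    case True
    then obtain us where "us \<in> set uss" "hd ts \<in> set us" by (auto simp: seen_def)
    then have "set ts = set us" using Cons.prems(2) hd by fastforce
    then have "set ` (set uss \<union> set (ts # tss)) = set ` (set uss \<union> set tss)"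
      using \<open>us \<in> set uss\<close> by auto
    moreover have "distinct (map set (discard_seen uss tss)) \<and>
        set ` set (discard_seen uss tss) = set ` (set uss \<union> set tss)"
      by (rule Cons.hyps) (use Cons.prems in auto)
    ultimately show ?thesis using True by simp
  next
    case False
    then have "set ts \<notin> set ` set uss" using hd by (auto simp: seen_def)
    then have "distinct (map set (discard_seen (ts # uss) tss)) \<and>
        set ` set (discard_seen (ts # uss) tss) = set ` (set (ts # uss) \<union> set tss)"
      by (intro Cons.hyps) (use Cons.prems in auto)
    then show ?thesis using False by simp
  qed
qed simp

lemma connected_class_disjoint:
  assumes "t \<in> assoc_types n" "u \<in> assoc_types n" "connected_class t \<noteq> connected_class u"
  shows "connected_class t \<inter> connected_class u = {}"
  using connected_class_eq assms by blast

lemma check_orbit_correct: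
  assumes "check_orbit (m, s, r)"
  shows "r \<in> assoc_types 9" "card (orbit r) = m"
    "C \<in> orbit r \<Longrightarrow> finite C \<and> card C = s \<and> C \<noteq> {} \<and> (\<forall>t \<in> C. \<not> type_less t r)"
proof -
  define K where "K = search 500 [] [r]"
  let ?gs = "[(0, 0), (1, 0), (2, 0), (3, 0), (0, 1), (1, 1), (2, 1), (3, 1)] :: (nat \<times> nat) list"
  let ?R = "discard_seen [] (images K)"
  have c: "right_normal r" "mdegree r = 9" "length K = s" "s \<noteq> 0" "minimal_in_all r (images K)"
    "length ?R = m"
    using assms by (auto simp: check_orbit_def check_class_def check_images_def has_length_def K_def mdegree_def)
  then show r: "r \<in> assoc_types 9" by (simp add: assoc_types_def)
  have K: "set K = connected_class r" "distinct K"
    using search_eq_rtrancl[of 500 r] c(3,4) by (auto simp: K_def connected_class_def)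
  have rn: "\<forall>t \<in> set K. right_normal t"
    using connected_class_subset[OF r] by (auto simp: K assoc_types_def)
  have im: "images K = map (\<lambda>g. map (D8_act g) K) ?gs" by (rule images_eq[OF rn])
  \<comment> \<open>One search serves the whole orbit, since the action carries components to
    components.\<close>
  have set: "set (map (D8_act g) K) = connected_class (D8_act g r)" if "g \<in> D8" for g
    using D8_act_connected_class[OF that r] by (simp add: K)
  have len: "length (map (D8_act g) K) = s" for g using c by simp
  have dist: "distinct (map (D8_act g) K)" if "g \<in> D8" for g
    using K(2) rn inj_on_subset[OF D8_act_inj[OF that]] by (auto simp: distinct_map)
  have sets: "set ` set (images K) = orbit r"
  proof -
    have "set ` set (images K) = (\<lambda>g. set (map (D8_act g) K)) ` D8"
      unfolding im D8_list by (simp only: set_map image_image)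
    also have "\<dots> = orbit r" unfolding orbit_def by (rule image_cong[OF HOL.refl set])
    finally show ?thesis .
  qed
  have "distinct (map set ?R) \<and> set ` set ?R = set ` (set [] \<union> set (images K))"
  proof (rule discard_seen_correct)
    show "\<forall>ts \<in> set [] \<union> set (images K). ts \<noteq> []"
      using c(3,4) by (auto simp: im)
    show "\<forall>ts \<in> set [] \<union> set (images K). \<forall>us \<in> set [] \<union> set (images K).
        set ts = set us \<or> set ts \<inter> set us = {}"
    proof (intro ballI)
      fix ts us assume "ts \<in> set [] \<union> set (images K)" "us \<in> set [] \<union> set (images K)"
      then have "set ts \<in> orbit r" "set us \<in> orbit r" using sets by auto
      then obtain g h where "set ts = connected_class (D8_act g r)" "set us = connected_class (D8_act h r)"
        by (auto simp: orbit_def)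
      then show "set ts = set us \<or> set ts \<inter> set us = {}"
        using connected_class_disjoint[OF D8_act_assoc_types[OF r] D8_act_assoc_types[OF r]] by metis
    qed
  qed simp
  then have "distinct (map set ?R)" "set (map set ?R) = orbit r" using sets by auto
  then show "card (orbit r) = m" using c(6) distinct_card by (metis length_map)
  show "finite C \<and> card C = s \<and> C \<noteq> {} \<and> (\<forall>t \<in> C. \<not> type_less t r)" if "C \<in> orbit r"
  proof -
    from that obtain g where g: "g \<in> D8" "C = connected_class (D8_act g r)" by (auto simp: orbit_def)
    then have C: "C = set (map (D8_act g) K)" using set by simp
    then have "card C = s" using dist[OF g(1)] len distinct_card by metis
    moreover have "map (D8_act g) K \<in> set (images K)"
      using g(1) unfolding im D8_list by auto
    then have "\<forall>t \<in> C. \<not> type_less t r"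
      using c(5) unfolding C minimal_in_all_def minimal_def by blast
    ultimately show ?thesis using c(4) C by auto
  qed
qed

lemma orbit_refl:
  assumes "r \<in> assoc_types n" shows "connected_class r \<in> orbit r"
proof -
  have "D8_act (0, 0) r = r"
    using assms by (simp add: D8_act_eq boxes_id normalize_right_normal assoc_types_def)
  moreover have "(0, 0) \<in> D8" by (simp add: D8_def)
  ultimately show ?thesis unfolding orbit_def by (metis image_eqI)
qed

text \<open>Applying the inverse of \<open>g'\<close> to the common component shows that some group
  element carries the class of \<open>r\<close> to the class of \<open>r'\<close>.\<close>

lemma orbit_eq:
  assumes "r \<in> assoc_types n" "r' \<in> assoc_types n" "C \<in> orbit r" "C \<in> orbit r'"
  shows "\<exists>C \<in> orbit r. r' \<in> C"
proof -
  obtain g g' where g: "g \<in> D8" "g' \<in> D8" "C = connected_class (D8_act g r)"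
    "C = connected_class (D8_act g' r')"
    using assms by (auto simp: orbit_def)
  obtain h where h: "h \<in> D8" "\<And>t :: assoc_type. right_normal t \<Longrightarrow> D8_act h (D8_act g' t) = t"
    using D8_act_inverse[OF g(2)] by blast
  obtain k where k: "k \<in> D8" "\<And>t :: assoc_type. D8_act h (D8_act g t) = D8_act k t"
    using D8_act_comp[OF h(1) g(1)] by blast
  have "D8_act h ` C = connected_class (D8_act k r)"
    using D8_act_connected_class[OF h(1) D8_act_assoc_types[OF assms(1)]] k g(3) by simp
  moreover have "D8_act h ` C = connected_class r'"
    using D8_act_connected_class[OF h(1) D8_act_assoc_types[OF assms(2)]] h g(4) assms(2)
    by (simp add: assoc_types_def)
  ultimately show ?thesis using k(1) connected_class_refl by (auto simp: orbit_def)
qed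

text \<open>If the orbits shared a component, then \<open>r\<close> would occur in the orbit of
  \<open>r'\<close>, although it is smaller than the minimum \<open>r'\<close> of that
  orbit.\<close>

lemma orbits_disjoint:
  assumes "check_orbit (m, s, r)" "check_orbit (m', s', r')" "type_less r r'"
  shows "orbit r \<inter> orbit r' = {}"
proof -
  note c = check_orbit_correct[OF assms(1)] and c' = check_orbit_correct[OF assms(2)]
  show ?thesis using orbit_eq[OF c'(1) c(1)] c'(3) assms(3) by blast
qed

definition orbit_union :: "(nat \<times> nat \<times> assoc_type) list \<Rightarrow> assoc_type set set" where
  "orbit_union d = (\<Union>(m, s, r) \<in> set d. orbit r)"

lemma card_orbit_union:
  assumes "check_orbits d" "sorted_wrt type_less (map (snd \<circ> snd) d)"
  shows "finite (orbit_union d) \<and> card (orbit_union d) = sum_list (map (\<lambda>(m, s, r). m) d) \<and>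
    sum card (orbit_union d) = sum_list (map (\<lambda>(m, s, r). m * s) d)"
  using assms
proof (induct d)
  case (Cons e d)
  obtain m s r where e: "e = (m, s, r)" by (cases e) auto
  have ok: "check_orbit (m, s, r)" "check_orbits d" using Cons.prems by (simp_all add: e check_orbits_def)
  note c = check_orbit_correct[OF ok(1)]
  have "orbit r \<inter> orbit_union d = {}"
  proof -
    have "orbit r \<inter> orbit r' = {}" if "(m', s', r') \<in> set d" for m' s' r'
    proof (rule orbits_disjoint[OF ok(1)])
      show "check_orbit (m', s', r')" using ok(2) that by (auto simp: check_orbits_def list_all_iff)
      show "type_less r r'" using Cons.prems(2) that by (force simp: e)
    qed
    then show ?thesis by (auto simp: orbit_union_def)
  qed
  moreover have "finite (orbit r)" by (simp add: orbit_def D8_def)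
  moreover have "sum card (orbit r) = m * s" using c(2,3) by simp
  moreover have "orbit_union (e # d) = orbit r \<union> orbit_union d" by (auto simp: orbit_union_def e)
  ultimately show ?case
    using Cons.hyps ok(2) Cons.prems(2) c(2) by (simp add: card_Un_disjoint sum.union_disjoint e)
qed (simp add: orbit_union_def)

section \<open>Counting association types\<close>

definition degree_count :: "(assoc_type \<Rightarrow> bool) \<Rightarrow> nat \<Rightarrow> nat" where
  "degree_count P n = card {t. P t \<and> mdegree t = n}"

lemma finite_degree: "finite {t :: assoc_type. mdegree t = n}"
proof (induct n rule: less_induct)
  case (less n)
  let ?D = "\<Union>k \<in> {..<n}. {t :: assoc_type. mdegree t = k}"
  have "finite ?D" using less by auto
  have "{t :: assoc_type. mdegree t = n} \<subseteq>
      {Var ()} \<union> (\<lambda>(p, q). p \<^bold>\<circ> q) ` (?D \<times> ?D) \<union> (\<lambda>(p, q). p \<^bold>\<bullet> q) ` (?D \<times> ?D)"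
  proof
    fix t :: assoc_type assume t: "t \<in> {t. mdegree t = n}"
    show "t \<in> {Var ()} \<union> (\<lambda>(p, q). p \<^bold>\<circ> q) ` (?D \<times> ?D) \<union> (\<lambda>(p, q). p \<^bold>\<bullet> q) ` (?D \<times> ?D)"
    proof (cases t)
      case (HComp p q)
      then show ?thesis using t mdegree_pos[of p] mdegree_pos[of q] by auto
    next
      case (VComp p q)
      then show ?thesis using t mdegree_pos[of p] mdegree_pos[of q] by auto
    qed simp
  qed
  then show ?case by (rule finite_subset) (use \<open>finite ?D\<close> in blast)
qed

lemma finite_degree_Collect: "finite {t :: assoc_type. P t \<and> mdegree t = n}"
  by (rule finite_subset[OF _ finite_degree[of n]]) auto

lemma degree_count_disj:
  assumes "\<And>t. P t \<Longrightarrow> Q t \<Longrightarrow> False"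
  shows "degree_count (\<lambda>t. P t \<or> Q t) n = degree_count P n + degree_count Q n"
proof -
  have "{t. (P t \<or> Q t) \<and> mdegree t = n} = {t. P t \<and> mdegree t = n} \<union> {t. Q t \<and> mdegree t = n}"
    by auto
  then show ?thesis
    unfolding degree_count_def using assms by (auto intro!: card_Un_disjoint finite_degree_Collect)
qed

lemma degree_count_Var: "degree_count (\<lambda>t. t = Var ()) n = (if n = 1 then 1 else 0)"
proof -
  have "{t. t = Var () \<and> mdegree t = n} = (if n = 1 then {Var ()} else {})" by auto
  then show ?thesis by (simp add: degree_count_def)
qed

text \<open>A convolution: the constructor \<open>c\<close> is injective and the degree additive.
  The range of \<open>k\<close> reflects that both factors have positive degree.\<close>

lemma degree_count_product:
  assumes "inj (\<lambda>(p, q). c p q)" "\<And>p q. mdegree (c p q) = mdegree p + mdegree q"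
  shows "degree_count (\<lambda>t. \<exists>p q. t = c p q \<and> P p \<and> Q q) n =
    (\<Sum>k = 1..<n. degree_count P k * degree_count Q (n - k))"
proof -
  let ?P = "\<lambda>k. {p. P p \<and> mdegree p = k}" and ?Q = "\<lambda>k. {q. Q q \<and> mdegree q = k}"
  let ?A = "\<lambda>k. (\<lambda>(p, q). c p q) ` (?P k \<times> ?Q (n - k))"
  have "{t. (\<exists>p q. t = c p q \<and> P p \<and> Q q) \<and> mdegree t = n} = (\<Union>k \<in> {1..<n}. ?A k)"
  proof
    show "{t. (\<exists>p q. t = c p q \<and> P p \<and> Q q) \<and> mdegree t = n} \<subseteq> (\<Union>k \<in> {1..<n}. ?A k)"
    proof
      fix t assume "t \<in> {t. (\<exists>p q. t = c p q \<and> P p \<and> Q q) \<and> mdegree t = n}"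
      then obtain p q where "t = c p q" "P p" "Q q" "mdegree p + mdegree q = n"
        by (auto simp: assms(2))
      moreover then have "mdegree p \<in> {1..<n}" "mdegree q = n - mdegree p"
        using mdegree_pos[of p] mdegree_pos[of q] by auto
      ultimately show "t \<in> (\<Union>k \<in> {1..<n}. ?A k)" by blast
    qed
  qed (auto simp: assms(2))
  moreover have "card (\<Union>k \<in> {1..<n}. ?A k) = (\<Sum>k = 1..<n. card (?A k))"
  proof (rule card_UN_disjoint)
    show "\<forall>i \<in> {1..<n}. \<forall>j \<in> {1..<n}. i \<noteq> j \<longrightarrow> ?A i \<inter> ?A j = {}"
    proof (intro ballI impI)
      fix i j :: nat assume "i \<noteq> j"
      have False if "t \<in> ?A i" "t \<in> ?A j" for t
      proof -
        from that(1) obtain p q where "t = c p q" "mdegree p = i" by auto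
        moreover from that(2) obtain p' q' where "t = c p' q'" "mdegree p' = j" by auto
        ultimately show False using injD[OF assms(1), of "(p, q)" "(p', q')"] \<open>i \<noteq> j\<close> by simp
      qed
      then show "?A i \<inter> ?A j = {}" by blast
    qed
  qed (auto intro!: finite_imageI finite_cartesian_product finite_degree_Collect)
  moreover have "card (?A k) = degree_count P k * degree_count Q (n - k)" for k
    unfolding degree_count_def card_cartesian_product[symmetric]
    by (rule card_image) (rule inj_on_subset[OF assms(1) subset_UNIV])
  ultimately show ?thesis by (simp add: degree_count_def)
qed

lemma degree_count_HComp:
  "degree_count (\<lambda>t. \<exists>p q. t = p \<^bold>\<circ> q \<and> P p \<and> Q q) n =
    (\<Sum>k = 1..<n. degree_count P k * degree_count Q (n - k))"
  by (rule degree_count_product) (auto simp: inj_def)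

lemma degree_count_VComp:
  "degree_count (\<lambda>t. \<exists>p q. t = p \<^bold>\<bullet> q \<and> P p \<and> Q q) n =
    (\<Sum>k = 1..<n. degree_count P k * degree_count Q (n - k))"
  by (rule degree_count_product) (auto simp: inj_def)

text \<open>Splitting by the root operation makes the count recursive: in a right-normal horizontal
  product the left factor is an indeterminate or vertically rooted, and vice versa.\<close>

definition hrooted :: "(assoc_type \<Rightarrow> bool) \<Rightarrow> assoc_type \<Rightarrow> bool" where
  "hrooted P t \<longleftrightarrow> P t \<and> (\<exists>p q. t = p \<^bold>\<circ> q)"

definition vrooted :: "(assoc_type \<Rightarrow> bool) \<Rightarrow> assoc_type \<Rightarrow> bool" where
  "vrooted P t \<longleftrightarrow> P t \<and> (\<exists>p q. t = p \<^bold>\<bullet> q)"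

lemma degree_count_cong: "(\<And>t. P t = Q t) \<Longrightarrow> degree_count P n = degree_count Q n"
  by (simp add: degree_count_def)

lemma degree_count_rooted:
  assumes "P (Var ())"
  shows "degree_count P n = (if n = 1 then 1 else 0) +
    (degree_count (hrooted P) n + degree_count (vrooted P) n)"
proof -
  have "degree_count P n = degree_count (\<lambda>t. t = Var () \<or> (hrooted P t \<or> vrooted P t)) n"
  proof (rule degree_count_cong)
    show "P t = (t = Var () \<or> (hrooted P t \<or> vrooted P t))" for t
      using assms by (cases t) (auto simp: hrooted_def vrooted_def)
  qed
  also have "\<dots> = (if n = 1 then 1 else 0) + (degree_count (hrooted P) n + degree_count (vrooted P) n)"
    by (subst degree_count_disj, force simp: hrooted_def vrooted_def,
        subst degree_count_disj, force simp: hrooted_def vrooted_def)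
      (simp add: degree_count_Var)
  finally show ?thesis .
qed

lemma degree_count_Var_or:
  assumes "\<not> P (Var ())"
  shows "degree_count (\<lambda>t. t = Var () \<or> P t) n = (if n = 1 then 1 else 0) + degree_count P n"
  using assms by (subst degree_count_disj) (auto simp: degree_count_Var)

lemma not_rooted_Var: "\<not> hrooted P (Var x)" "\<not> vrooted P (Var x)"
  by (simp_all add: hrooted_def vrooted_def)

lemma degree_count_hrooted:
  assumes "\<And>t. P t \<longleftrightarrow> (\<exists>p q. t = p \<^bold>\<circ> q \<and> (p = Var () \<or> vrooted Q p) \<and> R q)"
  shows "degree_count P n = (\<Sum>k = 1..<n.
    ((if k = 1 then 1 else 0) + degree_count (vrooted Q) k) * degree_count R (n - k))"
proof -
  have "degree_count P n = degree_count (\<lambda>t. \<exists>p q. t = p \<^bold>\<circ> q \<and> (p = Var () \<or> vrooted Q p) \<and> R q) n"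
    by (rule degree_count_cong) (rule assms)
  also have "\<dots> = (\<Sum>k = 1..<n. degree_count (\<lambda>p. p = Var () \<or> vrooted Q p) k * degree_count R (n - k))"
    by (rule degree_count_HComp)
  finally show ?thesis by (simp add: degree_count_Var_or not_rooted_Var)
qed

lemma degree_count_vrooted:
  assumes "\<And>t. P t \<longleftrightarrow> (\<exists>p q. t = p \<^bold>\<bullet> q \<and> (p = Var () \<or> hrooted Q p) \<and> R q)"
  shows "degree_count P n = (\<Sum>k = 1..<n.
    ((if k = 1 then 1 else 0) + degree_count (hrooted Q) k) * degree_count R (n - k))"
proof -
  have "degree_count P n = degree_count (\<lambda>t. \<exists>p q. t = p \<^bold>\<bullet> q \<and> (p = Var () \<or> hrooted Q p) \<and> R q) n"
    by (rule degree_count_cong) (rule assms)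
  also have "\<dots> = (\<Sum>k = 1..<n. degree_count (\<lambda>p. p = Var () \<or> hrooted Q p) k * degree_count R (n - k))"
    by (rule degree_count_VComp)
  finally show ?thesis by (simp add: degree_count_Var_or not_rooted_Var)
qed

lemma not_HComp_iff: "(\<nexists>u v. p = u \<^bold>\<circ> v) \<longleftrightarrow> p = Var () \<or> (\<exists>u v. p = u \<^bold>\<bullet> v)"
  by (cases p) auto

lemma not_VComp_iff: "(\<nexists>u v. p = u \<^bold>\<bullet> v) \<longleftrightarrow> p = Var () \<or> (\<exists>u v. p = u \<^bold>\<circ> v)"
  by (cases p) auto

lemma count_right_normal:
  "degree_count (hrooted right_normal) n = (\<Sum>k = 1..<n.
    ((if k = 1 then 1 else 0) + degree_count (vrooted right_normal) k) * degree_count right_normal (n - k))"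
  "degree_count (vrooted right_normal) n = (\<Sum>k = 1..<n.
    ((if k = 1 then 1 else 0) + degree_count (hrooted right_normal) k) * degree_count right_normal (n - k))"
proof -
  show "degree_count (hrooted right_normal) n = (\<Sum>k = 1..<n.
    ((if k = 1 then 1 else 0) + degree_count (vrooted right_normal) k) * degree_count right_normal (n - k))"
  proof (rule degree_count_hrooted)
    show "hrooted right_normal t \<longleftrightarrow>
      (\<exists>p q. t = p \<^bold>\<circ> q \<and> (p = Var () \<or> vrooted right_normal p) \<and> right_normal q)" for t
    proof (cases t)
      case (HComp p q)
      show ?thesis unfolding HComp hrooted_def vrooted_def right_normal.simps not_HComp_iff by auto
    qed (auto simp: hrooted_def)
  qed
  show "degree_count (vrooted right_normal) n = (\<Sum>k = 1..<n.
    ((if k = 1 then 1 else 0) + degree_count (hrooted right_normal) k) * degree_count right_normal (n - k))"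
  proof (rule degree_count_vrooted)
    show "vrooted right_normal t \<longleftrightarrow>
      (\<exists>p q. t = p \<^bold>\<bullet> q \<and> (p = Var () \<or> hrooted right_normal p) \<and> right_normal q)" for t
    proof (cases t)
      case (VComp p q)
      show ?thesis unfolding VComp hrooted_def vrooted_def right_normal.simps not_VComp_iff by auto
    qed (auto simp: vrooted_def)
  qed
qed

section \<open>Association types that admit no interchange\<close>

definition isolated :: "assoc_type \<Rightarrow> bool" where
  "isolated t \<longleftrightarrow> right_normal t \<and> neighbours t = []"

definition hvar :: "assoc_type \<Rightarrow> bool" where
  "hvar t \<longleftrightarrow> (\<exists>p q. t = p \<^bold>\<circ> q \<and> p = Var () \<and> isolated q)"

definition vvar :: "assoc_type \<Rightarrow> bool" where
  "vvar t \<longleftrightarrow> (\<exists>p q. t = p \<^bold>\<bullet> q \<and> p = Var () \<and> isolated q)"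

lemma hcross_eq_Nil: "hcross ss ts = [] \<longleftrightarrow> ss = [] \<or> ts = []"
proof -
  have "hcross ss [] = []" by (induct ss) auto
  then show ?thesis by (cases ss; cases ts) auto
qed

lemma vcross_eq_Nil: "vcross ss ts = [] \<longleftrightarrow> ss = [] \<or> ts = []"
proof -
  have "vcross ss [] = []" by (induct ss) auto
  then show ?thesis by (cases ss; cases ts) auto
qed

lemma neighbours_eq_Nil:
  "neighbours (p \<^bold>\<circ> q) = [] \<longleftrightarrow> neighbours p = [] \<and> neighbours q = [] \<and> hpair p q = []"
  "neighbours (p \<^bold>\<bullet> q) = [] \<longleftrightarrow> neighbours p = [] \<and> neighbours q = [] \<and> vpair p q = []"
  unfolding set_empty[symmetric] by auto

lemma splits_eq_Nil: "hsplits p = [] \<longleftrightarrow> (\<nexists>a b. p = a \<^bold>\<circ> b)" "vsplits p = [] \<longleftrightarrow> (\<nexists>a b. p = a \<^bold>\<bullet> b)"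
  by (cases p; simp)+

lemma hpair_eq_Nil:
  "hpair p q = [] \<longleftrightarrow> (\<nexists>a b. p = a \<^bold>\<bullet> b) \<or>
    \<not> ((\<exists>a b. q = a \<^bold>\<bullet> b) \<or> (\<exists>a b c. q = (a \<^bold>\<bullet> b) \<^bold>\<circ> c))"
proof (cases q)
  case (HComp a b)
  have "hpair p (a \<^bold>\<circ> b) = [] \<longleftrightarrow> vcross (vsplits p) (vsplits a) = []"
    unfolding set_empty[symmetric] by simp
  then show ?thesis by (auto simp: HComp vcross_eq_Nil splits_eq_Nil)
qed (auto simp: vcross_eq_Nil splits_eq_Nil)

lemma vpair_eq_Nil:
  "vpair p q = [] \<longleftrightarrow> (\<nexists>a b. p = a \<^bold>\<circ> b) \<or>
    \<not> ((\<exists>a b. q = a \<^bold>\<circ> b) \<or> (\<exists>a b c. q = (a \<^bold>\<circ> b) \<^bold>\<bullet> c))"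
proof (cases q)
  case (VComp a b)
  have "vpair p (a \<^bold>\<bullet> b) = [] \<longleftrightarrow> hcross (hsplits p) (hsplits a) = []"
    unfolding set_empty[symmetric] by simp
  then show ?thesis by (auto simp: VComp hcross_eq_Nil splits_eq_Nil)
qed (auto simp: hcross_eq_Nil splits_eq_Nil)

text \<open>A vertically rooted \<open>p\<close> must not be followed by another vertically rooted
  factor. So \<open>q\<close> is an indeterminate or begins with one; in the second case nothing can
  happen at the root of \<open>q\<close>, and the rest of \<open>q\<close> has to be isolated. An
  indeterminate \<open>p\<close> puts no restriction on the root of \<open>q\<close>.\<close>

lemma isolated_HComp_iff:
  "isolated (p \<^bold>\<circ> q) \<longleftrightarrow> (p = Var () \<and> isolated q) \<or> (vrooted isolated p \<and> (q = Var () \<or> hvar q))"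
proof (cases p)
  case (VComp a b)
  show ?thesis
  proof (cases q)
    case (HComp c d)
    then show ?thesis
      unfolding isolated_def neighbours_eq_Nil hpair_eq_Nil vrooted_def hvar_def VComp
      by (cases c) (auto simp: neighbours_eq_Nil hpair_eq_Nil vpair_eq_Nil
          simp del: neighbours.simps(2,3) hpair.simps vpair.simps)
  qed (auto simp: VComp isolated_def neighbours_eq_Nil hpair_eq_Nil vrooted_def hvar_def
      simp del: neighbours.simps(2,3) hpair.simps vpair.simps)
qed (auto simp: isolated_def neighbours_eq_Nil hpair_eq_Nil vrooted_def
      simp del: neighbours.simps(2,3) hpair.simps vpair.simps)

lemma isolated_VComp_iff:
  "isolated (p \<^bold>\<bullet> q) \<longleftrightarrow> (p = Var () \<and> isolated q) \<or> (hrooted isolated p \<and> (q = Var () \<or> vvar q))"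
proof (cases p)
  case (HComp a b)
  show ?thesis
  proof (cases q)
    case (VComp c d)
    then show ?thesis
      unfolding isolated_def neighbours_eq_Nil vpair_eq_Nil hrooted_def vvar_def HComp
      by (cases c) (auto simp: neighbours_eq_Nil hpair_eq_Nil vpair_eq_Nil
          simp del: neighbours.simps(2,3) hpair.simps vpair.simps)
  qed (auto simp: HComp isolated_def neighbours_eq_Nil vpair_eq_Nil hrooted_def vvar_def
      simp del: neighbours.simps(2,3) hpair.simps vpair.simps)
qed (auto simp: isolated_def neighbours_eq_Nil vpair_eq_Nil hrooted_def
      simp del: neighbours.simps(2,3) hpair.simps vpair.simps)

lemma not_var_Var: "\<not> hvar (Var x)" "\<not> vvar (Var x)"
  by (simp_all add: hvar_def vvar_def)

lemma sum_Var:
  fixes n :: nat and f :: "nat \<Rightarrow> nat"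
  shows "(\<Sum>k = 1..<n. (if k = 1 then 1 else 0) * f k) = (if 1 < n then f 1 else 0)"
proof (cases "1 < n")
  case True
  then have n: "{1..<n} = insert 1 {2..<n}" by auto
  have "(\<Sum>k = 2..<n. (if k = 1 then 1 else 0) * f k) = 0" by (rule sum.neutral) auto
  then show ?thesis unfolding n using True by simp
qed simp

lemma count_hvar: "degree_count hvar n = (if 1 < n then degree_count isolated (n - 1) else 0)"
  unfolding hvar_def degree_count_HComp degree_count_Var by (rule sum_Var)

lemma count_vvar: "degree_count vvar n = (if 1 < n then degree_count isolated (n - 1) else 0)"
  unfolding vvar_def degree_count_VComp degree_count_Var by (rule sum_Var)

lemma count_isolated:
  "degree_count (hrooted isolated) n = degree_count hvar n + (\<Sum>k = 1..<n.
    degree_count (vrooted isolated) k * ((if n - k = 1 then 1 else 0) + degree_count hvar (n - k)))"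
  "degree_count (vrooted isolated) n = degree_count vvar n + (\<Sum>k = 1..<n.
    degree_count (hrooted isolated) k * ((if n - k = 1 then 1 else 0) + degree_count vvar (n - k)))"
proof -
  let ?H = "\<lambda>t. \<exists>p q. t = p \<^bold>\<circ> q \<and> vrooted isolated p \<and> (q = Var () \<or> hvar q)"
  have "degree_count (hrooted isolated) n = degree_count (\<lambda>t. hvar t \<or> ?H t) n"
  proof (rule degree_count_cong)
    show "hrooted isolated t \<longleftrightarrow> hvar t \<or> ?H t" for t
      by (cases t) (auto simp: hrooted_def hvar_def isolated_HComp_iff)
  qed
  also have "\<dots> = degree_count hvar n + degree_count ?H n"
    by (rule degree_count_disj) (auto simp: hvar_def vrooted_def)
  finally show "degree_count (hrooted isolated) n = degree_count hvar n + (\<Sum>k = 1..<n.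
    degree_count (vrooted isolated) k * ((if n - k = 1 then 1 else 0) + degree_count hvar (n - k)))"
    unfolding degree_count_HComp by (simp add: degree_count_Var_or not_var_Var)
  let ?V = "\<lambda>t. \<exists>p q. t = p \<^bold>\<bullet> q \<and> hrooted isolated p \<and> (q = Var () \<or> vvar q)"
  have "degree_count (vrooted isolated) n = degree_count (\<lambda>t. vvar t \<or> ?V t) n"
  proof (rule degree_count_cong)
    show "vrooted isolated t \<longleftrightarrow> vvar t \<or> ?V t" for t
      by (cases t) (auto simp: vrooted_def vvar_def isolated_VComp_iff)
  qed
  also have "\<dots> = degree_count vvar n + degree_count ?V n"
    by (rule degree_count_disj) (auto simp: vvar_def hrooted_def)
  finally show "degree_count (vrooted isolated) n = degree_count vvar n + (\<Sum>k = 1..<n.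
    degree_count (hrooted isolated) k * ((if n - k = 1 then 1 else 0) + degree_count vvar (n - k)))"
    unfolding degree_count_VComp by (simp add: degree_count_Var_or not_var_Var)
qed

lemma sum_from_1:
  fixes f :: "nat \<Rightarrow> nat"
  shows
  "(\<Sum>k = 1..<2. f k) = (f 1)"
  "(\<Sum>k = 1..<3. f k) = (f 1 + f 2)"
  "(\<Sum>k = 1..<4. f k) = (f 1 + f 2 + f 3)"
  "(\<Sum>k = 1..<5. f k) = (f 1 + f 2 + f 3 + f 4)"
  "(\<Sum>k = 1..<6. f k) = (f 1 + f 2 + f 3 + f 4 + f 5)"
  "(\<Sum>k = 1..<7. f k) = (f 1 + f 2 + f 3 + f 4 + f 5 + f 6)"
  "(\<Sum>k = 1..<8. f k) = (f 1 + f 2 + f 3 + f 4 + f 5 + f 6 + f 7)"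
  "(\<Sum>k = 1..<9. f k) = (f 1 + f 2 + f 3 + f 4 + f 5 + f 6 + f 7 + f 8)"
  by (simp_all add: numeral_eq_Suc)

text \<open>The totals 1, 2, 6, 22, 90, ... are the large Schroeder numbers; from degree 2 on, the
  counts for one root operation are the small ones, half the total by the symmetry of the two
  operations.\<close>

lemma card_assoc_types_9: "card (assoc_types 9) = 41586"
proof -
  let ?h = "degree_count (hrooted right_normal)" and ?v = "degree_count (vrooted right_normal)"
  let ?a = "degree_count right_normal"
  note h = count_right_normal(1) and v = count_right_normal(2)
  have a: "?a n = (if n = 1 then 1 else 0) + (?h n + ?v n)" for n
    by (rule degree_count_rooted) simp
  have 1: "?h 1 = 0" "?v 1 = 0" "?a 1 = 1" unfolding a h[of 1] v[of 1] by simp_all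
  \<comment> \<open>The facts for degree 1 are restated with \<open>Suc 0\<close>, the form into
    which simplification brings this argument.\<close>
  have 2: "?h 2 = 1" "?v 2 = 1"
    unfolding h[of 2] v[of 2] sum_from_1 by (simp_all add: 1[unfolded One_nat_def])
  then have 2: "?h 2 = 1" "?v 2 = 1" "?a 2 = 2" unfolding a by simp_all
  have 3: "?h 3 = 3" "?v 3 = 3"
    unfolding h[of 3] v[of 3] sum_from_1 by (simp_all add: 1[unfolded One_nat_def] 2)
  then have 3: "?h 3 = 3" "?v 3 = 3" "?a 3 = 6" unfolding a by simp_all
  have 4: "?h 4 = 11" "?v 4 = 11"
    unfolding h[of 4] v[of 4] sum_from_1 by (simp_all add: 1[unfolded One_nat_def] 2 3)
  then have 4: "?h 4 = 11" "?v 4 = 11" "?a 4 = 22" unfolding a by simp_all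
  have 5: "?h 5 = 45" "?v 5 = 45"
    unfolding h[of 5] v[of 5] sum_from_1 by (simp_all add: 1[unfolded One_nat_def] 2 3 4)
  then have 5: "?h 5 = 45" "?v 5 = 45" "?a 5 = 90" unfolding a by simp_all
  have 6: "?h 6 = 197" "?v 6 = 197"
    unfolding h[of 6] v[of 6] sum_from_1 by (simp_all add: 1[unfolded One_nat_def] 2 3 4 5)
  then have 6: "?h 6 = 197" "?v 6 = 197" "?a 6 = 394" unfolding a by simp_all
  have 7: "?h 7 = 903" "?v 7 = 903"
    unfolding h[of 7] v[of 7] sum_from_1 by (simp_all add: 1[unfolded One_nat_def] 2 3 4 5 6)
  then have 7: "?h 7 = 903" "?v 7 = 903" "?a 7 = 1806" unfolding a by simp_all
  have 8: "?h 8 = 4279" "?v 8 = 4279"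
    unfolding h[of 8] v[of 8] sum_from_1 by (simp_all add: 1[unfolded One_nat_def] 2 3 4 5 6 7)
  then have 8: "?h 8 = 4279" "?v 8 = 4279" "?a 8 = 8558" unfolding a by simp_all
  have 9: "?h 9 = 20793" "?v 9 = 20793"
    unfolding h[of 9] v[of 9] sum_from_1 by (simp_all add: 1[unfolded One_nat_def] 2 3 4 5 6 7 8)
  then have 9: "?h 9 = 20793" "?v 9 = 20793" "?a 9 = 41586" unfolding a by simp_all
  have "assoc_types 9 = {t. right_normal t \<and> mdegree t = 9}" by (auto simp: assoc_types_def)
  then show ?thesis using 9(3) by (simp add: degree_count_def)
qed

text \<open>The totals agree with those of all types up to degree 3. In degree 4 the two sides of
  the interchange law drop out, which gives 20 instead of 22.\<close>

lemma card_isolated_9: "card {t \<in> assoc_types 9. neighbours t = []} = 14058"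
proof -
  let ?h = "degree_count (hrooted isolated)" and ?v = "degree_count (vrooted isolated)"
  let ?a = "degree_count isolated"
  note h = count_isolated(1) and v = count_isolated(2)
  have a: "?a n = (if n = 1 then 1 else 0) + (?h n + ?v n)" for n
    by (rule degree_count_rooted) (simp add: isolated_def)
  have 1: "?h 1 = 0" "?v 1 = 0" "?a 1 = 1" unfolding a h[of 1] v[of 1] by (simp_all add: count_hvar count_vvar)
  have 2: "?h 2 = 1" "?v 2 = 1"
    unfolding h[of 2] v[of 2] sum_from_1 by (simp_all add: count_hvar count_vvar 1[unfolded One_nat_def])
  then have 2: "?h 2 = 1" "?v 2 = 1" "?a 2 = 2" unfolding a by simp_all
  have 3: "?h 3 = 3" "?v 3 = 3"
    unfolding h[of 3] v[of 3] sum_from_1 by (simp_all add: count_hvar count_vvar 1[unfolded One_nat_def] 2)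
  then have 3: "?h 3 = 3" "?v 3 = 3" "?a 3 = 6" unfolding a by simp_all
  have 4: "?h 4 = 10" "?v 4 = 10"
    unfolding h[of 4] v[of 4] sum_from_1 by (simp_all add: count_hvar count_vvar 1[unfolded One_nat_def] 2 3)
  then have 4: "?h 4 = 10" "?v 4 = 10" "?a 4 = 20" unfolding a by simp_all
  have 5: "?h 5 = 35" "?v 5 = 35"
    unfolding h[of 5] v[of 5] sum_from_1 by (simp_all add: count_hvar count_vvar 1[unfolded One_nat_def] 2 3 4)
  then have 5: "?h 5 = 35" "?v 5 = 35" "?a 5 = 70" unfolding a by simp_all
  have 6: "?h 6 = 127" "?v 6 = 127"
    unfolding h[of 6] v[of 6] sum_from_1 by (simp_all add: count_hvar count_vvar 1[unfolded One_nat_def] 2 3 4 5)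
  then have 6: "?h 6 = 127" "?v 6 = 127" "?a 6 = 254" unfolding a by simp_all
  have 7: "?h 7 = 474" "?v 7 = 474"
    unfolding h[of 7] v[of 7] sum_from_1 by (simp_all add: count_hvar count_vvar 1[unfolded One_nat_def] 2 3 4 5 6)
  then have 7: "?h 7 = 474" "?v 7 = 474" "?a 7 = 948" unfolding a by simp_all
  have 8: "?h 8 = 1809" "?v 8 = 1809"
    unfolding h[of 8] v[of 8] sum_from_1 by (simp_all add: count_hvar count_vvar 1[unfolded One_nat_def] 2 3 4 5 6 7)
  then have 8: "?h 8 = 1809" "?v 8 = 1809" "?a 8 = 3618" unfolding a by simp_all
  have 9: "?h 9 = 7029" "?v 9 = 7029"
    unfolding h[of 9] v[of 9] sum_from_1 by (simp_all add: count_hvar count_vvar 1[unfolded One_nat_def] 2 3 4 5 6 7 8)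
  then have 9: "?h 9 = 7029" "?v 9 = 7029" "?a 9 = 14058" unfolding a by simp_all
  have "{t \<in> assoc_types 9. neighbours t = []} = {t. isolated t \<and> mdegree t = 9}"
    by (auto simp: assoc_types_def isolated_def)
  then show ?thesis using 9(3) by (simp add: degree_count_def)
qed

lemma finite_assoc_types: "finite (assoc_types n)"
  using finite_degree[of n] by (auto simp: assoc_types_def)

lemma card_not_isolated_9: "card {t \<in> assoc_types 9. neighbours t \<noteq> []} = 27528"
proof -
  have "{t \<in> assoc_types 9. neighbours t \<noteq> []} = assoc_types 9 - {t \<in> assoc_types 9. neighbours t = []}"
    by auto
  then show ?thesis
    using card_assoc_types_9 card_isolated_9 by (simp add: card_Diff_subset finite_assoc_types)
qed

section \<open>Walks and their labels\<close>

lemma label_simp [simp]: "label (t, \<sigma>, t') = \<sigma>"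
  by (simp add: label_def)

lemma label_product_simps [simp]:
  "label_product [] = id"
  "label_product (e # p) = label e \<circ> label_product p"
  by (simp_all add: label_product_def)

lemma label_product_append: "label_product (p @ q) = label_product p \<circ> label_product q"
  by (induct p) (auto simp: comp_assoc)

lemma label_permutes: "e \<in> arcs (G_graph n) \<Longrightarrow> label e permutes {..<n}"
  by (cases e) (simp add: arc_G_graph_iff)

lemma label_product_permutes:
  "set p \<subseteq> arcs (G_graph n) \<Longrightarrow> label_product p permutes {..<n}"
  by (induct p) (auto intro: permutes_compose label_permutes permutes_id simp del: id_apply)

lemma length_word_multilinear: "m \<in> multilinear n \<Longrightarrow> length (word m) = n"
  using multilinear_mdegree by (simp add: mdegree_def)

text \<open>The arc comes from some edge of F(n); renaming the indeterminates moves this edge over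
  the prescribed monomial \<open>m\<close>.\<close>

lemma arc_lift:
  assumes "(t, \<sigma>, t') \<in> arcs (G_graph n)" "m \<in> multilinear n" "type_of m = t"
  shows "\<exists>m' \<in> set (neighbours m). type_of m' = t' \<and> word m' = permute_list \<sigma> (word m)"
proof -
  obtain u u' where u: "\<sigma> permutes {..<n}" "u \<in> multilinear n" "u' \<in> set (neighbours u)"
    "type_of u = t" "type_of u' = t'" "word u' = permute_list \<sigma> (word u)"
    using assms(1) by (auto simp: arc_G_graph_iff)
  obtain \<rho> where \<rho>: "m = map_monomial \<rho> u"
    using multilinear_rename[OF u(2) assms(2)] u(4) assms(3) by auto
  have "map_monomial \<rho> u' \<in> set (neighbours m)" using u(3) by (simp add: \<rho> map_monomial_neighbours)
  moreover have "word (map_monomial \<rho> u') = permute_list \<sigma> (word m)"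
    using u(1,6) length_word_multilinear[OF u(2)] by (simp add: \<rho> word_map_monomial permute_list_map)
  ultimately show ?thesis using u(5) by (metis type_of_map_monomial)
qed

text \<open>\<open>permute_list\<close> reverses composition, so the label of the first arc acts
  first.\<close>

lemma permute_list_label_product:
  assumes "e \<in> arcs (G_graph n)" "set p \<subseteq> arcs (G_graph n)" "length xs = n"
  shows "permute_list (label_product (e # p)) xs = permute_list (label_product p) (permute_list (label e) xs)"
  using label_product_permutes[OF assms(2)] assms(3) by (simp add: permute_list_compose)

lemma walk_lift:
  assumes "pre_digraph.awalk (G_graph n) t p t'" "m \<in> multilinear n" "type_of m = t"
  shows "\<exists>m'. (m, m') \<in> monomial_rel\<^sup>* \<and> type_of m' = t' \<and>
    word m' = permute_list (label_product p) (word m)"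
proof -
  interpret wf_digraph "G_graph n" by (rule wf_digraph_G_graph)
  show ?thesis
    using assms
  proof (induct p arbitrary: t m)
    case Nil
    then show ?case by (auto simp: awalk_Nil_iff)
  next
    case (Cons e p)
    then have e: "e \<in> arcs (G_graph n)" "fst e = t" "awalk (snd (snd e)) p t'"
      by (auto simp: awalk_Cons_iff)
    obtain u where u: "u \<in> set (neighbours m)" "type_of u = snd (snd e)"
      "word u = permute_list (label e) (word m)"
      using arc_lift[of t "label e" "snd (snd e)" n m] e Cons.prems by (cases e) auto
    have "u \<in> multilinear n" using u(1) Cons.prems(2) multilinear_neighbours by blast
    then obtain m' where m': "(u, m') \<in> monomial_rel\<^sup>*" "type_of m' = t'"
      "word m' = permute_list (label_product p) (word u)"
      using Cons.hyps[OF e(3)] u(2) by blast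
    have "word m' = permute_list (label_product (e # p)) (word m)"
      unfolding m'(3) u(3)
      by (rule permute_list_label_product[symmetric, OF e(1)])
        (use e(3) length_word_multilinear Cons.prems(2) in \<open>auto simp: awalk_def\<close>)
    moreover have "(m, m') \<in> monomial_rel\<^sup>*"
      using u(1) m'(1) by (auto intro: converse_rtrancl_into_rtrancl)
    ultimately show ?case using m'(2) by blast
  qed
qed

lemma ex_walk:
  assumes "(m, m') \<in> monomial_rel\<^sup>*" "m \<in> multilinear n"
  shows "\<exists>p. pre_digraph.awalk (G_graph n) (type_of m) p (type_of m') \<and>
    word m' = permute_list (label_product p) (word m)"
proof -
  interpret wf_digraph "G_graph n" by (rule wf_digraph_G_graph)
  show ?thesis
    using assms
  proof (induct rule: converse_rtrancl_induct)
    case base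
    then show ?case using type_of_multilinear[of m'] by (intro exI[of _ "[]"]) (simp add: awalk_Nil_iff)
  next
    case (step m u)
    then have u: "u \<in> multilinear n" using multilinear_neighbours by blast
    then obtain p where p: "awalk (type_of u) p (type_of m')"
      "word m' = permute_list (label_product p) (word u)"
      using step by blast
    obtain \<sigma> where s: "(type_of m, \<sigma>, type_of u) \<in> arcs (G_graph n)" "word u = permute_list \<sigma> (word m)"
      using ex_arc_G_graph[OF step(4)] step(1) by blast
    have "awalk (type_of m) ((type_of m, \<sigma>, type_of u) # p) (type_of m')"
      using p(1) s(1) by (simp add: awalk_Cons_iff)
    moreover have "word m' = permute_list (label_product ((type_of m, \<sigma>, type_of u) # p)) (word m)"
      unfolding p(2) s(2)
      using permute_list_label_product[OF s(1), of p "word m"] p(1) length_word_multilinear[OF step(4)]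
      by (auto simp: awalk_def)
    ultimately show ?case by blast
  qed
qed

text \<open>Permutations act freely on words without repetition. Through this fact multilinearity
  makes trivial label products the same as closed lifts.\<close>

lemma permute_list_eq_id:
  assumes "permute_list \<sigma> xs = xs" "\<sigma> permutes {..<length xs}" "distinct xs"
  shows "\<sigma> = id"
proof
  fix i
  show "\<sigma> i = id i"
  proof (cases "i < length xs")
    case True
    then have "\<sigma> i < length xs" using permutes_in_image[OF assms(2)] by auto
    moreover have "xs ! \<sigma> i = xs ! i" using permute_list_nth[OF assms(2) True] assms(1) by simp
    ultimately show ?thesis using nth_eq_iff_index_eq[OF assms(3)] True by simp
  next
    case False
    then show ?thesis using permutes_not_in[OF assms(2)] by simp
  qed
qed

lemma permute_list_inj:
  assumes "permute_list \<sigma> xs = permute_list \<sigma> ys" "\<sigma> permutes {..<n}" "length xs = n" "length ys = n"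
  shows "xs = ys"
proof -
  have "permute_list (inv_into UNIV \<sigma>) (permute_list \<sigma> zs) = zs" if "length zs = n" for zs :: "'a list"
    using that assms(2) permutes_inv[OF assms(2)]
    by (simp add: permute_list_compose[symmetric] permutes_inv_o)
  then show ?thesis using assms by metis
qed

lemma reverse_arc_simps [simp]:
  "fst (reverse_arc e) = snd (snd e)"
  "snd (snd (reverse_arc e)) = fst e"
  "label (reverse_arc e) = inv_into UNIV (label e)"
  by (simp_all add: reverse_arc_def label_def case_prod_beta)

lemma reverse_arc_arcs:
  assumes "e \<in> arcs (G_graph n)" shows "reverse_arc e \<in> arcs (G_graph n)"
proof -
  obtain t \<sigma> t' where e: "e = (t, \<sigma>, t')" by (cases e)
  then obtain m m' where m: "\<sigma> permutes {..<n}" "m \<in> multilinear n" "m' \<in> set (neighbours m)"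
    "type_of m = t" "type_of m' = t'" "word m' = permute_list \<sigma> (word m)"
    using assms by (auto simp: arc_G_graph_iff)
  have "word m = permute_list (inv_into UNIV \<sigma>) (word m')"
    using m(1,6) length_word_multilinear[OF m(2)] permutes_inv[OF m(1)]
    by (simp add: permute_list_compose[symmetric] permutes_inv_o)
  moreover have "m \<in> set (neighbours m')"
    using m(2,3) neighbours_sym by (auto simp: multilinear_def)
  ultimately show ?thesis
    unfolding e reverse_arc_def prod.case arc_G_graph_iff
    using m permutes_inv[OF m(1)] multilinear_neighbours[OF m(2,3)] by blast
qed

lemma reverse_arc_reverse_arc:
  assumes "e \<in> arcs (G_graph n)" shows "reverse_arc (reverse_arc e) = e"
  using label_permutes[OF assms] permutes_inv_inv
  by (cases e) (auto simp: reverse_arc_def)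

lemma reverse_walk_simps:
  "reverse_walk [] = []" "reverse_walk (e # p) = reverse_walk p @ [reverse_arc e]"
  by (simp_all add: reverse_walk_def)

lemma awalk_reverse_walk:
  assumes "pre_digraph.awalk (G_graph n) t p t'"
  shows "pre_digraph.awalk (G_graph n) t' (reverse_walk p) t"
proof -
  interpret wf_digraph "G_graph n" by (rule wf_digraph_G_graph)
  show ?thesis
    using assms
  proof (induct p arbitrary: t)
    case Nil
    then show ?case by (auto simp: reverse_walk_simps awalk_Nil_iff)
  next
    case (Cons e p)
    then have "e \<in> arcs (G_graph n)" "fst e = t" "awalk (snd (snd e)) p t'"
      by (auto simp: awalk_Cons_iff)
    then show ?case
      using Cons.hyps[of "snd (snd e)"] reverse_arc_arcs[of e n] wellformed(1)[of e]
      by (auto simp: reverse_walk_simps awalk_simps)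
  qed
qed

lemma label_product_reverse_walk:
  assumes "set p \<subseteq> arcs (G_graph n)"
  shows "label_product p \<circ> label_product (reverse_walk p) = id"
  using assms
proof (induct p)
  case (Cons e p)
  have eq: "label_product (e # p) \<circ> label_product (reverse_walk (e # p)) =
      label e \<circ> (label_product p \<circ> label_product (reverse_walk p)) \<circ> inv_into UNIV (label e)"
    by (simp add: reverse_walk_simps label_product_append comp_assoc)
  have "label_product p \<circ> label_product (reverse_walk p) = id"
    by (rule Cons.hyps) (use Cons.prems in simp)
  then show ?case
    unfolding eq using Cons.prems permutes_inv_o(1)[OF label_permutes[of e n]] by simp
qed (simp add: reverse_walk_simps)

lemma edge_eq_iff:
  assumes "e \<in> arcs (G_graph n)" "edge e = edge f" shows "f = e \<or> f = reverse_arc e"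
  using assms by (auto simp: edge_def doubleton_eq_iff)

lemma edge_reverse_arc:
  assumes "e \<in> arcs (G_graph n)" shows "edge (reverse_arc e) = edge e"
  using reverse_arc_reverse_arc[OF assms] by (auto simp: edge_def)

section \<open>Simple cycles in a component\<close>

lemma not_distinct_map_decomp:
  "\<not> distinct (map f p) \<Longrightarrow> \<exists>q a r b s. p = q @ [a] @ r @ [b] @ s \<and> f a = f b"
proof (induct p)
  case (Cons x p)
  show ?case
  proof (cases "f x \<in> f ` set p")
    case True
    then obtain b where "b \<in> set p" "f x = f b" by blast
    moreover then obtain r s where "p = r @ b # s" by (meson split_list)
    ultimately have "x # p = [] @ [x] @ r @ [b] @ s \<and> f x = f b" by simp
    then show ?thesis by blast
  next
    case False
    then obtain q a r b s where "p = q @ [a] @ r @ [b] @ s" "f a = f b"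
      using Cons by auto
    then have "x # p = (x # q) @ [a] @ r @ [b] @ s \<and> f a = f b" by simp
    then show ?thesis by blast
  qed
qed simp

locale component_class =
  fixes n :: nat and t0 :: assoc_type
  assumes t0: "t0 \<in> assoc_types n"
begin

definition C :: "assoc_type set" where "C = connected_class t0"

definition H :: "(assoc_type, G_arc) pre_digraph" where "H = G_graph n \<restriction> C"

sublocale G: wf_digraph "G_graph n"
  by (rule wf_digraph_G_graph)

lemma C_subset: "C \<subseteq> assoc_types n"
  unfolding C_def by (rule connected_class_subset[OF t0])

sublocale wf_digraph H
  unfolding H_def by (rule G.wellformed_induce_subgraph)

lemma H_simps [simp]:
  "verts H = C" "tail H e = fst e" "head H e = snd (snd e)"
  "e \<in> arcs H \<longleftrightarrow> e \<in> arcs (G_graph n) \<and> fst e \<in> C \<and> snd (snd e) \<in> C"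
  by (simp_all add: H_def)

lemma awalk_H: "awalk t p t' \<Longrightarrow> G.awalk t p t'"
proof -
  have "subgraph H (G_graph n)"
    unfolding H_def using C_subset by (intro G.subgraph_induce_subgraphI) simp
  then show "awalk t p t' \<Longrightarrow> G.awalk t p t'" using G.subgraph_awalk_imp_awalk by blast
qed

lemma C_closed: "e \<in> arcs (G_graph n) \<Longrightarrow> fst e \<in> C \<Longrightarrow> snd (snd e) \<in> C"
proof -
  assume e: "e \<in> arcs (G_graph n)" "fst e \<in> C"
  have "(fst e, snd (snd e)) \<in> arcs_ends (G_graph n)"
    using e(1) by (force simp: arcs_ends_conv)
  then show "snd (snd e) \<in> C"
    using e(2) by (auto simp: arcs_ends_G_graph C_def in_connected_class intro: rtrancl.rtrancl_into_rtrancl)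
qed

lemma awalk_HI: "G.awalk t p t' \<Longrightarrow> t \<in> C \<Longrightarrow> awalk t p t'"
proof (induct p arbitrary: t)
  case Nil
  then show ?case by (simp add: awalk_Nil_iff G.awalk_Nil_iff)
next
  case (Cons e p)
  then show ?case using C_closed[of e] by (simp add: awalk_Cons_iff G.awalk_Cons_iff)
qed

lemma ex_awalk: "t \<in> C \<Longrightarrow> \<exists>p. G.awalk t0 p t"
  using t0 G.reachable_awalk[of t0 t] reachable_G_graph_iff[where t = t0 and u = t and n = n] by (simp add: C_def in_connected_class)

lemma reverse_arc_H: "e \<in> arcs H \<Longrightarrow> reverse_arc e \<in> arcs H"
  using reverse_arc_arcs by simp

text \<open>A second use of the first edge, in either direction, would put its tail \<open>t\<close>
  on the rest of the path, which a simple path does not revisit.\<close>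

lemma apath_distinct_edges: "apath t p t' \<Longrightarrow> distinct (map edge p)"
proof (induct p arbitrary: t)
  case (Cons e p)
  then have e: "e \<in> arcs H" "fst e = t" and p: "apath (snd (snd e)) p t'"
    "t \<notin> set (awalk_verts (snd (snd e)) p)"
    by (auto simp: apath_Cons_iff)
  have "edge e \<noteq> edge f" if "f \<in> set p" for f
  proof
    assume "edge e = edge f"
    then have "f = e \<or> f = reverse_arc e" using edge_eq_iff[of e n f] e(1) by simp
    then have "fst f = t \<or> snd (snd f) = t" using e(2) by auto
    moreover have "fst f \<in> set (awalk_verts (snd (snd e)) p)" "snd (snd f) \<in> set (awalk_verts (snd (snd e)) p)"
      using that awalk_verts_arc1[of f p "snd (snd e)"] awalk_verts_arc2[of "snd (snd e)" p t' f]  p(1)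
      by (auto simp: apath_def)
    ultimately show False using p(2) by auto
  qed
  then show ?case using Cons.hyps[OF p(1)] by auto
qed simp

text \<open>
  A closed walk that visits a vertex twice, or uses an edge twice, splits into two shorter
  closed walks; one of them is again nontrivial.
\<close>

lemma nontrivial_walk_imp_cycle:
  assumes "awalk t p t" "label_product p \<noteq> id"
  shows "\<exists>q. cycle q \<and> distinct (map edge q) \<and> label_product q \<noteq> id"
  using assms
proof (induct "length p" arbitrary: t p rule: less_induct)
  case less
  have arcs: "set p \<subseteq> arcs H" using less.prems(1) by auto
  have ne: "p \<noteq> []" using less.prems(2) by auto
  then obtain e p' where p: "p = e # p'" by (cases p) auto
  have e: "e \<in> arcs H" "fst e = t" "awalk (snd (snd e)) p' t"
    using less.prems(1) by (auto simp: p awalk_Cons_iff)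
  consider (verts) "\<not> distinct (tl (awalk_verts t p))" | (edges) "\<not> distinct (map edge p)"
    | (cycle) "distinct (tl (awalk_verts t p))" "distinct (map edge p)" by blast
  then show ?case
  proof cases
    case verts
    then have "\<not> distinct (awalk_verts (snd (snd e)) p')" by (simp add: p)
    then obtain q r s w where d: "p' = q @ r @ s" "0 < length r" "awalk (snd (snd e)) q w"
      "awalk w r w" "awalk w s t"
      using awalk_not_distinct_decomp[OF e(3)] by blast
    show ?thesis
    \<comment> \<open>A trivial inner loop can be cut out without changing the product; a nontrivial
      one is itself the shorter closed walk.\<close>
    proof (cases "label_product r = id")
      case True
      have "awalk t (e # q @ s) t" using d e by (auto simp: awalk_simps)
      moreover have "label_product (e # q @ s) \<noteq> id"
        using less.prems(2) True by (simp add: p d(1) label_product_append)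
      moreover have "length (e # q @ s) < length p" using d(2) by (simp add: p d(1))
      ultimately show ?thesis using less.hyps by blast
    next
      case False
      have "length r < length p" by (simp add: p d(1))
      then show ?thesis using less.hyps[OF _ d(4) False] by blast
    qed
  next
    \<comment> \<open>Distinct vertices do not exclude this: an arc followed by its reverse is a
      cycle in the sense of \<open>cycle\<close>.\<close>
    case edges
    then obtain q f r f' s where d: "p = q @ [f] @ r @ [f'] @ s" "edge f = edge f'"
      using not_distinct_map_decomp by blast
    then have f: "f \<in> arcs H" "f' \<in> arcs H" using arcs by auto
    have w: "awalk t q (fst f)" "awalk (snd (snd f)) r (fst f')" "awalk (snd (snd f')) s t"
      using less.prems(1) unfolding d(1) by (auto simp: awalk_simps)
    have "f' = f \<or> f' = reverse_arc f" using edge_eq_iff[of f n f'] d(2) f by simp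
    then show ?thesis
    proof
      assume ff: "f' = f"
      have c: "awalk (fst f) ([f] @ r) (fst f)" using w f ff by (auto simp: awalk_simps)
      show ?thesis
      proof (cases "label_product ([f] @ r) = id")
        case True
        have "awalk t (q @ [f] @ s) t" using w f ff by (auto simp: awalk_simps)
        moreover have "label_product (q @ [f] @ s) \<noteq> id"
        proof -
          have "label_product p = label_product q \<circ> (label_product ([f] @ r) \<circ> label_product ([f] @ s))"
            by (simp add: d(1) ff label_product_append comp_assoc)
          then have "label_product p = label_product (q @ [f] @ s)"
            unfolding True by (simp only: label_product_append id_comp)
          then show ?thesis using less.prems(2) by metis
        qed
        moreover have "length (q @ [f] @ s) < length p" by (simp add: d(1))
        ultimately show ?thesis using less.hyps by blast
      next
        case False
        have "length ([f] @ r) < length p" by (simp add: d(1))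
        then show ?thesis using less.hyps[OF _ c False] by blast
      qed
    next
      assume ff: "f' = reverse_arc f"
      have c: "awalk (snd (snd f)) r (snd (snd f))" using w(2) ff by simp
      show ?thesis
      proof (cases "label_product r = id")
        case True
        have "awalk t (q @ s) t" using w ff by (auto simp: awalk_simps)
        moreover have "label_product (q @ s) \<noteq> id"
        proof -
          \<comment> \<open>Going along \<open>f\<close>, around a trivial loop and back along
            \<open>f\<close> contributes a conjugate of the identity.\<close>
          have "label_product p = label_product q \<circ> (label f \<circ> label_product r \<circ> inv_into UNIV (label f)) \<circ> label_product s"
            by (simp add: d(1) ff label_product_append comp_assoc)
          also have "label f \<circ> label_product r \<circ> inv_into UNIV (label f) = id"
            using True permutes_inv_o(1)[OF label_permutes[of f n]] f by simp
          finally have "label_product p = label_product (q @ s)"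
            by (simp only: label_product_append comp_id)
          then show ?thesis using less.prems(2) by metis
        qed
        moreover have "length (q @ s) < length p" by (simp add: d(1))
        ultimately show ?thesis using less.hyps by blast
      next
        case False
        have "length r < length p" by (simp add: d(1))
        then show ?thesis using less.hyps[OF _ c False] by blast
      qed
    qed
  next
    case cycle
    then show ?thesis using less.prems ne by (auto simp: cycle_def)
  qed
qed

end

section \<open>Components with two monomials over each association type\<close>

text \<open>The double cover, given by a condition on the single fibre over the type of
  \<open>m0\<close>; the other fibres follow by transport along walks
  (\<open>lifts_over_two\<close>). Stated for general \<open>m0\<close> and \<open>m1\<close>, it
  can be moved by the dihedral group to the other components of the orbit.\<close>

locale two_lifts =
  fixes n :: nat and m0 m1 :: "nat monomial"
  assumes m0: "m0 \<in> multilinear n"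
    and m1: "m1 \<noteq> m0" "type_of m1 = type_of m0" "(m0, m1) \<in> monomial_rel\<^sup>*"
    and lifts: "\<And>m. (m0, m) \<in> monomial_rel\<^sup>* \<Longrightarrow> type_of m = type_of m0 \<Longrightarrow> m = m0 \<or> m = m1"
begin

sublocale component_class n "type_of m0"
  by unfold_locales (rule type_of_multilinear[OF m0])

definition lifts_over :: "assoc_type \<Rightarrow> nat monomial set" where
  "lifts_over t = {m. (m0, m) \<in> monomial_rel\<^sup>* \<and> type_of m = t}"

lemma lifts_over_multilinear: "m \<in> lifts_over t \<Longrightarrow> m \<in> multilinear n"
  using multilinear_rtrancl m0 by (auto simp: lifts_over_def)

lemma lifts_over_nonempty: "t \<in> C \<Longrightarrow> lifts_over t \<noteq> {}"
  using lift_rtrancl[of m0 t] by (auto simp: C_def in_connected_class lifts_over_def)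

lemma lifts_over_walk:
  assumes "G.awalk t p t'" "m \<in> lifts_over t"
  shows "\<exists>m' \<in> lifts_over t'. word m' = permute_list (label_product p) (word m)"
proof -
  obtain m' where "(m, m') \<in> monomial_rel\<^sup>*" "type_of m' = t'"
    "word m' = permute_list (label_product p) (word m)"
    using walk_lift[OF assms(1) lifts_over_multilinear[OF assms(2)]] assms(2)
    by (auto simp: lifts_over_def)
  moreover have "(m0, m) \<in> monomial_rel\<^sup>*" using assms(2) by (simp add: lifts_over_def)
  ultimately show ?thesis unfolding lifts_over_def by (blast intro: rtrancl_trans)
qed

text \<open>Returning to the base type along a reversed walk embeds the fibre over \<open>t\<close>
  into the two monomials \<open>m0\<close> and \<open>m1\<close>, so three different lifts are
  impossible.\<close>

lemma lifts_over_two: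
  assumes "t \<in> C" "x \<in> lifts_over t" "y \<in> lifts_over t" "z \<in> lifts_over t" "x \<noteq> y" "x \<noteq> z"
  shows "y = z"
proof -
  obtain p where "G.awalk (type_of m0) p t" using ex_awalk[OF assms(1)] by blast
  then have r: "G.awalk t (reverse_walk p) (type_of m0)" by (rule awalk_reverse_walk)
  define \<sigma> where "\<sigma> = label_product (reverse_walk p)"
  have perm: "\<sigma> permutes {..<n}"
    unfolding \<sigma>_def using r by (intro label_product_permutes) auto
  have return: "\<exists>m'. (m' = m0 \<or> m' = m1) \<and> word m' = permute_list \<sigma> (word m)" if "m \<in> lifts_over t" for m
    using lifts_over_walk[OF r that] lifts by (auto simp: \<sigma>_def lifts_over_def)
  have inj: "u = v" if "u \<in> lifts_over t" "v \<in> lifts_over t"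
    "permute_list \<sigma> (word u) = permute_list \<sigma> (word v)" for u v
  proof (rule monomial_eqI)
    show "type_of u = type_of v" using that by (simp add: lifts_over_def)
    show "word u = word v"
      using permute_list_inj[OF that(3) perm] length_word_multilinear lifts_over_multilinear that by metis
  qed
  show ?thesis using return[of x] return[of y] return[of z] inj assms by metis
qed

text \<open>A nontrivial label product moves the word of \<open>m\<close>, and the fibre offers just
  one other monomial as the end of the lifted walk.\<close>

lemma label_product_closed:
  assumes "G.awalk t p t" "t \<in> C" "m \<in> lifts_over t" "m' \<in> lifts_over t" "m \<noteq> m'"
    "label_product p \<noteq> id"
  shows "word m' = permute_list (label_product p) (word m)"
proof -
  obtain x where x: "x \<in> lifts_over t" "word x = permute_list (label_product p) (word m)"
    using lifts_over_walk[OF assms(1,3)] by blast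
  have "x \<noteq> m"
  proof
    assume "x = m"
    have m: "m \<in> multilinear n" using assms(3) by (rule lifts_over_multilinear)
    then have "label_product p permutes {..<length (word m)}"
      using assms(1) length_word_multilinear label_product_permutes by (metis G.awalkE')
    then have "label_product p = id"
      using permute_list_eq_id[of "label_product p" "word m"] x \<open>x = m\<close> m by (simp add: multilinear_def)
    then show False using assms(6) by simp
  qed
  then have "x = m'" using lifts_over_two[OF assms(2,3) x(1) assms(4)] assms(5) by simp
  then show ?thesis using x(2) by simp
qed

lemma base_lifts: "m0 \<in> lifts_over (type_of m0)" "m1 \<in> lifts_over (type_of m0)"
  using m1 by (simp_all add: lifts_over_def)

lemma base_in_C: "type_of m0 \<in> C"
  by (simp add: C_def connected_class_refl)

text \<open>Going out along \<epsilon> and back conjugates the label product of \<gamma>, which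
  keeps it nontrivial. The closed walk at the base type therefore exchanges \<open>m0\<close> and
  \<open>m1\<close>, whichever path \<epsilon> is used.\<close>

lemma produces_propertyI:
  assumes "G.awalk (type_of m0) \<epsilon> v" "G.awalk v \<gamma> v" "label_product \<gamma> \<noteq> id"
  shows "produces_property n \<epsilon> \<gamma> m0 m1"
proof -
  let ?p = "\<epsilon> @ \<gamma> @ reverse_walk \<epsilon>"
  have arcs: "set \<epsilon> \<subseteq> arcs (G_graph n)" using assms(1) by auto
  have w: "G.awalk (type_of m0) ?p (type_of m0)"
    using assms(1,2) awalk_reverse_walk[OF assms(1)] by (auto simp: G.awalk_append_iff)
  have "label_product ?p \<noteq> id"
  proof
    assume "label_product ?p = id"
    then have *: "label_product \<epsilon> \<circ> label_product \<gamma> \<circ> label_product (reverse_walk \<epsilon>) = id"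
      by (simp add: label_product_append comp_assoc)
    have r: "label_product \<epsilon> \<circ> label_product (reverse_walk \<epsilon>) = id"
      by (rule label_product_reverse_walk[OF arcs])
    have bij: "bij (label_product \<epsilon>)" using label_product_permutes[OF arcs] permutes_bij by blast
    then have r': "label_product (reverse_walk \<epsilon>) = inv_into UNIV (label_product \<epsilon>)"
      using r by (metis bij_is_inj comp_assoc comp_id fun.map_id0 id_comp inv_o_cancel)
    have "label_product \<gamma> x = x" for x
    proof -
      have "(label_product \<epsilon> \<circ> label_product \<gamma> \<circ> label_product (reverse_walk \<epsilon>)) (label_product \<epsilon> x) =
          label_product \<epsilon> (label_product \<gamma> x)"
        using bij by (simp add: r' bij_is_inj)
      then have "label_product \<epsilon> (label_product \<gamma> x) = label_product \<epsilon> x" unfolding * by simp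
      then show ?thesis using bij by (simp add: bij_is_inj inj_eq)
    qed
    then show False using assms(3) by auto
  qed
  then have "word m1 = permute_list (label_product ?p) (word m0)"
    using label_product_closed[OF w base_in_C base_lifts] m1(1) by simp
  then show ?thesis
    unfolding produces_property_def
    using m0 m1(2) assms lifts_over_multilinear[OF base_lifts(2)] by auto
qed

text \<open>A path from \<open>m0\<close> to \<open>m1\<close> in F(n) projects to a closed walk in
  G(n), and this walk is nontrivial because the two words differ.\<close>

lemma ex_nontrivial_cycle:
  "\<exists>\<gamma>. cycle \<gamma> \<and> distinct (map edge \<gamma>) \<and> label_product \<gamma> \<noteq> id"
proof -
  obtain p where p: "G.awalk (type_of m0) p (type_of m0)" "word m1 = permute_list (label_product p) (word m0)"
    using ex_walk[OF m1(3) m0] m1(2) by auto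
  have "label_product p \<noteq> id"
    using p(2) m1 monomial_eqI[of m1 m0] by auto
  then show ?thesis using nontrivial_walk_imp_cycle awalk_HI[OF p(1) base_in_C] by blast
qed

lemma cycle_produces_property:
  assumes "cycle \<gamma>" "label_product \<gamma> \<noteq> id"
  shows "\<exists>\<epsilon>. produces_property n \<epsilon> \<gamma> m0 m1"
proof -
  obtain v where v: "awalk v \<gamma> v" using assms(1) by (auto simp: cycle_def)
  then have "v \<in> C" using awalk_hd_in_verts by fastforce
  then obtain \<epsilon> where "G.awalk (type_of m0) \<epsilon> v" using ex_awalk by blast
  then show ?thesis using produces_propertyI awalk_H[OF v] assms(2) by blast
qed

lemma ex_traverses_produces_property:
  "\<exists>\<epsilon> \<gamma> D. traverses H \<gamma> D \<and> produces_property n \<epsilon> \<gamma> m0 m1"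
  using ex_nontrivial_cycle cycle_produces_property unfolding traverses_def by metis

section \<open>The parity of closed walks\<close>

definition chosen_lift :: "assoc_type \<Rightarrow> nat monomial" where
  "chosen_lift t = (SOME m. m \<in> lifts_over t)"

lemma chosen_lift: "t \<in> C \<Longrightarrow> chosen_lift t \<in> lifts_over t"
  unfolding chosen_lift_def using lifts_over_nonempty by (meson ex_in_conv someI_ex)

text \<open>With the chosen lifts as base points of the fibres, this is the mod 2 cocycle of the
  double cover: it marks the arcs along which a chosen lift is carried to the other element of its
  fibre.\<close>

definition swaps :: "G_arc \<Rightarrow> bool" where
  "swaps e \<longleftrightarrow> word (chosen_lift (snd (snd e))) \<noteq> permute_list (label e) (word (chosen_lift (fst e)))"

lemma length_chosen_lift: "t \<in> C \<Longrightarrow> length (word (chosen_lift t)) = n"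
  by (rule length_word_multilinear[OF lifts_over_multilinear[OF chosen_lift]])

lemma swaps_reverse_arc:
  assumes "e \<in> arcs H" shows "swaps (reverse_arc e) = swaps e"
proof -
  have s: "label e permutes {..<n}" using assms label_permutes by simp
  have l: "length (word (chosen_lift (fst e))) = n" "length (word (chosen_lift (snd (snd e)))) = n"
    using assms length_chosen_lift by simp_all
  have inv: "permute_list (label e) (permute_list (inv_into UNIV (label e)) xs) = xs"
    "permute_list (inv_into UNIV (label e)) (permute_list (label e) xs) = xs" if "length xs = n" for xs :: "nat list"
    using that s permutes_inv[OF s] by (simp_all add: permute_list_compose[symmetric] permutes_inv_o)
  have "word (chosen_lift (fst e)) = permute_list (inv_into UNIV (label e)) (word (chosen_lift (snd (snd e)))) \<longleftrightarrow>
      word (chosen_lift (snd (snd e))) = permute_list (label e) (word (chosen_lift (fst e)))"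
    using inv(1)[OF l(2)] inv(2)[OF l(1)] by auto
  then show ?thesis unfolding swaps_def by simp
qed

text \<open>In two-element fibres, every swapping arc exchanges the chosen lift with the other one,
  and every other arc preserves the distinction.\<close>

lemma lift_parity:
  assumes "awalk t p t'" "x \<in> lifts_over t" "x' \<in> lifts_over t'"
    "word x' = permute_list (label_product p) (word x)"
  shows "x' = chosen_lift t' \<longleftrightarrow> (x = chosen_lift t) = even (length (filter swaps p))"
  using assms
proof (induct p arbitrary: t x)
  case Nil
  then have "x' = x" using monomial_eqI[of x' x] by (simp add: lifts_over_def awalk_Nil_iff)
  then show ?case using Nil by (simp add: awalk_Nil_iff)
next
  case (Cons e p)
  let ?u = "snd (snd e)"
  have e: "e \<in> arcs H" "fst e = t" "awalk ?u p t'" using Cons.prems(1) by (auto simp: awalk_Cons_iff)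
  have C: "t \<in> C" "?u \<in> C" using e by auto
  have G: "G.awalk t [e] ?u" using e C_subset by (auto simp: G.awalk_simps)
  have s: "label e permutes {..<n}" using e(1) label_permutes by simp
  obtain y where y: "y \<in> lifts_over ?u" "word y = permute_list (label e) (word x)"
    using lifts_over_walk[OF G Cons.prems(2)] by auto
  obtain z where z: "z \<in> lifts_over ?u" "word z = permute_list (label e) (word (chosen_lift t))"
    using lifts_over_walk[OF G chosen_lift[OF C(1)]] by auto
  have len: "length (word x) = n" "length (word (chosen_lift t)) = n"
    using length_word_multilinear lifts_over_multilinear Cons.prems(2) chosen_lift[OF C(1)] by blast+
  have eq: "u = v \<longleftrightarrow> word u = word v" if "u \<in> lifts_over a" "v \<in> lifts_over a" for u v a
    using that monomial_eqI[of u v] by (auto simp: lifts_over_def)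
  have "y = z \<longleftrightarrow> x = chosen_lift t"
    using permute_list_inj[OF _ s len] eq[OF y(1) z(1)] eq[OF Cons.prems(2) chosen_lift[OF C(1)]]
    unfolding y(2) z(2) by metis
  moreover have "swaps e \<longleftrightarrow> z \<noteq> chosen_lift ?u"
    using eq[OF z(1) chosen_lift[OF C(2)]] z(2) e(2) by (auto simp: swaps_def)
  ultimately have "y = chosen_lift ?u \<longleftrightarrow> (x = chosen_lift t) = (\<not> swaps e)"
    using lifts_over_two[OF C(2) z(1) y(1) chosen_lift[OF C(2)]] by metis
  moreover have "word x' = permute_list (label_product p) (word y)"
    unfolding y(2) Cons.prems(4)
    by (rule permute_list_label_product) (use e awalk_H[OF e(3)] len in \<open>auto simp: G.awalk_def\<close>)
  then have "x' = chosen_lift t' \<longleftrightarrow> (y = chosen_lift ?u) = even (length (filter swaps p))"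
    using Cons.hyps[OF e(3) y(1) Cons.prems(3)] by simp
  ultimately show ?case by auto
qed

lemma label_product_id_iff:
  assumes "awalk t p t" shows "label_product p = id \<longleftrightarrow> even (length (filter swaps p))"
proof -
  have t: "t \<in> C" using awalk_hd_in_verts[OF assms] by simp
  let ?m = "chosen_lift t"
  have m: "?m \<in> lifts_over t" by (rule chosen_lift[OF t])
  obtain x where x: "x \<in> lifts_over t" "word x = permute_list (label_product p) (word ?m)"
    using lifts_over_walk[OF awalk_H[OF assms] m] by blast
  have "x = ?m \<longleftrightarrow> even (length (filter swaps p))"
    using lift_parity[OF assms m x] by simp
  moreover have "label_product p = id \<longleftrightarrow> x = ?m"
  proof
    assume "label_product p = id"
    then show "x = ?m" using x m monomial_eqI[of x ?m] by (auto simp: lifts_over_def)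
  next
    assume "x = ?m"
    have mm: "?m \<in> multilinear n" by (rule lifts_over_multilinear[OF m])
    have "set p \<subseteq> arcs (G_graph n)" using awalk_H[OF assms] by auto
    then have "label_product p permutes {..<length (word ?m)}"
      using length_word_multilinear[OF mm] label_product_permutes by simp
    then show "label_product p = id"
      using permute_list_eq_id[of "label_product p" "word ?m"] x(2) \<open>x = ?m\<close> mm by (simp add: multilinear_def)
  qed
  ultimately show ?thesis by simp
qed

end

section \<open>Row canonical forms of cycle bases\<close>

text \<open>A predicate \<open>P\<close> on edges stands for a linear functional over F_2 on finite
  edge sets, and \<open>odd_on P D\<close> is its value at \<open>D\<close>.\<close>

definition odd_on :: "('b \<Rightarrow> bool) \<Rightarrow> 'b set \<Rightarrow> bool" where
  "odd_on P D \<longleftrightarrow> odd (card {E \<in> D. P E})"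

lemma odd_card_symmetric_difference:
  assumes "finite A" "finite B"
  shows "odd (card ((A - B) \<union> (B - A))) \<longleftrightarrow> odd (card A) \<noteq> odd (card B)"
proof -
  have "card A = card (A - B) + card (A \<inter> B)"
    using assms by (metis card_Int_Diff add.commute)
  moreover have "card B = card (B - A) + card (A \<inter> B)"
    using assms by (metis card_Int_Diff add.commute Int_commute)
  moreover have "card ((A - B) \<union> (B - A)) = card (A - B) + card (B - A)"
    using assms by (intro card_Un_disjoint) auto
  ultimately show ?thesis by auto
qed

text \<open>Functionals are additive, so one that vanishes on all members of a list vanishes on
  their sum. Finiteness is carried through the induction because additivity of the parity relies on
  it.\<close>

lemma odd_on_symmetric_difference:
  assumes "\<forall>D \<in> set Ds. finite D \<and> \<not> odd_on P D"
  shows "finite (symmetric_difference Ds) \<and> \<not> odd_on P (symmetric_difference Ds)"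
  using assms
proof (induct Ds)
  case Nil
  then show ?case by (simp add: symmetric_difference_def odd_on_def)
next
  case (Cons D Ds)
  let ?S = "symmetric_difference Ds"
  have eq: "symmetric_difference (D # Ds) = (D - ?S) \<union> (?S - D)" by (simp add: symmetric_difference_def)
  have f: "finite D" "finite ?S" using Cons by auto
  have "{E \<in> (D - ?S) \<union> (?S - D). P E} = ({E \<in> D. P E} - {E \<in> ?S. P E}) \<union> ({E \<in> ?S. P E} - {E \<in> D. P E})"
    by auto
  then have "odd_on P ((D - ?S) \<union> (?S - D)) \<longleftrightarrow> odd_on P D \<noteq> odd_on P ?S"
    unfolding odd_on_def using odd_card_symmetric_difference[of "{E \<in> D. P E}" "{E \<in> ?S. P E}"] f by simp
  then show ?case unfolding eq using Cons f by auto
qed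

lemma sum_bit:
  "finite J \<Longrightarrow> (\<Sum>j \<in> J. if Q j then 1 else (0 :: bit)) = (if odd (card {j \<in> J. Q j}) then 1 else 0)"
proof (induct rule: finite_induct)
  case (insert x J)
  have "{j \<in> insert x J. Q j} = (if Q x then insert x {j \<in> J. Q j} else {j \<in> J. Q j})" by auto
  then show ?case using insert by auto
qed simp

definition row_set :: "'b list \<Rightarrow> bit mat \<Rightarrow> nat \<Rightarrow> 'b set" where
  "row_set es M i = {es ! j | j. j < length es \<and> M $$ (i, j) = 1}"

definition indicator_vec :: "'b list \<Rightarrow> ('b \<Rightarrow> bool) \<Rightarrow> bit vec" where
  "indicator_vec es P = vec (length es) (\<lambda>j. if P (es ! j) then 1 else 0)"

text \<open>Multiplication by the indicator vector evaluates the functional \<open>P\<close> on all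
  rows at once; since \<open>es\<close> is distinct, counting columns is counting edges.\<close>

lemma mult_indicator_vec:
  assumes "M \<in> carrier_mat nr (length es)" "distinct es" "i < nr"
  shows "(M *\<^sub>v indicator_vec es P) $ i = (if odd_on P (row_set es M i) then 1 else 0)"
proof -
  let ?J = "{j \<in> {0..<length es}. M $$ (i, j) = 1 \<and> P (es ! j)}"
  note dims = carrier_matD[OF assms(1)]
  have "(M *\<^sub>v indicator_vec es P) $ i = row M i \<bullet> indicator_vec es P"
    using assms(3) dims by (intro index_mult_mat_vec) simp
  also have "\<dots> = (\<Sum>j \<in> {0..<dim_vec (indicator_vec es P)}. row M i $ j * indicator_vec es P $ j)"
    by (simp only: scalar_prod_def)
  also have "\<dots> = (\<Sum>j \<in> {0..<length es}. M $$ (i, j) * (if P (es ! j) then 1 else 0))"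
    by (rule sum.cong) (use assms(3) dims in \<open>auto simp: indicator_vec_def\<close>)
  also have "\<dots> = (\<Sum>j \<in> {0..<length es}. if M $$ (i, j) = 1 \<and> P (es ! j) then 1 else 0)"
    by (rule sum.cong) auto
  also have "\<dots> = (if odd (card ?J) then 1 else 0)" by (rule sum_bit) simp
  also have "card ?J = card {E \<in> row_set es M i. P E}"
  proof (rule bij_betw_same_card[of "(!) es"])
    have "inj_on ((!) es) ?J" using assms(2) by (intro inj_on_nth) auto
    then show "bij_betw ((!) es) ?J {E \<in> row_set es M i. P E}"
      by (auto simp: bij_betw_def row_set_def)
  qed
  finally show ?thesis unfolding odd_on_def .
qed

lemma row_set_incidence_matrix:
  assumes "i < length cs" "cs ! i \<subseteq> set es" shows "row_set es (incidence_matrix es cs) i = cs ! i"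
proof -
  have "row_set es (incidence_matrix es cs) i = {es ! j | j. j < length es \<and> es ! j \<in> cs ! i}"
    using assms(1) by (auto simp: row_set_def incidence_matrix_def split: if_splits)
  also have "\<dots> = cs ! i" using assms(2) by (force simp: in_set_conv_nth)
  finally show ?thesis .
qed

locale cycle_matrix =
  fixes es :: "'b list" and cs :: "'b set list"
  assumes es: "distinct es" and cs: "\<And>D. D \<in> set cs \<Longrightarrow> D \<subseteq> set es"
begin

definition A :: "bit mat" where "A = incidence_matrix es cs"
definition B :: "bit mat" where "B = gauss_jordan_single A"

lemma A_carrier: "A \<in> carrier_mat (length cs) (length es)"
  by (simp add: A_def incidence_matrix_def)

lemmas gauss = gauss_jordan_single[OF A_carrier B_def[symmetric]]

lemma canonical_cycles_eq: "canonical_cycles es cs = row_set es B ` {..<length cs}"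
  by (auto simp: canonical_cycles_def row_set_def B_def A_def)

text \<open>Kernel vectors are the functionals that vanish on every row, and row reduction preserves
  the kernel. This takes the place of an equality of row spaces.\<close>

lemma odd_on_rows_iff:
  "(\<forall>D \<in> set cs. \<not> odd_on P D) \<longleftrightarrow> (\<forall>i < length cs. \<not> odd_on P (row_set es B i))"
proof -
  let ?x = "indicator_vec es P"
  have x: "?x \<in> carrier_vec (length es)" by (simp add: indicator_vec_def)
  have "M *\<^sub>v ?x = 0\<^sub>v (length cs) \<longleftrightarrow> (\<forall>i < length cs. \<not> odd_on P (row_set es M i))"
    if "M \<in> carrier_mat (length cs) (length es)" for M
  proof -
    have "M *\<^sub>v ?x = 0\<^sub>v (length cs) \<longleftrightarrow> (\<forall>i < length cs. (M *\<^sub>v ?x) $ i = 0)"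
      using that by (auto simp: vec_eq_iff)
    then show ?thesis using mult_indicator_vec[OF that es, of _ P] by auto
  qed
  from this[OF A_carrier] this[OF gauss(2)] gauss(1)[OF x]
  have "(\<forall>i < length cs. \<not> odd_on P (row_set es A i)) \<longleftrightarrow> (\<forall>i < length cs. \<not> odd_on P (row_set es B i))"
    by simp
  moreover have "row_set es A i = cs ! i" if "i < length cs" for i
    unfolding A_def using that cs by (intro row_set_incidence_matrix) auto
  ultimately show ?thesis by (auto simp: all_set_conv_all_nth)
qed

text \<open>
  For a column j without pivot there is a kernel vector of the row canonical form whose only
  other nonzero entries are in pivot columns. A subset D of a row meets no pivot column but the
  pivot of that row, so orthogonality of D to these vectors determines D.
\<close>

lemma row_minimal:
  assumes i: "i < length cs" and D: "D \<subseteq> row_set es B i" "D \<noteq> {}"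
    and span: "\<And>P. \<forall>D \<in> set cs. \<not> odd_on P D \<Longrightarrow> \<not> odd_on P D"
  shows "D = row_set es B i"
proof -
  let ?nr = "length cs" and ?nc = "length es" and ?R = "row_set es B"
  have dims: "dim_row B = ?nr" "dim_col B = ?nc" using gauss(2) by auto
  obtain f where "pivot_fun B f ?nc" using gauss(3) dims by (auto simp: row_echelon_form_def)
  note f = pivot_funD[OF dims(1) this]
  have in_R: "es ! j \<in> ?R k \<longleftrightarrow> B $$ (k, j) = 1" if "j < ?nc" for j k
    using that es by (auto simp: row_set_def nth_eq_iff_index_eq)
  \<comment> \<open>\<open>f k\<close> equals the number of columns if row \<open>k\<close> has no
    pivot; a row with an entry 1 has one.\<close>
  have pivot: "f k < ?nc" if "B $$ (k, j) = 1" "k < ?nr" "j < ?nc" for k j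
    using f(1)[OF that(2)] f(2)[OF that(2), of j] that by fastforce
  have pivot_in: "es ! f k \<in> ?R l \<longleftrightarrow> l = k" if "k < ?nr" "l < ?nr" "f k < ?nc" for k l
    using in_R[OF that(3)] f(4)[OF that(1,3)] f(5)[OF that(1,3,2)] by (cases "l = k") auto
  have key: "es ! j \<in> D \<longleftrightarrow> es ! f i \<in> D \<and> B $$ (i, j) = 1"
    if j: "j < ?nc" "\<forall>k < ?nr. f k \<noteq> j" for j
  proof -
    \<comment> \<open>The kernel vector of the free column \<open>j\<close>: it has a 1 at
      \<open>j\<close> and at the pivot of each row with a 1 in column \<open>j\<close>. Every row
      then meets it in two edges or in none.\<close>
    define P where "P E \<longleftrightarrow> E = es ! j \<or> (\<exists>k < ?nr. f k < ?nc \<and> E = es ! f k \<and> B $$ (k, j) = 1)" for E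
    have neq: "es ! j \<noteq> es ! f k" if "k < ?nr" "f k < ?nc" for k
      using that j es by (auto simp: nth_eq_iff_index_eq)
    have "{E \<in> ?R k. P E} = (if B $$ (k, j) = 1 then {es ! j, es ! f k} else {})" if k: "k < ?nr" for k
      using in_R[OF j(1), of k] pivot[OF _ k j(1)] pivot_in[OF _ k] k by (auto simp: P_def)
    then have "\<not> odd_on P (?R k)" if "k < ?nr" for k
      using that neq[OF that] pivot[OF _ that j(1)] by (simp add: odd_on_def)
    then have "\<not> odd_on P D" using odd_on_rows_iff span by blast
    moreover have "{E \<in> D. P E} = {E. E = es ! j \<and> E \<in> D} \<union> {E. E = es ! f i \<and> E \<in> D \<and> B $$ (i, j) = 1}"
    proof -
      have "E = es ! f i \<and> B $$ (i, j) = 1"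
        if "E \<in> D" "k < ?nr" "f k < ?nc" "E = es ! f k" "B $$ (k, j) = 1" for E k
        using that pivot_in[OF that(2) i that(3)] D(1) by auto
      moreover have "\<exists>k < ?nr. f k < ?nc \<and> E = es ! f k \<and> B $$ (k, j) = 1"
        if "E = es ! f i" "B $$ (i, j) = 1" for E
        using that pivot[OF that(2) i j(1)] i by blast
      ultimately show ?thesis unfolding P_def by blast
    qed
    moreover have "es ! j \<noteq> es ! f i" if "B $$ (i, j) = 1" using neq[OF i] pivot[OF that i j(1)] .
    ultimately show ?thesis
      by (cases "es ! j \<in> D"; cases "es ! f i \<in> D \<and> B $$ (i, j) = 1")
        (auto simp: odd_on_def Collect_conv_if Collect_conv_if2 insert_commute cong: conj_cong)
  qed
  have no_pivot: "es ! f k \<notin> D" if "k < ?nr" "f k < ?nc" "k \<noteq> i" for k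
    using pivot_in[OF that(1) i that(2)] that(3) D(1) by auto
  obtain E where "E \<in> D" using D(2) by blast
  then obtain j where j: "E = es ! j" "j < ?nc" "B $$ (i, j) = 1" using D(1) by (auto simp: row_set_def)
  have fi: "f i < ?nc" by (rule pivot[OF j(3) i j(2)])
  \<comment> \<open>Any edge of \<open>D\<close> forces the pivot edge of row \<open>i\<close> into
    \<open>D\<close>, and the pivot edge forces all the others.\<close>
  have "es ! f i \<in> D"
  proof (cases "\<exists>k < ?nr. f k = j")
    case True
    then show ?thesis using no_pivot j \<open>E \<in> D\<close> by blast
  next
    case False
    then show ?thesis using key[OF j(2)] j(1) \<open>E \<in> D\<close> by blast
  qed
  then have "es ! j \<in> D" if "j < ?nc" "B $$ (i, j) = 1" for j
    using key[OF that(1)] that(2) f(4,5) no_pivot i fi that(1)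
    by (metis pivot_in in_R)
  then show ?thesis using D(1) by (auto simp: row_set_def)
qed

end

lemma odd_on_map:
  "distinct (map g xs) \<Longrightarrow> odd_on P (g ` set xs) \<longleftrightarrow> odd (length (filter (P \<circ> g) xs))"
proof -
  assume "distinct (map g xs)"
  then have "length (filter P (map g xs)) = card ({x. P x} \<inter> set (map g xs))"
    by (rule distinct_length_filter)
  moreover have "{x. P x} \<inter> set (map g xs) = {E \<in> g ` set xs. P E}" by auto
  ultimately show ?thesis by (simp add: odd_on_def filter_map comp_def)
qed

section \<open>Nonempty rows of the canonical form are cycles\<close>

context component_class
begin

text \<open>Transfers a functional from arcs to edges; for a property invariant under reversal,
  either arc of the edge decides.\<close>

definition edge_prop :: "(G_arc \<Rightarrow> bool) \<Rightarrow> G_arc set \<Rightarrow> bool" where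
  "edge_prop Q E \<longleftrightarrow> (\<exists>e \<in> E. e \<in> arcs H \<and> Q e)"

lemma edge_prop_edge:
  assumes "\<And>e. e \<in> arcs H \<Longrightarrow> Q (reverse_arc e) = Q e" "e \<in> arcs H"
  shows "edge_prop Q (edge e) = Q e"
  using assms reverse_arc_H[of e] by (auto simp: edge_prop_def edge_def)

lemma odd_on_traverses:
  assumes "\<And>e. e \<in> arcs H \<Longrightarrow> Q (reverse_arc e) = Q e" "traverses H \<gamma> D"
  shows "odd_on (edge_prop Q) D \<longleftrightarrow> odd (length (filter Q \<gamma>))"
proof -
  have "set \<gamma> \<subseteq> arcs H" "distinct (map edge \<gamma>)" "D = edge ` set \<gamma>"
    using assms(2) by (auto simp: traverses_def cycle_def simp del: H_simps(4))
  moreover have "edge_prop Q (edge e) = Q e" if "e \<in> arcs H" for e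
    by (rule edge_prop_edge) (use assms(1) that in auto)
  ultimately have "filter (edge_prop Q \<circ> edge) \<gamma> = filter Q \<gamma>"
    by (intro filter_cong) (auto simp del: H_simps(4))
  note this \<open>distinct (map edge \<gamma>)\<close> \<open>D = edge ` set \<gamma>\<close>
  then show ?thesis using odd_on_map by metis
qed

text \<open>Each crossing of the cut between \<open>S\<close> and its complement changes the side,
  so a closed walk crosses it an even number of times.\<close>

lemma crossing_parity:
  "awalk t p t' \<Longrightarrow> odd (length (filter (\<lambda>e. (fst e \<in> S) \<noteq> (snd (snd e) \<in> S)) p)) \<longleftrightarrow> (t \<in> S) \<noteq> (t' \<in> S)"
proof (induct p arbitrary: t)
  case (Cons e p)
  then have "fst e = t" "awalk (snd (snd e)) p t'" by (auto simp: awalk_Cons_iff)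
  then show ?case using Cons.hyps by auto
qed (simp add: awalk_Nil_iff)

lemma cycles_subset: "D \<in> cycles H \<Longrightarrow> D \<subseteq> edges H"
  by (auto simp: cycles_def traverses_def cycle_def edges_def simp del: H_simps(4))

lemma cycles_nonempty: "D \<in> cycles H \<Longrightarrow> D \<noteq> {}"
  by (auto simp: cycles_def traverses_def cycle_def)

text \<open>
  If an edge of R does not lie on a cycle within R, then R crosses some cut in that edge only,
  whereas every cycle crosses every cut an even number of times.
\<close>

lemma contains_cycle:
  assumes R: "R \<subseteq> edges H" "R \<noteq> {}"
    and span: "\<And>P. \<forall>D \<in> cycles H. \<not> odd_on P D \<Longrightarrow> \<not> odd_on P R"
  shows "\<exists>D \<in> cycles H. D \<subseteq> R"
proof -
  obtain e where e: "e \<in> arcs H" "edge e \<in> R" using R unfolding edges_def by blast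
  \<comment> \<open>If the tail of \<open>e\<close> lies outside \<open>S\<close>, then
    \<open>e\<close> is the one edge of \<open>R\<close> across the cut of \<open>S\<close>; if it
    lies inside, then \<open>e\<close> closes a cycle within \<open>R\<close>.\<close>
  define S where "S = {w. \<exists>p. awalk (snd (snd e)) p w \<and> edge ` set p \<subseteq> R - {edge e}}"
  have head: "snd (snd e) \<in> S"
    unfolding S_def using e(1) by (intro CollectI exI[of _ "[]"]) (simp add: awalk_Nil_iff)
  let ?Q = "\<lambda>f :: G_arc. (fst f \<in> S) \<noteq> (snd (snd f) \<in> S)"
  have Q: "edge_prop ?Q (edge f) = ?Q f" if "f \<in> arcs H" for f
    by (rule edge_prop_edge[OF _ that]) auto
  have "fst e \<in> S"
  proof (rule ccontr)
    assume "fst e \<notin> S"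
    have step: "snd (snd f) \<in> S" if f: "f \<in> arcs H" "edge f \<in> R" "edge f \<noteq> edge e" "fst f \<in> S" for f
    proof -
      obtain p where p: "awalk (snd (snd e)) p (fst f)" "edge ` set p \<subseteq> R - {edge e}"
        using f(4) by (auto simp: S_def)
      have "awalk (snd (snd e)) (p @ [f]) (snd (snd f))"
        using p(1) f(1) by (simp add: awalk_simps)
      moreover have "edge ` set (p @ [f]) \<subseteq> R - {edge e}" using p(2) f(2,3) by simp
      ultimately show ?thesis unfolding S_def by blast
    qed
    have other: "\<not> edge_prop ?Q (edge f)" if f: "f \<in> arcs H" "edge f \<in> R" "edge f \<noteq> edge e" for f
    proof -
      have er: "edge (reverse_arc f) = edge f" using f(1) edge_reverse_arc[of f n] by simp
      have "snd (snd f) \<in> S \<longleftrightarrow> fst f \<in> S"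
        using step[OF f] step[of "reverse_arc f"] reverse_arc_H[OF f(1)] er f(2,3) by auto
      then show ?thesis using Q[OF f(1)] by simp
    qed
    have "E = edge e" if E: "E \<in> R" "edge_prop ?Q E" for E
    proof -
      obtain f where "f \<in> arcs H" "E = edge f" using E(1) R(1) unfolding edges_def by blast
      then show ?thesis using other E by blast
    qed
    moreover have "edge_prop ?Q (edge e)"
      using Q[OF e(1)] head \<open>fst e \<notin> S\<close> by simp
    ultimately have "{E \<in> R. edge_prop ?Q E} = {edge e}" using e(2) by blast
    then have "odd_on (edge_prop ?Q) R" by (simp add: odd_on_def)
    moreover have "\<not> odd_on (edge_prop ?Q) D" if D: "D \<in> cycles H" for D
    proof -
      obtain \<gamma> where g: "traverses H \<gamma> D" using D by (auto simp: cycles_def)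
      then obtain t where "awalk t \<gamma> t" by (auto simp: traverses_def cycle_def)
      then have "\<not> odd (length (filter ?Q \<gamma>))" using crossing_parity[of t \<gamma> t S] by simp
      moreover have "odd_on (edge_prop ?Q) D \<longleftrightarrow> odd (length (filter ?Q \<gamma>))"
        by (rule odd_on_traverses[OF _ g]) auto
      ultimately show ?thesis by simp
    qed
    ultimately show False using span by blast
  qed
  then obtain p where p: "awalk (snd (snd e)) p (fst e)" "edge ` set p \<subseteq> R - {edge e}"
    by (auto simp: S_def)
  \<comment> \<open>Shortening to a simple path removes repeated vertices and edges. No new edges
    come in, so \<open>e\<close> is still avoided.\<close>
  define q where "q = awalk_to_apath p"
  have q: "apath (snd (snd e)) q (fst e)" "set q \<subseteq> set p"
    unfolding q_def using apath_awalk_to_apath[OF p(1)] awalk_to_apath_subset[OF p(1)] by auto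
  have "awalk (fst e) (e # q) (fst e)" using q(1) e(1) by (auto simp: awalk_Cons_iff apath_def)
  then have "cycle (e # q)" using q(1) by (auto simp: cycle_def apath_def)
  moreover have "distinct (map edge (e # q))"
    using apath_distinct_edges[OF q(1)] q(2) p(2) by auto
  ultimately have "traverses H (e # q) (edge ` set (e # q))" by (simp add: traverses_def)
  then have "edge ` set (e # q) \<in> cycles H" unfolding cycles_def by blast
  moreover have "edge ` set (e # q) \<subseteq> R" using q(2) p(2) e(2) by auto
  ultimately show ?thesis by blast
qed

text \<open>Functionals that vanish on all cycles vanish on the row, so the row contains a cycle.
  This cycle is a combination of the basis, and by \<open>row_minimal\<close> it fills the row. The
  condition \<open>R \<noteq> {}\<close> excludes zero rows, whose edge sets are no cycles.\<close>

lemma canonical_row: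
  assumes basis: "is_cycle_basis H cs" and cols: "distinct es" "set es = edges H"
    and R: "R \<in> canonical_cycles es cs" "R \<noteq> {}"
  shows "R \<in> cycles H"
proof -
  have cs: "D \<subseteq> set es" if "D \<in> set cs" for D
    using that basis cycles_subset cols(2) by (auto simp: is_cycle_basis_def)
  interpret cycle_matrix es cs by unfold_locales (use cols cs in auto)
  obtain i where i: "i < length cs" "R = row_set es B i" using R(1) by (auto simp: canonical_cycles_eq)
  have "R \<subseteq> edges H" unfolding cols(2)[symmetric] i(2) by (auto simp: row_set_def)
  moreover have "\<not> odd_on P R" if "\<forall>D \<in> cycles H. \<not> odd_on P D" for P
  proof -
    have "\<forall>D \<in> set cs. \<not> odd_on P D" using that basis by (auto simp: is_cycle_basis_def)
    then show ?thesis using odd_on_rows_iff i by blast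
  qed
  ultimately obtain D where D: "D \<in> cycles H" "D \<subseteq> R" using contains_cycle R(2) by blast
  obtain Cs where Cs: "set Cs \<subseteq> set cs" "D = symmetric_difference Cs"
    using basis D(1) by (auto simp: is_cycle_basis_def)
  have "\<not> odd_on P D" if "\<forall>D \<in> set cs. \<not> odd_on P D" for P
    using odd_on_symmetric_difference[of Cs P] that Cs cs finite_subset[OF cs] by blast
  then have "D = R"
    unfolding i(2) using row_minimal[OF i(1) D(2)[unfolded i(2)] cycles_nonempty[OF D(1)]] by blast
  then show ?thesis using D(1) by simp
qed

text \<open>A functional that is odd on a cycle is odd on a member of the basis, hence does not
  vanish on all rows of the canonical form.\<close>

lemma ex_odd_canonical_row:
  assumes basis: "is_cycle_basis H cs" and cols: "distinct es" "set es = edges H"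
    and D: "D \<in> cycles H" "odd_on P D"
  shows "\<exists>R \<in> canonical_cycles es cs. odd_on P R"
proof -
  have cs: "D \<subseteq> set es" if "D \<in> set cs" for D
    using that basis cycles_subset cols(2) by (auto simp: is_cycle_basis_def)
  interpret cycle_matrix es cs by unfold_locales (use cols cs in auto)
  obtain Cs where Cs: "set Cs \<subseteq> set cs" "D = symmetric_difference Cs"
    using basis D(1) by (auto simp: is_cycle_basis_def)
  have "\<exists>C' \<in> set cs. odd_on P C'"
    using odd_on_symmetric_difference[of Cs P] D(2) Cs finite_subset[OF cs] by blast
  then show ?thesis using odd_on_rows_iff by (auto simp: canonical_cycles_eq)
qed

end

context two_lifts
begin

text \<open>\<open>traverses\<close> leaves the starting point and the direction open, but the
  parity depends on the edge set alone. So triviality does not depend on the traversal.\<close>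

lemma label_product_traverses:
  assumes "traverses H \<gamma> D" shows "label_product \<gamma> = id \<longleftrightarrow> \<not> odd_on (edge_prop swaps) D"
proof -
  obtain t where "awalk t \<gamma> t" using assms by (auto simp: traverses_def cycle_def)
  then show ?thesis
    using label_product_id_iff odd_on_traverses[where Q = swaps, OF _ assms] swaps_reverse_arc by blast
qed

lemma cycle_basis_property:
  assumes basis: "is_cycle_basis H cs" and es: "distinct es" "set es = edges H"
  shows "(\<exists>D \<in> canonical_cycles es cs. nontrivial H D) \<and>
    (\<forall>D \<in> canonical_cycles es cs. nontrivial H D \<longrightarrow>
      (\<exists>\<epsilon> \<gamma>. traverses H \<gamma> D \<and> produces_property n \<epsilon> \<gamma> m0 m1) \<and>
      (\<forall>\<epsilon> v \<gamma>. traverses H \<gamma> D \<and> G.awalk (type_of m0) \<epsilon> v \<and> G.awalk v \<gamma> v \<longrightarrow>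
        produces_property n \<epsilon> \<gamma> m0 m1))"
proof
  obtain \<gamma>0 where g0: "traverses H \<gamma>0 (edge ` set \<gamma>0)" "label_product \<gamma>0 \<noteq> id"
    using ex_nontrivial_cycle by (auto simp: traverses_def)
  then have "edge ` set \<gamma>0 \<in> cycles H" "odd_on (edge_prop swaps) (edge ` set \<gamma>0)"
    using label_product_traverses unfolding cycles_def by blast+
  then obtain R where R: "R \<in> canonical_cycles es cs" "odd_on (edge_prop swaps) R"
    using ex_odd_canonical_row[OF basis es] by blast
  then have "R \<noteq> {}" by (auto simp: odd_on_def)
  then obtain \<gamma> where "traverses H \<gamma> R"
    using canonical_row[OF basis es R(1)] unfolding cycles_def by blast
  then have "nontrivial H R" using label_product_traverses R(2) unfolding nontrivial_def by blast
  then show "\<exists>D \<in> canonical_cycles es cs. nontrivial H D" using R(1) by blast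
next
  show "\<forall>D \<in> canonical_cycles es cs. nontrivial H D \<longrightarrow>
      (\<exists>\<epsilon> \<gamma>. traverses H \<gamma> D \<and> produces_property n \<epsilon> \<gamma> m0 m1) \<and>
      (\<forall>\<epsilon> v \<gamma>. traverses H \<gamma> D \<and> G.awalk (type_of m0) \<epsilon> v \<and> G.awalk v \<gamma> v \<longrightarrow>
        produces_property n \<epsilon> \<gamma> m0 m1)"
  proof (intro ballI impI conjI allI)
    fix D assume "nontrivial H D"
    then obtain \<gamma> where g: "traverses H \<gamma> D" "label_product \<gamma> \<noteq> id" by (auto simp: nontrivial_def)
    then show "\<exists>\<epsilon> \<gamma>. traverses H \<gamma> D \<and> produces_property n \<epsilon> \<gamma> m0 m1"
      using cycle_produces_property[of \<gamma>] unfolding traverses_def by blast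
    fix \<epsilon> v \<gamma>' assume a: "traverses H \<gamma>' D \<and> G.awalk (type_of m0) \<epsilon> v \<and> G.awalk v \<gamma>' v"
    then have "label_product \<gamma>' \<noteq> id" using label_product_traverses g by blast
    then show "produces_property n \<epsilon> \<gamma>' m0 m1" using produces_propertyI a by blast
  qed
qed

end

section \<open>The components of G(9)\<close>

context
begin

private abbreviation (input) X :: assoc_type where "X \<equiv> Var ()"
private abbreviation (input) H :: "assoc_type \<Rightarrow> assoc_type \<Rightarrow> assoc_type" where "H \<equiv> HComp"
private abbreviation (input) V :: "assoc_type \<Rightarrow> assoc_type \<Rightarrow> assoc_type" where "V \<equiv> VComp"
private abbreviation (input) h :: assoc_type where "h \<equiv> H X X"
private abbreviation (input) v :: assoc_type where "v \<equiv> V X X"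

text \<open>Certificate data: the orbits in increasing order of their smallest vertices, spread over
  six lists. The entries are mere claims, verified by the evaluations \<open>check_orbits_1\<close>
  to \<open>check_orbits_6\<close> and \<open>ascending_orbits\<close>.\<close>

definition orbits_1 :: "(nat \<times> nat \<times> assoc_type) list" where
  "orbits_1 =
   [(4, 2, H X (H X (H X (H X (H X (H v v)))))), (4, 2, H X (H X (H X (H X (H v (H v X)))))),
    (8, 3, H X (H X (H X (H X (H v (V X h)))))), (4, 3, H X (H X (H X (H X (H v (V X v)))))),
    (4, 3, H X (H X (H X (H X (H (V X v) v))))), (8, 2, H X (H X (H X (H X (V X (H v v)))))),
    (4, 2, H X (H X (H X (H v (H v h))))), (4, 6, H X (H X (H X (H v (H v v))))),
    (8, 3, H X (H X (H X (H v (H (V X h) X))))), (4, 3, H X (H X (H X (H v (H (V X v) X))))),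
    (8, 4, H X (H X (H X (H v (V X (H X h)))))), (8, 6, H X (H X (H X (H v (V X (H X v)))))),
    (8, 3, H X (H X (H X (H v (V X (H v X)))))), (4, 4, H X (H X (H X (H v (V X (V X v)))))),
    (4, 3, H X (H X (H X (H v (V X (V h X)))))), (4, 3, H X (H X (H X (H (V X v) (H v X))))),
    (8, 6, H X (H X (H X (H (V X v) (V X h))))), (4, 6, H X (H X (H X (H (V X v) (V X v))))),
    (4, 4, H X (H X (H X (H (V X (V X v)) v)))), (4, 3, H X (H X (H X (H (V X (V h X)) v)))),
    (8, 2, H X (H X (H X (H (V X (H v v)) X)))), (8, 2, H X (H X (H X (V X (H X (H v v)))))),
    (8, 2, H X (H X (H X (V X (H v (H v X)))))), (8, 3, H X (H X (H X (V X (H v (V X h)))))),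
    (8, 3, H X (H X (H X (V X (H v (V X v)))))), (8, 3, H X (H X (H X (V X (H v (V h X)))))),
    (8, 3, H X (H X (H X (V X (H (V X v) v))))), (8, 2, H X (H X (H X (V X (V X (H v v)))))),
    (4, 2, H X (H X (H X (V X (V h (V h X)))))), (4, 2, H X (H X (H v (H X (H v v))))),
    (4, 2, H X (H X (H v (H v (H X v))))), (4, 6, H X (H X (H v (H v (H v X))))),
    (8, 10, H X (H X (H v (H v (V X h))))), (4, 13, H X (H X (H v (H v (V X v))))),
    (4, 3, H X (H X (H v (H (V X h) h)))), (4, 3, H X (H X (H v (H (V X v) h)))),
    (4, 11, H X (H X (H v (H (V X v) v)))), (8, 4, H X (H X (H v (H (V X (H X h)) X)))),
    (8, 6, H X (H X (H v (H (V X (H X v)) X)))), (8, 3, H X (H X (H v (H (V X (H v X)) X)))),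
    (4, 4, H X (H X (H v (H (V X (V X v)) X)))), (4, 3, H X (H X (H v (H (V X (V h X)) X)))),
    (8, 5, H X (H X (H v (V X (H X (H X h)))))), (8, 10, H X (H X (H v (V X (H X (H X v)))))),
    (8, 4, H X (H X (H v (V X (H X (H v X)))))), (8, 10, H X (H X (H v (V X (H X (V X v)))))),
    (8, 12, H X (H X (H v (V X (H X (V h X)))))), (8, 4, H X (H X (H v (V X (H v h))))),
    (8, 3, H X (H X (H v (V X (H (V X h) X))))), (8, 3, H X (H X (H v (V X (H (V X v) X))))),
    (8, 3, H X (H X (H v (V X (H (V h X) X))))), (4, 5, H X (H X (H v (V X (V X (V X v)))))),
    (8, 4, H X (H X (H v (V X (V X (V h X)))))), (4, 3, H X (H X (H v (V X (V (H X h) X))))),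
    (4, 3, H X (H X (H v (V X (V (H X v) X))))), (4, 3, H X (H X (H v (V X (V (H v X) X))))),
    (4, 13, H X (H X (H (V X v) (H v v)))), (8, 6, H X (H X (H (V X v) (H (V X h) X)))),
    (4, 6, H X (H X (H (V X v) (H (V X v) X)))), (8, 10, H X (H X (H (V X v) (V X (H X h))))),
    (8, 13, H X (H X (H (V X v) (V X (H X v))))), (8, 12, H X (H X (H (V X v) (V X (H v X))))),
    (4, 10, H X (H X (H (V X v) (V X (V X v))))), (4, 11, H X (H X (H (V X v) (V X (V h X))))),
    (4, 4, H X (H X (H (V X (V X v)) (H v X)))), (8, 10, H X (H X (H (V X (V X v)) (V X h)))),
    (4, 10, H X (H X (H (V X (V X v)) (V X v)))), (4, 3, H X (H X (H (V X (V h X)) (H v X)))),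
    (4, 2, H X (H X (H (V X (H v v)) h))), (4, 5, H X (H X (H (V X (V X (V X v))) v))),
    (8, 4, H X (H X (H (V X (V X (V h X))) v))), (4, 3, H X (H X (H (V X (V (H X h) X)) v))),
    (4, 3, H X (H X (H (V X (V (H X v) X)) v))), (4, 3, H X (H X (H (V X (V (H v X) X)) v))),
    (8, 2, H X (H X (H (V X (H X (H v v))) X))), (8, 2, H X (H X (H (V X (H v (H v X))) X))),
    (8, 3, H X (H X (H (V X (H v (V X h))) X))), (8, 3, H X (H X (H (V X (H v (V X v))) X))),
    (8, 3, H X (H X (H (V X (H v (V h X))) X))), (8, 3, H X (H X (H (V X (H (V X v) v)) X))),
    (8, 2, H X (H X (H (V X (V X (H v v))) X))), (4, 2, H X (H X (H (V X (V h (V h X))) X))),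
    (8, 2, H X (H X (V X (H X (H X (H v v)))))), (8, 2, H X (H X (V X (H X (H v (H v X)))))),
    (8, 3, H X (H X (V X (H X (H v (V X h)))))), (8, 3, H X (H X (V X (H X (H v (V X v)))))),
    (8, 3, H X (H X (V X (H X (H v (V h X)))))), (8, 3, H X (H X (V X (H X (H (V X v) v))))),
    (8, 2, H X (H X (V X (H X (V X (H v v)))))), (8, 2, H X (H X (V X (H X (V h (V h X)))))),
    (8, 2, H X (H X (V X (H v (H v h))))), (8, 6, H X (H X (V X (H v (H v v))))),
    (8, 3, H X (H X (V X (H v (H (V X h) X))))), (8, 3, H X (H X (V X (H v (H (V X v) X))))),
    (8, 3, H X (H X (V X (H v (H (V h X) X))))), (8, 4, H X (H X (V X (H v (V X (H X h)))))),
    (8, 6, H X (H X (V X (H v (V X (H X v)))))), (8, 3, H X (H X (V X (H v (V X (H v X)))))),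
    (8, 4, H X (H X (V X (H v (V X (V X v))))))]"

definition orbits_2 :: "(nat \<times> nat \<times> assoc_type) list" where
  "orbits_2 =
   [(8, 3, H X (H X (V X (H v (V X (V h X)))))), (8, 6, H X (H X (V X (H v (V h v))))),
    (8, 4, H X (H X (V X (H v (V (H X h) X))))), (8, 3, H X (H X (V X (H v (V (H v X) X))))),
    (8, 3, H X (H X (V X (H (V X v) (H v X))))), (8, 6, H X (H X (V X (H (V X v) (V X h))))),
    (8, 6, H X (H X (V X (H (V X v) (V X v))))), (8, 6, H X (H X (V X (H (V X v) (V h X))))),
    (8, 4, H X (H X (V X (H (V X (V X v)) v)))), (8, 3, H X (H X (V X (H (V X (V h X)) v)))),
    (8, 2, H X (H X (V X (H (V X (H v v)) X)))), (8, 2, H X (H X (V X (H (V h (V h X)) X)))),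
    (8, 2, H X (H X (V X (V X (H X (H v v)))))), (8, 2, H X (H X (V X (V X (H v (H v X)))))),
    (8, 3, H X (H X (V X (V X (H v (V X h)))))), (8, 3, H X (H X (V X (V X (H v (V X v)))))),
    (8, 3, H X (H X (V X (V X (H v (V h X)))))), (8, 3, H X (H X (V X (V X (H (V X v) v))))),
    (8, 2, H X (H X (V X (V X (V X (H v v)))))), (8, 2, H X (H X (V X (V X (V h (V h X)))))),
    (8, 3, H X (H X (V X (V h (V (H X h) X))))), (4, 3, H X (H X (V X (V h (V (H X v) X))))),
    (4, 3, H X (H X (V X (V h (V (H v X) X))))), (4, 2, H X (H X (V X (V (H X (H v v)) X)))),
    (4, 2, H X (H X (V X (V (H v (H v X)) X)))), (8, 2, H X (H X (V h (V X (H v v))))),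
    (4, 2, H X (H v (H X (H X (H v v))))), (4, 2, H X (H v (H X (H v (H v X))))),
    (8, 3, H X (H v (H X (H v (V X h))))), (4, 3, H X (H v (H X (H v (V X v))))),
    (4, 3, H X (H v (H X (H (V X v) v)))), (8, 2, H X (H v (H X (V X (H v v))))),
    (4, 2, H X (H v (H v (H X (H X v))))), (8, 2, H X (H v (H v (H X (V X h))))),
    (4, 2, H X (H v (H v (H X (V X v))))), (4, 20, H X (H v (H v (H v v)))),
    (4, 10, H X (H v (H v (H (V X h) X)))), (4, 13, H X (H v (H v (H (V X v) X)))),
    (8, 15, H X (H v (H v (V X (H X h))))), (8, 24, H X (H v (H v (V X (H X v))))),
    (8, 33, H X (H v (H v (V X (H v X))))), (4, 24, H X (H v (H v (V X (V X v))))),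
    (4, 38, H X (H v (H v (V X (V h X))))), (8, 3, H X (H v (H (V X h) (H X v)))),
    (4, 3, H X (H v (H (V X v) (H X v)))), (2, 11, H X (H v (H (V X v) (H v X)))),
    (4, 16, H X (H v (H (V X (V X v)) v))), (4, 11, H X (H v (H (V X (V h X)) v))),
    (4, 5, H X (H v (H (V X (H X (H X h))) X))), (8, 10, H X (H v (H (V X (H X (H X v))) X))),
    (8, 4, H X (H v (H (V X (H X (H v X))) X))), (8, 10, H X (H v (H (V X (H X (V X v))) X))),
    (8, 12, H X (H v (H (V X (H X (V h X))) X))), (4, 3, H X (H v (H (V X (H (V X h) X)) X))),
    (4, 3, H X (H v (H (V X (H (V X v) X)) X))), (4, 3, H X (H v (H (V X (H (V h X) X)) X))),
    (4, 5, H X (H v (H (V X (V X (V X v))) X))), (8, 4, H X (H v (H (V X (V X (V h X))) X))),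
    (4, 3, H X (H v (H (V X (V (H X h) X)) X))), (4, 3, H X (H v (H (V X (V (H X v) X)) X))),
    (4, 3, H X (H v (H (V X (V (H v X) X)) X))), (8, 6, H X (H v (V X (H X (H X (H X h)))))),
    (8, 15, H X (H v (V X (H X (H X (H X v)))))), (8, 5, H X (H v (V X (H X (H X (H v X)))))),
    (8, 20, H X (H v (V X (H X (H X (V X v)))))), (8, 36, H X (H v (V X (H X (H X (V h X)))))),
    (8, 5, H X (H v (V X (H X (H v h))))), (8, 4, H X (H v (V X (H X (H (V X h) X))))),
    (8, 4, H X (H v (V X (H X (H (V X v) X))))), (8, 4, H X (H v (V X (H X (H (V h X) X))))),
    (8, 15, H X (H v (V X (H X (V X (V X v)))))), (8, 36, H X (H v (V X (H X (V X (V h X)))))),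
    (8, 30, H X (H v (V X (H X (V (H X h) X))))), (8, 5, H X (H v (V X (H v (H X h))))),
    (8, 7, H X (H v (V X (H v (H v X))))), (8, 4, H X (H v (V X (H (V X h) h)))),
    (8, 4, H X (H v (V X (H (V X v) h)))), (8, 4, H X (H v (V X (H (V h X) h)))),
    (8, 3, H X (H v (V X (H (V X (H X h)) X)))), (8, 3, H X (H v (V X (H (V X (H X v)) X)))),
    (8, 3, H X (H v (V X (H (V X (H v X)) X)))), (8, 3, H X (H v (V X (H (V X (V X h)) X)))),
    (8, 3, H X (H v (V X (H (V X (V X v)) X)))), (8, 3, H X (H v (V X (H (V X (V h X)) X)))),
    (8, 3, H X (H v (V X (H (V h v) X)))), (8, 3, H X (H v (V X (H (V (H X h) X) X)))),
    (8, 3, H X (H v (V X (H (V (H X v) X) X)))), (8, 3, H X (H v (V X (H (V (H v X) X) X)))),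
    (4, 6, H X (H v (V X (V X (V X (V X v)))))), (8, 5, H X (H v (V X (V X (V X (V h X)))))),
    (4, 5, H X (H v (V X (V X (V h v))))), (8, 4, H X (H v (V X (V X (V (H X h) X))))),
    (8, 4, H X (H v (V X (V X (V (H X v) X))))), (8, 4, H X (H v (V X (V X (V (H v X) X))))),
    (4, 7, H X (H v (V X (V h (V h X))))), (4, 3, H X (H v (V X (V (H X (H X h)) X)))),
    (4, 3, H X (H v (V X (V (H X (H X v)) X)))), (4, 3, H X (H v (V X (V (H X (H v X)) X)))),
    (8, 3, H X (H v (V X (V (H X (V X h)) X))))]"

definition orbits_3 :: "(nat \<times> nat \<times> assoc_type) list" where
  "orbits_3 =
   [(4, 3, H X (H v (V X (V (H X (V X v)) X)))), (4, 3, H X (H v (V X (V (H v h) X)))),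
    (8, 3, H X (H v (V X (V (H (V X h) X) X)))), (4, 3, H X (H v (V X (V (H (V X v) X) X)))),
    (8, 2, H X (H (V X h) (H X (H v v)))), (4, 2, H X (H (V X v) (H X (H v v)))),
    (4, 3, H X (H (V X v) (H v (H X v)))), (8, 24, H X (H (V X v) (H v (V X h)))),
    (4, 30, H X (H (V X v) (H v (V X v)))), (4, 38, H X (H (V X v) (H (V X v) v))),
    (4, 13, H X (H (V X v) (H (V X (H X v)) X))), (4, 10, H X (H (V X v) (H (V X (V X v)) X))),
    (2, 11, H X (H (V X v) (H (V X (V h X)) X))), (8, 15, H X (H (V X v) (V X (H X (H X h))))),
    (8, 24, H X (H (V X v) (V X (H X (H X v))))), (8, 36, H X (H (V X v) (V X (H X (H v X))))),
    (8, 24, H X (H (V X v) (V X (H X (V X v))))), (8, 38, H X (H (V X v) (V X (H X (V h X))))),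
    (8, 30, H X (H (V X v) (V X (H (V X v) X)))), (4, 15, H X (H (V X v) (V X (V X (V X v))))),
    (4, 33, H X (H (V X v) (V X (V X (V h X))))), (4, 16, H X (H (V X v) (V X (V (H X h) X)))),
    (4, 11, H X (H (V X v) (V X (V (H v X) X)))), (4, 24, H X (H (V X (V X v)) (H v v))),
    (8, 20, H X (H (V X (V X v)) (V X (H X h)))), (8, 24, H X (H (V X (V X v)) (V X (H X v)))),
    (8, 36, H X (H (V X (V X v)) (V X (H v X)))), (4, 20, H X (H (V X (V X v)) (V X (V X v)))),
    (4, 33, H X (H (V X (V X v)) (V X (V h X)))), (8, 2, H X (H (V X (H v v)) (H X v))),
    (8, 15, H X (H (V X (V X (V X v))) (V X h))), (4, 15, H X (H (V X (V X (V X v))) (V X v))),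
    (4, 6, H X (H (V X (V X (V X (V X v)))) v)), (8, 5, H X (H (V X (V X (V X (V h X)))) v)),
    (4, 5, H X (H (V X (V X (V h v))) v)), (8, 4, H X (H (V X (V X (V (H X h) X))) v)),
    (8, 4, H X (H (V X (V X (V (H X v) X))) v)), (8, 4, H X (H (V X (V X (V (H v X) X))) v)),
    (4, 7, H X (H (V X (V h (V h X))) v)), (4, 3, H X (H (V X (V (H X (H X h)) X)) v)),
    (4, 3, H X (H (V X (V (H X (H X v)) X)) v)), (4, 3, H X (H (V X (V (H X (H v X)) X)) v)),
    (8, 3, H X (H (V X (V (H X (V X h)) X)) v)), (4, 3, H X (H (V X (V (H X (V X v)) X)) v)),
    (4, 3, H X (H (V X (V (H v h) X)) v)), (8, 3, H X (H (V X (V (H (V X h) X) X)) v)),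
    (4, 3, H X (H (V X (V (H (V X v) X) X)) v)), (8, 2, H X (H (V X (H X (H X (H v v)))) X)),
    (4, 2, H X (H (V X (H X (H v (H v X)))) X)), (8, 3, H X (H (V X (H X (H v (V X h)))) X)),
    (8, 3, H X (H (V X (H X (H v (V X v)))) X)), (8, 3, H X (H (V X (H X (H v (V h X)))) X)),
    (8, 3, H X (H (V X (H X (H (V X v) v))) X)), (8, 2, H X (H (V X (H X (V X (H v v)))) X)),
    (8, 2, H X (H (V X (H X (V h (V h X)))) X)), (4, 6, H X (H (V X (H v (H v v))) X)),
    (4, 4, H X (H (V X (H v (V X (H X h)))) X)), (8, 6, H X (H (V X (H v (V X (H X v)))) X)),
    (4, 3, H X (H (V X (H v (V X (H v X)))) X)), (8, 4, H X (H (V X (H v (V X (V X v)))) X)),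
    (8, 3, H X (H (V X (H v (V X (V h X)))) X)), (8, 6, H X (H (V X (H v (V h v))) X)),
    (4, 4, H X (H (V X (H v (V (H X h) X))) X)), (4, 3, H X (H (V X (H v (V (H v X) X))) X)),
    (4, 6, H X (H (V X (H (V X v) (V X v))) X)), (8, 2, H X (H (V X (V X (H X (H v v)))) X)),
    (4, 3, H X (H (V X (V X (H v (V X h)))) X)), (8, 3, H X (H (V X (V X (H v (V X v)))) X)),
    (4, 3, H X (H (V X (V X (H v (V h X)))) X)), (4, 2, H X (H (V X (V X (V X (H v v)))) X)),
    (4, 2, H X (H (V X (V X (V h (V h X)))) X)), (4, 3, H X (H (V X (V h (V (H X h) X))) X)),
    (4, 3, H X (H (V X (V h (V (H X v) X))) X)), (4, 2, H X (H (V X (V (H X (H v v)) X)) X)),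
    (4, 2, H X (H (V h (V X (H v v))) X)), (8, 2, H X (V X (H X (H X (H X (H v v)))))),
    (8, 2, H X (V X (H X (H X (H v (H v X)))))), (8, 3, H X (V X (H X (H X (H v (V X h)))))),
    (8, 3, H X (V X (H X (H X (H v (V X v)))))), (8, 3, H X (V X (H X (H X (H v (V h X)))))),
    (8, 3, H X (V X (H X (H X (H (V X v) v))))), (8, 2, H X (V X (H X (H X (V X (H v v)))))),
    (8, 2, H X (V X (H X (H X (V h (V h X)))))), (8, 2, H X (V X (H X (H v (H v h))))),
    (8, 6, H X (V X (H X (H v (H v v))))), (8, 3, H X (V X (H X (H v (H (V X h) X))))),
    (8, 3, H X (V X (H X (H v (H (V X v) X))))), (8, 3, H X (V X (H X (H v (H (V h X) X))))),
    (8, 4, H X (V X (H X (H v (V X (H X h)))))), (8, 6, H X (V X (H X (H v (V X (H X v)))))),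
    (8, 3, H X (V X (H X (H v (V X (H v X)))))), (8, 4, H X (V X (H X (H v (V X (V X v)))))),
    (8, 3, H X (V X (H X (H v (V X (V h X)))))), (8, 6, H X (V X (H X (H v (V h v))))),
    (8, 4, H X (V X (H X (H v (V (H X h) X))))), (8, 3, H X (V X (H X (H v (V (H v X) X))))),
    (8, 3, H X (V X (H X (H (V X v) (H v X))))), (8, 6, H X (V X (H X (H (V X v) (V X h))))),
    (8, 6, H X (V X (H X (H (V X v) (V X v)))))]"

definition orbits_4 :: "(nat \<times> nat \<times> assoc_type) list" where
  "orbits_4 =
   [(8, 6, H X (V X (H X (H (V X v) (V h X))))), (8, 4, H X (V X (H X (H (V X (V X v)) v)))),
    (8, 3, H X (V X (H X (H (V X (V h X)) v)))), (8, 2, H X (V X (H X (H (V X (H v v)) X)))),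
    (8, 2, H X (V X (H X (H (V h (V h X)) X)))), (8, 2, H X (V X (H X (V X (H X (H v v)))))),
    (8, 2, H X (V X (H X (V X (H v (H v X)))))), (8, 3, H X (V X (H X (V X (H v (V X h)))))),
    (8, 3, H X (V X (H X (V X (H v (V X v)))))), (8, 3, H X (V X (H X (V X (H v (V h X)))))),
    (8, 3, H X (V X (H X (V X (H (V X v) v))))), (8, 2, H X (V X (H X (V X (V X (H v v)))))),
    (8, 2, H X (V X (H X (V X (V h (V h X)))))), (8, 2, H X (V X (H X (V h (V h v))))),
    (8, 3, H X (V X (H X (V h (V (H X h) X))))), (8, 3, H X (V X (H X (V h (V (H X v) X))))),
    (8, 3, H X (V X (H X (V h (V (H v X) X))))), (8, 3, H X (V X (H X (V (H X h) (V h X))))),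
    (8, 2, H X (V X (H X (V (H X (H v v)) X)))), (8, 2, H X (V X (H X (V (H v (H v X)) X)))),
    (8, 2, H X (V X (H v (H X (H v v))))), (8, 2, H X (V X (H v (H v (H X h))))),
    (8, 2, H X (V X (H v (H v (H X v))))), (8, 6, H X (V X (H v (H v (H v X))))),
    (8, 10, H X (V X (H v (H v (V X h))))), (8, 13, H X (V X (H v (H v (V X v))))),
    (8, 10, H X (V X (H v (H v (V h X))))), (8, 3, H X (V X (H v (H (V X h) h)))),
    (8, 3, H X (V X (H v (H (V X v) h)))), (8, 11, H X (V X (H v (H (V X v) v)))),
    (8, 3, H X (V X (H v (H (V h X) h)))), (8, 4, H X (V X (H v (H (V X (H X h)) X)))),
    (8, 6, H X (V X (H v (H (V X (H X v)) X)))), (8, 3, H X (V X (H v (H (V X (H v X)) X)))),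
    (8, 4, H X (V X (H v (H (V X (V X v)) X)))), (8, 3, H X (V X (H v (H (V X (V h X)) X)))),
    (8, 6, H X (V X (H v (H (V h v) X)))), (8, 4, H X (V X (H v (H (V (H X h) X) X)))),
    (8, 3, H X (V X (H v (H (V (H v X) X) X)))), (8, 5, H X (V X (H v (V X (H X (H X h)))))),
    (8, 10, H X (V X (H v (V X (H X (H X v)))))), (8, 4, H X (V X (H v (V X (H X (H v X)))))),
    (8, 10, H X (V X (H v (V X (H X (V X v)))))), (8, 12, H X (V X (H v (V X (H X (V h X)))))),
    (8, 4, H X (V X (H v (V X (H v h))))), (8, 3, H X (V X (H v (V X (H (V X h) X))))),
    (8, 3, H X (V X (H v (V X (H (V X v) X))))), (8, 3, H X (V X (H v (V X (H (V h X) X))))),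
    (8, 5, H X (V X (H v (V X (V X (V X v)))))), (8, 4, H X (V X (H v (V X (V X (V h X)))))),
    (8, 4, H X (V X (H v (V X (V h v))))), (8, 3, H X (V X (H v (V X (V (H X h) X))))),
    (8, 3, H X (V X (H v (V X (V (H X v) X))))), (8, 3, H X (V X (H v (V X (V (H v X) X))))),
    (8, 10, H X (V X (H v (V h (V X v))))), (8, 12, H X (V X (H v (V h (V h X))))),
    (8, 10, H X (V X (H v (V (H X h) v)))), (8, 5, H X (V X (H v (V (H X (H X h)) X)))),
    (8, 4, H X (V X (H v (V (H X (H v X)) X)))), (8, 4, H X (V X (H v (V (H v h) X)))),
    (8, 3, H X (V X (H v (V (H (V X h) X) X)))), (8, 3, H X (V X (H v (V (H (V X v) X) X)))),
    (8, 3, H X (V X (H v (V (H (V h X) X) X)))), (8, 3, H X (V X (H (V X v) (H v h)))),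
    (8, 13, H X (V X (H (V X v) (H v v)))), (8, 6, H X (V X (H (V X v) (H (V X h) X)))),
    (8, 6, H X (V X (H (V X v) (H (V X v) X)))), (8, 6, H X (V X (H (V X v) (H (V h X) X)))),
    (8, 10, H X (V X (H (V X v) (V X (H X h))))), (8, 13, H X (V X (H (V X v) (V X (H X v))))),
    (8, 12, H X (V X (H (V X v) (V X (H v X))))), (8, 10, H X (V X (H (V X v) (V X (V X v))))),
    (8, 11, H X (V X (H (V X v) (V X (V h X))))), (8, 13, H X (V X (H (V X v) (V h v)))),
    (8, 10, H X (V X (H (V X v) (V (H X h) X)))), (8, 12, H X (V X (H (V X v) (V (H v X) X)))),
    (8, 4, H X (V X (H (V X (V X v)) (H v X)))), (8, 10, H X (V X (H (V X (V X v)) (V X h)))),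
    (8, 10, H X (V X (H (V X (V X v)) (V X v)))), (8, 10, H X (V X (H (V X (V X v)) (V h X)))),
    (8, 3, H X (V X (H (V X (V h X)) (H v X)))), (8, 2, H X (V X (H (V X (H v v)) h))),
    (8, 5, H X (V X (H (V X (V X (V X v))) v))), (8, 4, H X (V X (H (V X (V X (V h X))) v))),
    (8, 4, H X (V X (H (V X (V h v)) v))), (8, 3, H X (V X (H (V X (V (H X h) X)) v))),
    (8, 3, H X (V X (H (V X (V (H X v) X)) v))), (8, 3, H X (V X (H (V X (V (H v X) X)) v))),
    (8, 2, H X (V X (H (V h (V h X)) h))), (8, 2, H X (V X (H (V X (H X (H v v))) X))),
    (8, 2, H X (V X (H (V X (H v (H v X))) X))), (8, 3, H X (V X (H (V X (H v (V X h))) X))),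
    (8, 3, H X (V X (H (V X (H v (V X v))) X))), (8, 3, H X (V X (H (V X (H v (V h X))) X))),
    (8, 3, H X (V X (H (V X (H (V X v) v)) X))), (8, 2, H X (V X (H (V X (V X (H v v))) X))),
    (8, 2, H X (V X (H (V X (V h (V h X))) X))), (8, 2, H X (V X (H (V h (V h v)) X))),
    (8, 3, H X (V X (H (V h (V (H X h) X)) X)))]"

definition orbits_5 :: "(nat \<times> nat \<times> assoc_type) list" where
  "orbits_5 =
   [(8, 3, H X (V X (H (V h (V (H X v) X)) X))), (8, 3, H X (V X (H (V h (V (H v X) X)) X))),
    (8, 3, H X (V X (H (V (H X h) (V h X)) X))), (8, 2, H X (V X (H (V (H X (H v v)) X) X))),
    (8, 2, H X (V X (H (V (H v (H v X)) X) X))), (8, 2, H X (V X (V X (H X (H X (H v v)))))),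
    (8, 2, H X (V X (V X (H X (H v (H v X)))))), (8, 3, H X (V X (V X (H X (H v (V X h)))))),
    (8, 3, H X (V X (V X (H X (H v (V X v)))))), (8, 3, H X (V X (V X (H X (H v (V h X)))))),
    (8, 3, H X (V X (V X (H X (H (V X v) v))))), (8, 2, H X (V X (V X (H X (V X (H v v)))))),
    (8, 2, H X (V X (V X (H X (V h (V h X)))))), (8, 2, H X (V X (V X (H v (H v h))))),
    (8, 6, H X (V X (V X (H v (H v v))))), (8, 3, H X (V X (V X (H v (H (V X h) X))))),
    (8, 3, H X (V X (V X (H v (H (V X v) X))))), (8, 3, H X (V X (V X (H v (H (V h X) X))))),
    (8, 4, H X (V X (V X (H v (V X (H X h)))))), (8, 6, H X (V X (V X (H v (V X (H X v)))))),
    (8, 3, H X (V X (V X (H v (V X (H v X)))))), (8, 4, H X (V X (V X (H v (V X (V X v)))))),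
    (8, 3, H X (V X (V X (H v (V X (V h X)))))), (8, 6, H X (V X (V X (H v (V h v))))),
    (8, 4, H X (V X (V X (H v (V (H X h) X))))), (8, 3, H X (V X (V X (H v (V (H v X) X))))),
    (8, 3, H X (V X (V X (H (V X v) (H v X))))), (8, 6, H X (V X (V X (H (V X v) (V X h))))),
    (8, 6, H X (V X (V X (H (V X v) (V X v))))), (8, 6, H X (V X (V X (H (V X v) (V h X))))),
    (8, 4, H X (V X (V X (H (V X (V X v)) v)))), (8, 3, H X (V X (V X (H (V X (V h X)) v)))),
    (8, 2, H X (V X (V X (H (V X (H v v)) X)))), (8, 2, H X (V X (V X (H (V h (V h X)) X)))),
    (8, 2, H X (V X (V X (V X (H X (H v v)))))), (8, 2, H X (V X (V X (V X (H v (H v X)))))),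
    (8, 3, H X (V X (V X (V X (H v (V X h)))))), (8, 3, H X (V X (V X (V X (H v (V X v)))))),
    (8, 3, H X (V X (V X (V X (H v (V h X)))))), (8, 3, H X (V X (V X (V X (H (V X v) v))))),
    (8, 2, H X (V X (V X (V X (V X (H v v)))))), (8, 2, H X (V X (V X (V X (V h (V h X)))))),
    (4, 2, H X (V X (V X (V h (V h v))))), (8, 3, H X (V X (V X (V h (V (H X h) X))))),
    (8, 3, H X (V X (V X (V h (V (H X v) X))))), (8, 3, H X (V X (V X (V h (V (H v X) X))))),
    (8, 3, H X (V X (V X (V (H X h) (V h X))))), (8, 2, H X (V X (V X (V (H X (H v v)) X)))),
    (8, 2, H X (V X (V X (V (H v (H v X)) X)))), (8, 2, H X (V X (V h (V X (H v v))))),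
    (8, 2, H X (V X (V h (V h (V X h))))), (4, 6, H X (V X (V h (V h (V h X))))),
    (8, 4, H X (V X (V h (V (H X (H X h)) X)))), (8, 6, H X (V X (V h (V (H X (H X v)) X)))),
    (8, 3, H X (V X (V h (V (H X (H v X)) X)))), (4, 4, H X (V X (V h (V (H X (V X v)) X)))),
    (4, 3, H X (V X (V h (V (H X (V h X)) X)))), (8, 6, H X (V X (V h (V (H v h) X)))),
    (4, 4, H X (V X (V h (V (H (V X v) X) X)))), (4, 3, H X (V X (V h (V (H (V h X) X) X)))),
    (4, 6, H X (V X (V (H X h) (V (H X h) X)))), (4, 2, H X (V X (V (H X (H X (H v v))) X))),
    (4, 2, H X (V X (V (H X (H v (H v X))) X))), (8, 3, H X (V X (V (H X (H v (V X h))) X))),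
    (4, 3, H X (V X (V (H X (H v (V X v))) X))), (4, 3, H X (V X (V (H X (H (V X v) v)) X))),
    (8, 2, H X (V X (V (H X (V X (H v v))) X))), (4, 2, H X (V X (V (H v (H v h)) X))),
    (8, 3, H X (V X (V (H v (H (V X h) X)) X))), (4, 3, H X (V X (V (H v (H (V X v) X)) X))),
    (4, 3, H X (V X (V (H (V X v) (H v X)) X))), (8, 2, H X (V X (V (H (V X (H v v)) X) X))),
    (8, 2, H X (V h (V X (H X (H v v))))), (8, 2, H X (V h (V X (H v (H v X))))),
    (8, 3, H X (V h (V X (H v (V X h))))), (8, 3, H X (V h (V X (H v (V X v))))),
    (8, 3, H X (V h (V X (H v (V h X))))), (8, 3, H X (V h (V X (H (V X v) v)))),
    (8, 2, H X (V h (V X (V X (H v v))))), (8, 2, H X (V h (V h (V X (H X h))))),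
    (8, 2, H X (V h (V h (V X (H X v))))), (8, 2, H X (V h (V h (V X (H v X))))),
    (4, 2, H v (H X (H X (H X (H v v))))), (8, 3, H v (H X (H X (H v (V X h))))),
    (4, 3, H v (H X (H X (H v (V X v))))), (4, 3, H v (H X (H X (H (V X v) v)))),
    (8, 2, H v (H X (H X (V X (H v v))))), (4, 6, H v (H X (H v (H v v)))),
    (8, 4, H v (H X (H v (V X (H X h))))), (8, 6, H v (H X (H v (V X (H X v))))),
    (8, 3, H v (H X (H v (V X (H v X))))), (4, 4, H v (H X (H v (V X (V X v))))),
    (4, 3, H v (H X (H v (V X (V h X))))), (8, 6, H v (H X (H (V X v) (V X h)))),
    (4, 6, H v (H X (H (V X v) (V X v)))), (4, 4, H v (H X (H (V X (V X v)) v))),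
    (4, 3, H v (H X (H (V X (V h X)) v))), (8, 2, H v (H X (V X (H X (H v v))))),
    (8, 2, H v (H X (V X (H v (H v X)))))]"

definition orbits_6 :: "(nat \<times> nat \<times> assoc_type) list" where
  "orbits_6 =
   [(8, 3, H v (H X (V X (H v (V X h))))), (8, 3, H v (H X (V X (H v (V X v))))),
    (8, 3, H v (H X (V X (H v (V h X))))), (8, 3, H v (H X (V X (H (V X v) v)))),
    (8, 2, H v (H X (V X (V X (H v v))))), (4, 2, H v (H X (V X (V h (V h X))))),
    (8, 2, H v (H v (H X (H X (V X h))))), (4, 2, H v (H v (H X (H X (V X v))))),
    (2, 4, H v (H v (H X (H v v)))), (8, 2, H v (H v (H X (V X (H X h))))),
    (8, 2, H v (H v (H X (V X (H X v))))), (8, 2, H v (H v (H X (V X (H v X))))),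
    (8, 2, H v (H v (H X (V X (V X h))))), (4, 2, H v (H v (H X (V X (V X v))))),
    (4, 2, H v (H v (H X (V X (V h X))))), (4, 35, H v (H v (H v (V X h)))),
    (4, 49, H v (H v (H v (V X v)))), (2, 89, H v (H v (H (V X v) v))),
    (4, 21, H v (H v (V X (H X (H X h))))), (8, 40, H v (H v (V X (H X (H X v))))),
    (4, 80, H v (H v (V X (H X (H v X))))), (8, 49, H v (H v (V X (H X (V X v))))),
    (8, 105, H v (H v (V X (H X (V h X))))), (4, 107, H v (H v (V X (H (V X v) X)))),
    (4, 40, H v (H v (V X (V X (V X v))))), (4, 108, H v (H v (V X (V X (V h X))))),
    (4, 113, H v (H v (V X (V (H X h) X)))), (8, 3, H v (H (V X h) (H X (V X h)))),
    (8, 3, H v (H (V X h) (H X (V X v)))), (8, 3, H v (H (V X h) (H X (V h X)))),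
    (8, 3, H v (H (V X v) (H X (V X h)))), (4, 3, H v (H (V X v) (H X (V X v)))),
    (2, 21, H v (H (V X (V X (V X v))) v)), (4, 16, H v (H (V X (V X (V h X))) v)),
    (2, 11, H v (H (V X (V (H X h) X)) v)), (4, 11, H v (H (V X (V (H X v) X)) v)),
    (4, 7, H v (V X (H X (H X (H X (H X h)))))), (8, 21, H v (V X (H X (H X (H X (H X v)))))),
    (8, 6, H v (V X (H X (H X (H X (H v X)))))), (8, 35, H v (V X (H X (H X (H X (V X v)))))),
    (8, 86, H v (V X (H X (H X (H X (V h X)))))), (8, 6, H v (V X (H X (H X (H v h))))),
    (8, 5, H v (V X (H X (H X (H (V X h) X))))), (8, 5, H v (V X (H X (H X (H (V X v) X))))),
    (8, 5, H v (V X (H X (H X (H (V h X) X))))), (4, 100, H v (V X (H X (H X (V X (V h X)))))),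
    (8, 120, H v (V X (H X (H X (V (H X h) X))))), (8, 9, H v (V X (H X (H v (H v X))))),
    (4, 5, H v (V X (H X (H (V X h) h)))), (4, 5, H v (V X (H X (H (V X v) h)))),
    (4, 5, H v (V X (H X (H (V h X) h)))), (8, 4, H v (V X (H X (H (V X (H X h)) X)))),
    (8, 4, H v (V X (H X (H (V X (H X v)) X)))), (8, 4, H v (V X (H X (H (V X (H v X)) X)))),
    (8, 4, H v (V X (H X (H (V X (V X h)) X)))), (8, 4, H v (V X (H X (H (V X (V X v)) X)))),
    (8, 4, H v (V X (H X (H (V X (V h X)) X)))), (8, 4, H v (V X (H X (H (V h v) X)))),
    (8, 4, H v (V X (H X (H (V (H X h) X) X)))), (8, 4, H v (V X (H X (H (V (H X v) X) X)))),
    (8, 4, H v (V X (H X (H (V (H v X) X) X)))), (4, 96, H v (V X (H X (V (H X (H X h)) X)))),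
    (4, 5, H v (V X (H v (H X (H v X))))), (4, 11, H v (V X (H v (H (V X h) X)))),
    (8, 10, H v (V X (H v (H (V X v) X)))), (4, 11, H v (V X (H v (H (V h X) X)))),
    (4, 3, H v (V X (H (V X (H X (H X h))) X))), (8, 3, H v (V X (H (V X (H X (H X v))) X))),
    (4, 3, H v (V X (H (V X (H X (H v X))) X))), (8, 3, H v (V X (H (V X (H X (V X h))) X))),
    (8, 3, H v (V X (H (V X (H X (V X v))) X))), (8, 3, H v (V X (H (V X (H X (V h X))) X))),
    (4, 6, H v (V X (H (V X (H v v)) X))), (4, 3, H v (V X (H (V X (V X (H X h))) X))),
    (8, 3, H v (V X (H (V X (V X (H X v))) X))), (4, 3, H v (V X (H (V X (V X (V X h))) X))),
    (4, 3, H v (V X (H (V X (V X (V X v))) X))), (4, 3, H v (V X (H (V X (V X (V h X))) X))),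
    (4, 3, H v (V X (H (V X (V h v)) X))), (4, 3, H v (V X (H (V X (V (H X h) X)) X))),
    (8, 3, H v (V X (H (V X (V (H X v) X)) X))), (4, 3, H v (V X (H (V h (V X h)) X))),
    (4, 3, H v (V X (H (V h (V X v)) X))), (4, 6, H v (V X (H (V h (V h X)) X))),
    (4, 3, H v (V X (H (V (H X h) v) X))), (8, 3, H v (V X (H (V (H X v) v) X))),
    (4, 3, H v (V X (H (V (H X (H X h)) X) X))), (8, 3, H v (V X (H (V (H X (H X v)) X) X))),
    (4, 3, H v (V X (H (V (H X (H v X)) X) X))), (8, 3, H v (V X (H (V (H X (V X h)) X) X))),
    (8, 3, H v (V X (H (V (H X (V X v)) X) X))), (8, 3, H v (V X (H (V (H X (V h X)) X) X))),
    (8, 3, H (V X h) (H X (H v (V X v)))), (8, 2, H (V X h) (H X (V X (H v v)))),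
    (8, 2, H (V X h) (H X (V h (V h X)))), (4, 3, H (V X v) (H X (H v (V X v)))),
    (8, 2, H (V X v) (H X (V X (H v v)))), (4, 59, H (V X v) (H v (V X (H X v)))),
    (1, 118, H (V X v) (H v (V X (V h X))))]"

text \<open>The smallest vertex of the components with 120 vertices, hence a vertex of the first of
  them in the numbering.\<close>

definition big_type :: assoc_type where
  "big_type = H v (V X (H X (H X (V (H X h) X))))"

end

lemma check_orbits_1: "check_orbits orbits_1"
  unfolding orbits_1_def by (simp only: orbit_eval)

lemma check_orbits_2: "check_orbits orbits_2"
  unfolding orbits_2_def by (simp only: orbit_eval)

lemma check_orbits_3: "check_orbits orbits_3"
  unfolding orbits_3_def by (simp only: orbit_eval)

lemma check_orbits_4: "check_orbits orbits_4"
  unfolding orbits_4_def by (simp only: orbit_eval)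

lemma check_orbits_5: "check_orbits orbits_5"
  unfolding orbits_5_def by (simp only: orbit_eval)

lemma check_orbits_6: "check_orbits orbits_6"
  unfolding orbits_6_def by (simp only: orbit_eval)

definition orbits :: "(nat \<times> nat \<times> assoc_type) list" where
  "orbits = orbits_1 @ orbits_2 @ orbits_3 @ orbits_4 @ orbits_5 @ orbits_6"

lemma check_orbits_orbits: "check_orbits orbits"
  using check_orbits_1 check_orbits_2 check_orbits_3 check_orbits_4 check_orbits_5 check_orbits_6
  by (simp add: orbits_def check_orbits_def)

lemma ascending_orbits: "ascending (Var ()) orbits"
  unfolding orbits_def orbits_1_def orbits_2_def orbits_3_def orbits_4_def orbits_5_def orbits_6_def
  by (simp only: orbit_eval)

lemma sum_orbits:
  "sum_list (map (\<lambda>(m, s, r). m) orbits) = 4001"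
  "sum_list (map (\<lambda>(m, s, r). m * s) orbits) = 27528"
  by (simp_all add: orbits_def orbits_1_def orbits_2_def orbits_3_def orbits_4_def orbits_5_def orbits_6_def)

text \<open>The bound 120 separates the orbit of \<open>big_type\<close> from all others, whose
  components have at most 118 vertices. The bound 2 ensures that no listed component is an isolated
  vertex.\<close>

lemma orbits_sizes: "list_all (\<lambda>(m, s, r). 2 \<le> s \<and> (s < 120 \<or> r = big_type)) orbits"
  by (simp add: orbits_def big_type_def orbits_1_def orbits_2_def orbits_3_def orbits_4_def orbits_5_def orbits_6_def)

lemma big_type_in_orbits: "(8, 120, big_type) \<in> set orbits"
  by (simp add: orbits_def big_type_def orbits_1_def orbits_2_def orbits_3_def orbits_4_def orbits_5_def orbits_6_def)

section \<open>Monomials reachable from the left side\<close>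

definition only_two :: "assoc_type \<Rightarrow> nat monomial \<Rightarrow> nat monomial \<Rightarrow> nat monomial list \<Rightarrow> bool" where
  "only_two t a b ms \<longleftrightarrow> (\<forall>m \<in> set ms. type_of m = t \<longrightarrow> m = a \<or> m = b)"

definition only_two_and :: "bool \<Rightarrow> nat monomial \<Rightarrow> assoc_type \<Rightarrow> nat monomial \<Rightarrow> nat monomial \<Rightarrow>
    nat monomial list \<Rightarrow> bool" where
  "only_two_and c m t a b ms \<longleftrightarrow> (c \<longrightarrow> m = a \<or> m = b) \<and> only_two t a b ms"

definition check_lifts :: "nat monomial \<Rightarrow> nat monomial \<Rightarrow> nat monomial list \<Rightarrow> bool" where
  "check_lifts a b ms \<longleftrightarrow> ms \<noteq> [] \<and> b \<in> set ms \<and> only_two (type_of a) a b ms"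

lemma lifts_eval:
  "type_of (Var x) = Var ()"
  "type_of (p \<^bold>\<circ> q) = type_of p \<^bold>\<circ> type_of q"
  "type_of (p \<^bold>\<bullet> q) = type_of p \<^bold>\<bullet> type_of q"
  "only_two t a b [] = True"
  "only_two t a b (m # ms) = only_two_and (same (type_of m) t) m t a b ms"
  "only_two_and True m t a b ms = (mem m [a, b] \<and> only_two t a b ms)"
  "only_two_and False m t a b ms = only_two t a b ms"
  "check_lifts a b [] = False"
  "check_lifts a b (m # ms) = (mem b (m # ms) \<and> only_two (type_of a) a b (m # ms))"
  by (auto simp: type_of_def only_two_def only_two_and_def check_lifts_def same_def mem_def)

text \<open>The search runs over monomials, two for each association type of the component, hence
  twice the fuel of \<open>check_orbit\<close>.\<close>

lemma check_lifts: "check_lifts left_side right_side (search 1000 [] [left_side])"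
  unfolding left_side_def right_side_def monomial_3994_def
  by (simp only: search_eval neighbours_eval lifts_eval simp_thms rel_simps)

lemma mem_big_class: "mem (type_of left_side) (search 1000 [] [big_type])"
  unfolding left_side_def monomial_3994_def big_type_def
  by (simp only: search_eval neighbours_eval lifts_eval simp_thms)

lemma connected_class_isolated: "neighbours t = [] \<Longrightarrow> connected_class t = {t}"
  unfolding connected_class_def by (auto elim: converse_rtranclE)

lemma orbit_unionD:
  assumes "C \<in> orbit_union orbits"
  shows "\<exists>t \<in> assoc_types 9. C = connected_class t" "finite C" "2 \<le> card C"
    "card C < 120 \<or> C \<in> orbit big_type"
proof -
  obtain m s r where e: "(m, s, r) \<in> set orbits" "C \<in> orbit r"
    using assms by (auto simp: orbit_union_def)
  have c: "check_orbit (m, s, r)"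
    using check_orbits_orbits e(1) by (auto simp: check_orbits_def list_all_iff)
  note ok = check_orbit_correct[OF c]
  show "\<exists>t \<in> assoc_types 9. C = connected_class t"
    using e(2) D8_act_assoc_types[OF ok(1)] by (auto simp: orbit_def)
  have "2 \<le> s \<and> (s < 120 \<or> r = big_type)"
    using orbits_sizes e(1) by (auto simp: list_all_iff)
  then show "finite C" "2 \<le> card C" "card C < 120 \<or> C \<in> orbit big_type"
    using ok(3)[OF e(2)] e(2) by auto
qed

lemma ascending_orbits': "sorted_wrt type_less (map (snd \<circ> snd) orbits)"
  using ascending_orbits by (simp add: ascending_def)

lemmas orbit_union_orbits = card_orbit_union[OF check_orbits_orbits ascending_orbits', unfolded sum_orbits]

text \<open>
  The components found are disjoint, and together they have as many vertices as there are
  association types admitting an interchange; hence none is missing.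
\<close>

lemma Union_orbit_union: "\<Union>(orbit_union orbits) = {t \<in> assoc_types 9. neighbours t \<noteq> []}"
proof (rule card_subset_eq)
  show "finite {t \<in> assoc_types 9. neighbours t \<noteq> []}" using finite_assoc_types[of 9] by simp
  show "\<Union>(orbit_union orbits) \<subseteq> {t \<in> assoc_types 9. neighbours t \<noteq> []}"
  proof
    fix t assume "t \<in> \<Union>(orbit_union orbits)"
    then obtain C where C: "C \<in> orbit_union orbits" "t \<in> C" by blast
    obtain u where u: "u \<in> assoc_types 9" "C = connected_class u" using orbit_unionD(1)[OF C(1)] by blast
    have t: "t \<in> assoc_types 9" using connected_class_subset[OF u(1)] C(2) u(2) by blast
    have "C = connected_class t" using connected_class_eq[OF u(1)] C(2) u(2) by simp
    then have "neighbours t \<noteq> []" using connected_class_isolated[of t] orbit_unionD(3)[OF C(1)] by force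
    then show "t \<in> {t \<in> assoc_types 9. neighbours t \<noteq> []}" using t by simp
  qed
  have "card (\<Union>(orbit_union orbits)) = sum card (orbit_union orbits)"
  proof (rule card_Union_disjoint)
    show "pairwise disjnt (orbit_union orbits)"
    proof (rule pairwiseI)
      fix C D assume "C \<in> orbit_union orbits" "D \<in> orbit_union orbits" "C \<noteq> D"
      then show "disjnt C D"
        using orbit_unionD(1) connected_class_disjoint unfolding disjnt_def by metis
    qed
  qed (rule orbit_unionD(2))
  then show "card (\<Union>(orbit_union orbits)) = card {t \<in> assoc_types 9. neighbours t \<noteq> []}"
    using orbit_union_orbits card_not_isolated_9 by simp
qed

lemma nonisolated_components_9: "nonisolated_components 9 = orbit_union orbits"
proof
  show "nonisolated_components 9 \<subseteq> orbit_union orbits"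
  proof
    fix C assume "C \<in> nonisolated_components 9"
    then obtain t where t: "t \<in> assoc_types 9" "C = connected_class t" "2 \<le> card C"
      by (auto simp: nonisolated_components_def sccs_verts_G_graph)
    then have "neighbours t \<noteq> []" using connected_class_isolated[of t] by force
    then obtain D where D: "D \<in> orbit_union orbits" "t \<in> D" using Union_orbit_union t(1) by blast
    obtain u where u: "u \<in> assoc_types 9" "D = connected_class u" using orbit_unionD(1)[OF D(1)] by blast
    have "D = C" using connected_class_eq[OF u(1), of t] D(2) u(2) t(2) by simp
    then show "C \<in> orbit_union orbits" using D(1) by simp
  qed
  show "orbit_union orbits \<subseteq> nonisolated_components 9"
    using orbit_unionD by (auto simp: nonisolated_components_def sccs_verts_G_graph)
qed

section \<open>The numbering of the components\<close>

lemma index_number_less: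
  assumes "t \<in> assoc_types n" "u \<in> assoc_types n" "type_less t u"
  shows "index_number t < index_number u"
proof -
  have d: "mdegree t = n" "mdegree u = n" using assms by (auto simp: assoc_types_def)
  have "{s \<in> assoc_types n. type_less s t} \<subset> {s \<in> assoc_types n. type_less s u}"
    using assms type_less_trans type_less_irrefl by blast
  then have "card {s \<in> assoc_types n. type_less s t} < card {s \<in> assoc_types n. type_less s u}"
    by (intro psubset_card_mono) (simp_all add: finite_assoc_types)
  then show ?thesis by (simp add: index_number_def d)
qed

lemma index_number_inj: "inj_on index_number (assoc_types n)"
  using index_number_less type_less_total by (metis inj_onI nat_neq_iff)

lemma index_number_le:
  "t \<in> assoc_types n \<Longrightarrow> u \<in> assoc_types n \<Longrightarrow> \<not> type_less u t \<Longrightarrow> index_number t \<le> index_number u"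
  using index_number_less[of t n u] type_less_total[of t u] by auto

text \<open>In a finite strict total order the number of predecessors is strictly monotone, hence an
  injective rank.\<close>

lemma card_predecessors:
  assumes "finite N" "\<And>x. \<not> R x x" "\<And>x y z. R x y \<Longrightarrow> R y z \<Longrightarrow> R x z"
    "\<And>x y. x \<in> N \<Longrightarrow> y \<in> N \<Longrightarrow> x \<noteq> y \<Longrightarrow> R x y \<or> R y x"
  shows "inj_on (\<lambda>x. card {y \<in> N. R y x}) N" "x \<in> N \<Longrightarrow> card {y \<in> N. R y x} < card N"
proof -
  have less: "card {y \<in> N. R y x} < card {y \<in> N. R y z}" if "x \<in> N" "R x z" for x z
  proof (rule psubset_card_mono)
    show "{y \<in> N. R y x} \<subset> {y \<in> N. R y z}" using that assms(2,3) by blast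
  qed (use assms(1) in simp)
  then show "inj_on (\<lambda>x. card {y \<in> N. R y x}) N"
    using assms(4) by (metis (mono_tags, lifting) inj_onI nat_neq_iff)
  show "card {y \<in> N. R y x} < card N" if "x \<in> N"
  proof (rule psubset_card_mono[OF assms(1)])
    show "{y \<in> N. R y x} \<subset> N" using that assms(2) by blast
  qed
qed

abbreviation components :: "assoc_type set set" where
  "components \<equiv> nonisolated_components 9"

lemma componentsD:
  assumes "C \<in> components"
  shows "\<exists>t \<in> assoc_types 9. C = connected_class t" "finite C" "C \<noteq> {}" "C \<subseteq> assoc_types 9"
proof -
  show t: "\<exists>t \<in> assoc_types 9. C = connected_class t" and "finite C"
    using assms orbit_unionD unfolding nonisolated_components_9 by blast+
  show "C \<noteq> {}" "C \<subseteq> assoc_types 9" using t connected_class_refl connected_class_subset by blast+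
qed

text \<open>Components of equal size are told apart by their minima, because they are disjoint and
  \<open>index_number\<close> is injective.\<close>

lemma component_before_total:
  assumes "C \<in> components" "D \<in> components" "C \<noteq> D"
  shows "component_before C D \<or> component_before D C"
proof -
  note c = componentsD[OF assms(1)] and d = componentsD[OF assms(2)]
  have "Min (index_number ` C) \<in> index_number ` C" "Min (index_number ` D) \<in> index_number ` D"
    using c d by simp_all
  moreover have "index_number ` C \<inter> index_number ` D = {}"
  proof -
    have "C \<inter> D = {}" using c(1) d(1) connected_class_disjoint assms(3) by metis
    then show ?thesis
      using inj_on_image_Int[OF index_number_inj[of 9] c(4) d(4)] by simp
  qed
  ultimately have "Min (index_number ` C) \<noteq> Min (index_number ` D)" by (metis disjoint_iff)
  then show ?thesis unfolding component_before_def by auto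
qed

text \<open>This rank starts at 0, whereas \<open>component\<close> counts from 1.\<close>

definition position :: "assoc_type set \<Rightarrow> nat" where
  "position C = card {D \<in> components. component_before D C}"

lemma finite_components: "finite components" and card_components: "card components = 4001"
  using orbit_union_orbits by (auto simp: nonisolated_components_9)

lemma position_inj: "inj_on position components"
  and position_less: "C \<in> components \<Longrightarrow> position C < 4001"
proof -
  have tr: "component_before A C" if "component_before A B" "component_before B C" for A B C
    using that by (auto simp: component_before_def)
  have ir: "\<not> component_before A A" for A by (simp add: component_before_def)
  note * = card_predecessors[of components component_before, OF finite_components ir tr
      component_before_total]
  show "inj_on position components" using *(1) by (simp add: position_def[abs_def])
  show "C \<in> components \<Longrightarrow> position C < 4001" using *(2) by (simp add: position_def card_components)
qed

lemma component_position: "C \<in> components \<Longrightarrow> component 9 (position C + 1) = C"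
  unfolding component_def
  by (rule the_equality) (use position_inj in \<open>auto simp: position_def[symmetric] inj_on_def\<close>)

lemma big_type: "check_orbit (8, 120, big_type)"
  using check_orbits_orbits big_type_in_orbits by (auto simp: check_orbits_def list_all_iff)

lemmas big_orbit = check_orbit_correct[OF big_type]

lemma big_orbit_subset: "orbit big_type \<subseteq> components"
  using big_type_in_orbits unfolding nonisolated_components_9 orbit_union_def by force

lemma before_big_orbit: "C \<in> orbit big_type \<Longrightarrow> D \<in> components - orbit big_type \<Longrightarrow> component_before D C"
  using orbit_unionD(4)[of D] big_orbit(3)[of C]
  by (auto simp: component_before_def nonisolated_components_9)

lemma card_small_components: "card (components - orbit big_type) = 3993"
  using card_Diff_subset[OF _ big_orbit_subset] finite_subset[OF big_orbit_subset finite_components]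
    big_orbit(2) card_components
  by simp

text \<open>All 4001 - 8 smaller components come first, which leaves exactly eight ranks for the
  eight components of the orbit.\<close>

lemma position_big_orbit: "position ` orbit big_type = {3993..<4001}"
proof (rule card_subset_eq)
  show "position ` orbit big_type \<subseteq> {3993..<4001}"
  proof
    fix k assume "k \<in> position ` orbit big_type"
    then obtain C where C: "C \<in> orbit big_type" "k = position C" by blast
    have "components - orbit big_type \<subseteq> {D \<in> components. component_before D C}"
      using before_big_orbit[OF C(1)] by blast
    then have "card (components - orbit big_type) \<le> position C"
      unfolding position_def by (intro card_mono) (simp_all add: finite_components)
    then show "k \<in> {3993..<4001}"
      using card_small_components position_less[of C] C big_orbit_subset by auto
  qed
  have "inj_on position (orbit big_type)" by (rule inj_on_subset[OF position_inj big_orbit_subset])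
  then show "card (position ` orbit big_type) = card {3993..<4001::nat}"
    using big_orbit(2) by (simp add: card_image)
qed simp

text \<open>Among components of equal size the smallest vertex decides, and
  \<open>check_orbit\<close> has verified that no vertex of the orbit is below
  \<open>big_type\<close>.\<close>

lemma position_big_class: "position (connected_class big_type) = 3993"
proof -
  let ?C = "connected_class big_type"
  have C: "?C \<in> orbit big_type" by (rule orbit_refl[OF big_orbit(1)])
  have "\<not> component_before D ?C" if D: "D \<in> orbit big_type" for D
  proof -
    have "index_number big_type \<le> index_number t" if "t \<in> D" for t
    proof (rule index_number_le[OF big_orbit(1)])
      show "t \<in> assoc_types 9" using componentsD(4) big_orbit_subset D that by blast
      show "\<not> type_less t big_type" using big_orbit(3)[OF D] that by blast
    qed
    then have "index_number big_type \<le> Min (index_number ` D)"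
      using big_orbit(3)[OF D] by simp
    moreover have "Min (index_number ` ?C) \<le> index_number big_type"
      using big_orbit(3)[OF C] connected_class_refl by (intro Min_le) auto
    ultimately have "Min (index_number ` ?C) \<le> Min (index_number ` D)" by (rule order_trans[rotated])
    moreover have "card D = card ?C" using big_orbit(3)[OF D] big_orbit(3)[OF C] by simp
    ultimately show ?thesis unfolding component_before_def by (metis less_irrefl not_less)
  qed
  then have "{D \<in> components. component_before D ?C} = components - orbit big_type"
    using before_big_orbit[OF C] by blast
  then show ?thesis unfolding position_def using card_small_components by simp
qed

lemma component_3994: "component 9 3994 = connected_class big_type"
  using component_position[of "connected_class big_type"] orbit_refl[OF big_orbit(1)] big_orbit_subset
  by (auto simp: position_big_class)

lemma component_in_big_orbit: "N \<in> {3994..4001} \<Longrightarrow> component 9 N \<in> orbit big_type"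
proof -
  assume "N \<in> {3994..4001}"
  then have "N - 1 \<in> position ` orbit big_type" "N - 1 + 1 = N" by (auto simp: position_big_orbit)
  then show "component 9 N \<in> orbit big_type" using component_position big_orbit_subset by fastforce
qed

lemma ex_component_number:
  assumes "C \<in> orbit big_type" shows "\<exists>N \<in> {3994..4001}. component 9 N = C"
proof
  show "component 9 (position C + 1) = C" using component_position big_orbit_subset assms by blast
  have "position C \<in> {3993..<4001}" using assms position_big_orbit by blast
  then show "position C + 1 \<in> {3994..4001}" by simp
qed

lemma left_in_big_class: "type_of left_side \<in> connected_class big_type"
proof -
  have "search 1000 [] [big_type] \<noteq> []" using mem_big_class by (auto simp: mem_def)
  then show ?thesis
    using search_eq_rtrancl(1)[of 1000 big_type] mem_big_class by (simp add: mem_def connected_class_def)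
qed

section \<open>Dihedral symmetry of the eight largest components\<close>

lemma orbit_cases:
  assumes "C \<in> orbit big_type"
  obtains g where "g \<in> D8" "C = D8_act g ` connected_class big_type"
  using assms D8_act_connected_class[OF _ big_orbit(1)] by (auto simp: orbit_def)

lemma D8_act_orbit:
  assumes "g \<in> D8" "C \<in> orbit big_type" shows "D8_act g ` C \<in> orbit big_type"
proof -
  obtain h where h: "h \<in> D8" "C = connected_class (D8_act h big_type)"
    using assms(2) by (auto simp: orbit_def)
  obtain k where "k \<in> D8" "D8_act g (D8_act h big_type) = D8_act k big_type"
    using D8_act_comp[OF assms(1) h(1)] by blast
  then show ?thesis
    using D8_act_connected_class[OF assms(1) D8_act_assoc_types[OF big_orbit(1)], of h] h(2)
    by (auto simp: orbit_def)
qed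

text \<open>Both components are images of the class of \<open>big_type\<close>; the element sought
  is \<open>h\<close> after the inverse of \<open>g\<close>.\<close>

lemma orbit_transitive:
  assumes "C \<in> orbit big_type" "D \<in> orbit big_type"
  shows "\<exists>g \<in> D8. D = D8_act g ` C"
proof -
  let ?B = "connected_class big_type"
  obtain g where g: "g \<in> D8" "C = D8_act g ` ?B" using orbit_cases[OF assms(1)] .
  obtain h where h: "h \<in> D8" "D = D8_act h ` ?B" using orbit_cases[OF assms(2)] .
  obtain i where i: "i \<in> D8" "\<And>t :: assoc_type. right_normal t \<Longrightarrow> D8_act i (D8_act g t) = t"
    using D8_act_inverse[OF g(1)] by blast
  obtain k where k: "k \<in> D8" "\<And>t :: assoc_type. D8_act h (D8_act i t) = D8_act k t"
    using D8_act_comp[OF h(1) i(1)] by blast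
  have "D8_act k (D8_act g t) = D8_act h t" if "t \<in> ?B" for t
    using that connected_class_subset[OF big_orbit(1)] i(2)[of t] k(2)[of "D8_act g t"]
    by (auto simp: assoc_types_def)
  then have "D = D8_act k ` C" by (auto simp: g(2) h(2) image_image)
  then show ?thesis using k(1) by blast
qed

text \<open>The action commutes with \<open>type_of\<close>, is injective on right-normal monomials
  and preserves reachability in both directions, so it carries the fibre over one type to the fibre
  over the image type.\<close>

lemma two_lifts_D8_act:
  assumes "two_lifts n m0 m1" "g \<in> D8" shows "two_lifts n (D8_act g m0) (D8_act g m1)"
proof -
  interpret two_lifts n m0 m1 by (rule assms(1))
  have rn: "right_normal m0" "right_normal m1"
    using m0 lifts_over_multilinear[OF base_lifts(2)] by (auto simp: multilinear_def)
  show ?thesis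
  proof
    show "D8_act g m0 \<in> multilinear n" by (rule D8_act_multilinear[OF m0])
    show "D8_act g m1 \<noteq> D8_act g m0"
      using inj_onD[OF D8_act_inj[OF assms(2)], of m1 m0] m1(1) rn by auto
    show "type_of (D8_act g m1) = type_of (D8_act g m0)" using m1(2) by (simp add: type_of_D8_act)
    show "(D8_act g m0, D8_act g m1) \<in> monomial_rel\<^sup>*" by (rule D8_act_rtrancl[OF m1(3) rn(1)])
    fix m assume m: "(D8_act g m0, m) \<in> monomial_rel\<^sup>*" "type_of m = type_of (D8_act g m0)"
    have "right_normal m" using m(1) right_normal_rtrancl right_normal_D8_act by blast
    then obtain u where u: "right_normal u" "D8_act g u = m" using D8_act_surj[OF assms(2)] by blast
    have "(m0, u) \<in> monomial_rel\<^sup>*" using D8_act_rtrancl_iff[OF assms(2) rn(1) u(1)] m(1) u(2) by simp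
    moreover have "D8_act g (type_of u) = D8_act g (type_of m0)"
      using m(2) unfolding u(2)[symmetric] type_of_D8_act .
    then have "type_of u = type_of m0"
      using inj_onD[OF D8_act_inj[OF assms(2)], of "type_of u" "type_of m0"] u(1) rn by simp
    ultimately show "m = D8_act g m0 \<or> m = D8_act g m1" using lifts u(2) by blast
  qed
qed

text \<open>The completed search lists everything reachable from the left side, so the fibre over
  its type can be read off.\<close>

lemma two_lifts_left_right: "two_lifts 9 left_side right_side"
proof
  have s: "search 1000 [] [left_side] \<noteq> []" "right_side \<in> set (search 1000 [] [left_side])"
    "only_two (type_of left_side) left_side right_side (search 1000 [] [left_side])"
    using check_lifts by (auto simp: check_lifts_def)
  note set = search_eq_rtrancl(1)[OF s(1)]
  show "left_side \<in> multilinear 9"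
    by (auto simp: multilinear_def left_side_def monomial_3994_def)
  show "right_side \<noteq> left_side"
    by (simp add: right_side_def left_side_def monomial_3994_def)
  show "type_of right_side = type_of left_side"
    by (simp add: right_side_def left_side_def monomial_3994_def type_of_def)
  show "(left_side, right_side) \<in> monomial_rel\<^sup>*" using s(2) set by simp
  show "m = left_side \<or> m = right_side"
    if "(left_side, m) \<in> monomial_rel\<^sup>*" "type_of m = type_of left_side" for m
    using s(3) that unfolding only_two_def set by simp
qed

lemma component_class_H:
  "component_class.H n t = G_graph n \<restriction> connected_class t" if "t \<in> assoc_types n"
  using component_class.H_def[of n t] component_class.C_def[of n t] that
  by (simp add: component_class_def)

lemma component_3994_class: "component 9 3994 = connected_class (type_of left_side)"
  using component_3994 connected_class_eq[OF big_orbit(1) left_in_big_class] by simp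

theorem theorem4p3:
  shows
    "(\<forall>cs es. is_cycle_basis (component_graph 9 3994) cs \<and>
              distinct es \<and> set es = edges (component_graph 9 3994) \<longrightarrow>
        (\<exists>C \<in> canonical_cycles es cs. nontrivial (component_graph 9 3994) C) \<and>
        (\<forall>C \<in> canonical_cycles es cs. nontrivial (component_graph 9 3994) C \<longrightarrow>
           (\<exists>\<epsilon> \<gamma>. traverses (component_graph 9 3994) \<gamma> C \<and>
              produces_property 9 \<epsilon> \<gamma> left_side right_side) \<and>
           (\<forall>\<epsilon> v \<gamma>. traverses (component_graph 9 3994) \<gamma> C \<and>
              pre_digraph.awalk (G_graph 9) (type_of left_side) \<epsilon> v \<and>
              pre_digraph.awalk (G_graph 9) v \<gamma> v \<longrightarrow>
              produces_property 9 \<epsilon> \<gamma> left_side right_side)))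
     \<and> type_of left_side \<in> component 9 3994
     \<and> right_side = map_monomial (Transposition.transpose 3 5) left_side
     \<and> (\<forall>(S :: 'a set) hc vc. double_semigroup S hc vc \<longrightarrow> satisfies S hc vc left_side right_side)
     \<and> (\<forall>a b c d e f g h (i :: nat).
          monomial_3994 a b c d e f g h i =
            row_vector [column_vector [Var a, Var b],
                        column_vector [Var c,
                          row_vector [column_vector [Var d, Var e],
                                      column_vector [Var f, Var g],
                                      column_vector [Var h, Var i]]]])
     \<and> (\<forall>g \<in> D8. \<forall>N \<in> {3994..4001}. \<exists>M \<in> {3994..4001}.
          induces_bijection 9 g (component 9 N) (component 9 M))
     \<and> (\<forall>N \<in> {3994..4001}. \<forall>M \<in> {3994..4001}. \<exists>g \<in> D8.
          induces_bijection 9 g (component 9 N) (component 9 M))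
     \<and> (\<forall>N \<in> {3994..4001}. \<forall>g \<in> D8.
          induces_bijection 9 g (component 9 3994) (component 9 N) \<longrightarrow>
            type_of (D8_act g left_side) \<in> component 9 N \<and>
            (\<exists>\<epsilon> \<gamma> C. traverses (component_graph 9 N) \<gamma> C \<and>
               produces_property 9 \<epsilon> \<gamma> (D8_act g left_side) (D8_act g right_side)) \<and>
            (\<forall>(S :: 'a set) hc vc. double_semigroup S hc vc \<longrightarrow>
               satisfies S hc vc (D8_act g left_side) (D8_act g right_side)))"
proof (intro conjI ballI allI impI; (elim conjE)?)
  interpret L: two_lifts 9 left_side right_side by (rule two_lifts_left_right)
  have left: "type_of left_side \<in> assoc_types 9" by (rule type_of_multilinear[OF L.m0])
  have H: "L.H = component_graph 9 3994"
    by (simp add: component_class_H[OF left] component_3994_class)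
  have subset: "component 9 N \<subseteq> assoc_types 9" if "N \<in> {3994..4001}" for N
    using componentsD(4) big_orbit_subset component_in_big_orbit[OF that] by blast
  {
    fix cs es
    assume "is_cycle_basis (component_graph 9 3994) cs" "distinct es"
      "set es = edges (component_graph 9 3994)"
    note p = L.cycle_basis_property[unfolded H, OF this]
    show "\<exists>C \<in> canonical_cycles es cs. nontrivial (component_graph 9 3994) C" using p by blast
    fix C assume "C \<in> canonical_cycles es cs" "nontrivial (component_graph 9 3994) C"
    then show "\<exists>\<epsilon> \<gamma>. traverses (component_graph 9 3994) \<gamma> C \<and>
        produces_property 9 \<epsilon> \<gamma> left_side right_side"
      and "\<And>\<epsilon> v \<gamma>. traverses (component_graph 9 3994) \<gamma> C \<Longrightarrow>
        pre_digraph.awalk (G_graph 9) (type_of left_side) \<epsilon> v \<Longrightarrow>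
        pre_digraph.awalk (G_graph 9) v \<gamma> v \<Longrightarrow> produces_property 9 \<epsilon> \<gamma> left_side right_side"
      using p by blast+
  next
    show "type_of left_side \<in> component 9 3994"
      by (simp add: component_3994_class connected_class_refl)
    show "right_side = map_monomial (Transposition.transpose 3 5) left_side"
      by (simp add: right_side_def left_side_def monomial_3994_def transpose_def)
    show "satisfies S hc vc left_side right_side" if "double_semigroup S hc vc" for S :: "'a set" and hc vc
      by (rule rtrancl_satisfies[OF that L.m1(3)])
    show "monomial_3994 a b c d e f g h i =
            row_vector [column_vector [Var a, Var b],
                        column_vector [Var c,
                          row_vector [column_vector [Var d, Var e],
                                      column_vector [Var f, Var g],
                                      column_vector [Var h, Var i]]]]"
      for a b c d e f g h and i :: nat
      by (simp add: monomial_3994_def)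
  next
    fix g N assume g: "g \<in> D8" and N: "N \<in> {3994..4001::nat}"
    \<comment> \<open>The action maps the orbit of components to itself, and the numbers 3994 to
      4001 enumerate exactly this orbit.\<close>
    show "\<exists>M \<in> {3994..4001}. induces_bijection 9 g (component 9 N) (component 9 M)"
      using ex_component_number[OF D8_act_orbit[OF g component_in_big_orbit[OF N]]]
        induces_bijection_iff[OF g subset[OF N]] by metis
  next
    fix N M assume N: "N \<in> {3994..4001::nat}" and M: "M \<in> {3994..4001::nat}"
    show "\<exists>g \<in> D8. induces_bijection 9 g (component 9 N) (component 9 M)"
      using orbit_transitive[OF component_in_big_orbit[OF N] component_in_big_orbit[OF M]]
        induces_bijection_iff[OF _ subset[OF N]] by metis
  next
    fix N g assume N: "N \<in> {3994..4001::nat}" and g: "g \<in> D8"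
      and b: "induces_bijection 9 g (component 9 3994) (component 9 N)"
    interpret T: two_lifts 9 "D8_act g left_side" "D8_act g right_side"
      by (rule two_lifts_D8_act[OF two_lifts_left_right g])
    \<comment> \<open>The assumed bijection identifies component \<open>N\<close> as the image of
      component 3994, hence as the class of the transformed left side.\<close>
    have "component 9 N = D8_act g ` connected_class (type_of left_side)"
      using b induces_bijection_iff[OF g subset[of 3994]] component_3994_class by simp
    then have N': "component 9 N = connected_class (type_of (D8_act g left_side))"
      using D8_act_connected_class[OF g left] by (simp add: type_of_D8_act)
    then show "type_of (D8_act g left_side) \<in> component 9 N" by (simp add: connected_class_refl)
    have "T.H = component_graph 9 N"
      unfolding N' by (rule component_class_H[OF type_of_multilinear[OF T.m0]])
    then show "\<exists>\<epsilon> \<gamma> C. traverses (component_graph 9 N) \<gamma> C \<and>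
        produces_property 9 \<epsilon> \<gamma> (D8_act g left_side) (D8_act g right_side)"
      using T.ex_traverses_produces_property by simp
    show "satisfies S hc vc (D8_act g left_side) (D8_act g right_side)"
      if "double_semigroup S hc vc" for S :: "'a set" and hc vc
      by (rule rtrancl_satisfies[OF that T.m1(3)])
  }
qed

end
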